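(* Let $G$ be a Lie group with Lie algebra $\mathfrak g$, and let $E=E(g,\mu,\xi,\nu)$ be a smooth function (Lagrangian) on ${}^{1}TT^*G=(G\circledS\mathfrak g_1^* )\circledS(\mathfrak g_2\circledS\mathfrak g_3^* )$ (as a manifold $G\times\mathfrak g^*\times\mathfrak g\times\mathfrak g^*$). The extremals of the action integral $\int_a^bE(g,\mu,\xi,\nu)\,dt$ with respect to the variations $$\delta g=T_eR_g\eta,\quad \delta\mu=\lambda+ad^*_\eta\mu,\quad \delta\xi=\dot\eta+[\xi,\eta],\quad \delta\nu=\dot\lambda+ad^*_\eta\nu-ad^*_\xi\lambda,$$ with $(\eta,\lambda)$ an arbitrary curve in $\mathfrak g\circledS\mathfrak g^*$ vanishing at the end points, are the curves satisfying the trivialized Euler–Lagrange equations $$\frac{d}{dt}\Big(\frac{\delta E}{\delta\xi}\Big)=T_e^*R_g\Big(\frac{\delta E}{\delta g}\Big)-ad^*_{\frac{\delta E}{\delta\mu}}\mu+ad^*_\xi\Big(\frac{\delta E}{\delta\xi}\Big)-ad^*_{\frac{\delta E}{\delta\nu}}\nu,$$ $$\frac{d}{dt}\Big(\frac{\delta E}{\delta\nu}\Big)=\frac{\delta E}{\delta\mu}-ad_\xi\frac{\delta E}{\delta\nu}.$$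
   Context: Conventions. $G$ is a (finite-dimensional) Lie group with identity $e$, $\mathfrak g=T_eG$, $\mathfrak g^*$ its dual, $\mathfrak g^{**}=\mathfrak g$. $R_g$ is right translation and $T_e^*R_g:T_g^*G\to\mathfrak g^*$ is the dual of $T_eR_g$. $Ad_g$ is the tangent map at $e$ of $h\mapsto g^{-1}hg$; the Lie bracket is $[\xi,\eta]=ad_\xi\eta=\frac{d}{dt}|_{t=0}Ad_{\exp(t\xi)}\eta$ (the bracket of right invariant vector fields). $\langle ad^*_\xi\mu,\eta\rangle=\langle\mu,[\xi,\eta]\rangle$. Partial derivatives: $\delta E/\delta g\in T_g^*G$, $\delta E/\delta\mu,\delta E/\delta\nu\in\mathfrak g$, $\delta E/\delta\xi\in\mathfrak g^*$. ${}^{1}TT^*G$ is the right trivialization of $T(G\circledS\mathfrak g^* )$, where $G\circledS\mathfrak g^*$ is the right trivialization of $T^*G$; subscripts on copies of $\mathfrak g,\mathfrak g^*$ are only labels. The Lie algebra $\mathfrak g\circledS\mathfrak g^*$ of $G\circledS\mathfrak g^*$ has bracket $[(\xi,\nu),(\eta,\lambda)]=([\xi,\eta],ad^*_\eta\nu-ad^*_\xi\lambda)$. *)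

theory Defs
  imports "HOL-Analysis.Analysis" "HOL-Algebra.Group"
begin

section \<open>Smooth maps between manifolds given by atlases\<close>

text \<open>
  On an open subset of a finite-dimensional space, a function is of class \<open>C\<^sup>k\<^sup>+\<^sup>1\<close> iff it is
  differentiable and all its directional derivatives are of class \<open>C\<^sup>k\<close>. The two predicates below are
  used only for open sets \<open>S\<close> and finite-dimensional domains.
\<close>

primrec ck_on :: "nat \<Rightarrow> 'a set \<Rightarrow> ('a::real_normed_vector \<Rightarrow> 'b::real_normed_vector) \<Rightarrow> bool" where
  "ck_on 0 S f \<longleftrightarrow> continuous_on S f"
| "ck_on (Suc k) S f \<longleftrightarrow>
     (\<forall>x\<in>S. f differentiable (at x)) \<and> (\<forall>v. ck_on k S (\<lambda>x. frechet_derivative f (at x) v))"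

definition smooth_on :: "'a set \<Rightarrow> ('a::real_normed_vector \<Rightarrow> 'b::real_normed_vector) \<Rightarrow> bool" where
  "smooth_on S f \<longleftrightarrow> (\<forall>k. ck_on k S f)"

text \<open>A chart is its domain together with the coordinate map; the values of the latter outside the
  domain are irrelevant.\<close>

type_synonym ('m, 'v) chart = "'m set \<times> ('m \<Rightarrow> 'v)"

definition smooth_atlas :: "('m::topological_space, 'v::real_normed_vector) chart set \<Rightarrow> bool" where
  "smooth_atlas A \<longleftrightarrow>
     (\<forall>(U, \<phi>)\<in>A. open U \<and> open (\<phi> ` U) \<and> homeomorphism U (\<phi> ` U) \<phi> (inv_into U \<phi>)) \<and>
     (\<Union>(U, \<phi>)\<in>A. U) = UNIV \<and>
     (\<forall>(U, \<phi>)\<in>A. \<forall>(V, \<psi>)\<in>A. smooth_on (\<phi> ` (U \<inter> V)) (\<psi> \<circ> inv_into U \<phi>))"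

definition vec_atlas :: "('v, 'v) chart set" where
  "vec_atlas = {(UNIV, id)}"

definition prod_atlas ::
  "('m, 'v) chart set \<Rightarrow> ('n, 'w) chart set \<Rightarrow> ('m \<times> 'n, 'v \<times> 'w) chart set" where
  "prod_atlas A B = {(U \<times> V, map_prod \<phi> \<psi>) | U \<phi> V \<psi>. (U, \<phi>) \<in> A \<and> (V, \<psi>) \<in> B}"

text \<open>\<open>f\<close>, restricted to the open subset \<open>W\<close> of the manifold with atlas \<open>A\<close>, is a smooth map into the
  manifold with atlas \<open>B\<close>.\<close>

definition smooth_map_on ::
  "('m::topological_space, 'v::real_normed_vector) chart set \<Rightarrow> 'm set \<Rightarrow>
   ('n::topological_space, 'w::real_normed_vector) chart set \<Rightarrow> ('m \<Rightarrow> 'n) \<Rightarrow> bool" where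
  "smooth_map_on A W B f \<longleftrightarrow> open W \<and> continuous_on W f \<and>
     (\<forall>(U, \<phi>)\<in>A. \<forall>(V, \<psi>)\<in>B. smooth_on (\<phi> ` (W \<inter> U \<inter> f -` V)) (\<psi> \<circ> f \<circ> inv_into U \<phi>))"

text \<open>The tangent space at \<open>p\<close> is represented by the model space, through a chart around \<open>p\<close> chosen once
  and for all; the tangent map is then the derivative of the coordinate expression of \<open>f\<close>. For
  \<open>vec_atlas\<close> this is the usual identification of a vector space with its tangent spaces.\<close>

definition chart_at :: "('m, 'v) chart set \<Rightarrow> 'm \<Rightarrow> ('m, 'v) chart" where
  "chart_at A p = (SOME c. c \<in> A \<and> p \<in> fst c)"

definition tangent_map ::
  "('m, 'v::real_normed_vector) chart set \<Rightarrow> ('n, 'w::real_normed_vector) chart set \<Rightarrow>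
   ('m \<Rightarrow> 'n) \<Rightarrow> 'm \<Rightarrow> 'v \<Rightarrow> 'w" where
  "tangent_map A B f p =
     (let (U, \<phi>) = chart_at A p; (V, \<psi>) = chart_at B (f p)
      in frechet_derivative (\<psi> \<circ> f \<circ> inv_into U \<phi>) (at (\<phi> p)))"

definition velocity :: "('m, 'v::real_normed_vector) chart set \<Rightarrow> (real \<Rightarrow> 'm) \<Rightarrow> real \<Rightarrow> 'v" where
  "velocity A c t = tangent_map vec_atlas A c t 1"

text \<open>Smoothness on a compact interval means smoothness on an open neighbourhood of it.\<close>

definition smooth_curve ::
  "('m::topological_space, 'v::real_normed_vector) chart set \<Rightarrow> real \<Rightarrow> real \<Rightarrow> (real \<Rightarrow> 'm) \<Rightarrow> bool" where
  "smooth_curve A a b c \<longleftrightarrow> (\<exists>T. {a..b} \<subseteq> T \<and> smooth_map_on vec_atlas T A c)"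


section \<open>Lie groups\<close>

record ('g, 'v) lie_struct = "'g monoid" +
  atlas :: "('g, 'v) chart set"

locale lie_group = group G
  for G :: "('g::{t2_space, second_countable_topology}, 'v::euclidean_space, 'z) lie_struct_scheme"
    (structure) +
  assumes carrier_UNIV: "carrier G = UNIV"
    and atlas: "smooth_atlas (atlas G)"
    and smooth_mult: "smooth_map_on (prod_atlas (atlas G) (atlas G)) UNIV (atlas G) (\<lambda>(x, y). x \<otimes> y)"
    and smooth_inv: "smooth_map_on (atlas G) UNIV (atlas G) (\<lambda>x. inv x)"

text \<open>With the above representation of tangent spaces, the type \<open>'v\<close> is the Lie algebra, i.e. the
  tangent space at the identity, and also every other tangent space of the group.\<close>

type_synonym 'v dual = "'v \<Rightarrow>\<^sub>L real"

definition TR :: "('g, 'v::real_normed_vector, 'z) lie_struct_scheme \<Rightarrow> 'g \<Rightarrow> 'v \<Rightarrow> 'v" where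
  "TR G g = tangent_map (atlas G) (atlas G) (\<lambda>h. h \<otimes>\<^bsub>G\<^esub> g) \<one>\<^bsub>G\<^esub>"

definition TR_dual ::
  "('g, 'v::real_normed_vector, 'z) lie_struct_scheme \<Rightarrow> 'g \<Rightarrow> 'v dual \<Rightarrow> 'v dual" where
  "TR_dual G g \<alpha> = Blinfun (\<lambda>\<eta>. blinfun_apply \<alpha> (TR G g \<eta>))"

definition Ad :: "('g, 'v::real_normed_vector, 'z) lie_struct_scheme \<Rightarrow> 'g \<Rightarrow> 'v \<Rightarrow> 'v" where
  "Ad G g = tangent_map (atlas G) (atlas G) (\<lambda>h. inv\<^bsub>G\<^esub> g \<otimes>\<^bsub>G\<^esub> h \<otimes>\<^bsub>G\<^esub> g) \<one>\<^bsub>G\<^esub>"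

definition one_param_subgroup ::
  "('g::topological_space, 'v::real_normed_vector, 'z) lie_struct_scheme \<Rightarrow> (real \<Rightarrow> 'g) \<Rightarrow> bool" where
  "one_param_subgroup G \<gamma> \<longleftrightarrow>
     smooth_map_on vec_atlas UNIV (atlas G) \<gamma> \<and> (\<forall>s t. \<gamma> (s + t) = \<gamma> s \<otimes>\<^bsub>G\<^esub> \<gamma> t)"

definition lie_exp ::
  "('g::topological_space, 'v::real_normed_vector, 'z) lie_struct_scheme \<Rightarrow> 'v \<Rightarrow> 'g" where
  "lie_exp G \<xi> = (THE \<gamma>. one_param_subgroup G \<gamma> \<and> velocity (atlas G) \<gamma> 0 = \<xi>) 1"

text \<open>Because \<open>Ad\<close> is built from conjugation by the inverse, this is the opposite of the bracket that is
  customary for left invariant vector fields.\<close>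

definition ad ::
  "('g::topological_space, 'v::real_normed_vector, 'z) lie_struct_scheme \<Rightarrow> 'v \<Rightarrow> 'v \<Rightarrow> 'v" where
  "ad G \<xi> \<eta> = vector_derivative (\<lambda>t. Ad G (lie_exp G (t *\<^sub>R \<xi>)) \<eta>) (at 0)"

definition ad_dual ::
  "('g::topological_space, 'v::real_normed_vector, 'z) lie_struct_scheme \<Rightarrow> 'v \<Rightarrow> 'v dual \<Rightarrow> 'v dual" where
  "ad_dual G \<xi> \<mu> = Blinfun (\<lambda>\<eta>. blinfun_apply \<mu> (ad G \<xi> \<eta>))"


section \<open>Lagrangians on the trivialized bundle\<close>

type_synonym ('g, 'v) lagrangian = "'g \<Rightarrow> 'v dual \<Rightarrow> 'v \<Rightarrow> 'v dual \<Rightarrow> real"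

definition smooth_lagrangian ::
  "('g::topological_space, 'v::real_normed_vector, 'z) lie_struct_scheme \<Rightarrow> ('g, 'v) lagrangian \<Rightarrow> bool" where
  "smooth_lagrangian G E \<longleftrightarrow>
     smooth_map_on (prod_atlas (atlas G) vec_atlas) UNIV vec_atlas (\<lambda>(g, \<mu>, \<xi>, \<nu>). E g \<mu> \<xi> \<nu>)"

definition d_g :: "('g, 'v::real_normed_vector, 'z) lie_struct_scheme \<Rightarrow> ('g, 'v) lagrangian \<Rightarrow>
    'g \<Rightarrow> 'v dual \<Rightarrow> 'v \<Rightarrow> 'v dual \<Rightarrow> 'v dual" where
  "d_g G E g \<mu> \<xi> \<nu> = Blinfun (tangent_map (atlas G) vec_atlas (\<lambda>h. E h \<mu> \<xi> \<nu>) g)"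

definition d_xi :: "('g, 'v::real_normed_vector) lagrangian \<Rightarrow>
    'g \<Rightarrow> 'v dual \<Rightarrow> 'v \<Rightarrow> 'v dual \<Rightarrow> 'v dual" where
  "d_xi E g \<mu> \<xi> \<nu> = Blinfun (frechet_derivative (\<lambda>x. E g \<mu> x \<nu>) (at \<xi>))"

text \<open>Derivatives in directions of the dual space are elements of the bidual, which is identified with
  the space itself.\<close>

definition of_bidual :: "('v::real_normed_vector dual \<Rightarrow> real) \<Rightarrow> 'v" where
  "of_bidual F = (THE x. \<forall>\<alpha>. F \<alpha> = blinfun_apply \<alpha> x)"

definition d_mu :: "('g, 'v::real_normed_vector) lagrangian \<Rightarrow>
    'g \<Rightarrow> 'v dual \<Rightarrow> 'v \<Rightarrow> 'v dual \<Rightarrow> 'v" where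
  "d_mu E g \<mu> \<xi> \<nu> = of_bidual (frechet_derivative (\<lambda>x. E g x \<xi> \<nu>) (at \<mu>))"

definition d_nu :: "('g, 'v::real_normed_vector) lagrangian \<Rightarrow>
    'g \<Rightarrow> 'v dual \<Rightarrow> 'v \<Rightarrow> 'v dual \<Rightarrow> 'v" where
  "d_nu E g \<mu> \<xi> \<nu> = of_bidual (frechet_derivative (\<lambda>x. E g \<mu> \<xi> x) (at \<nu>))"

definition action :: "('g, 'v::real_normed_vector) lagrangian \<Rightarrow> real \<Rightarrow> real \<Rightarrow>
    (real \<Rightarrow> 'g) \<Rightarrow> (real \<Rightarrow> 'v dual) \<Rightarrow> (real \<Rightarrow> 'v) \<Rightarrow> (real \<Rightarrow> 'v dual) \<Rightarrow> real" where
  "action E a b g \<mu> \<xi> \<nu> = integral {a..b} (\<lambda>t. E (g t) (\<mu> t) (\<xi> t) (\<nu> t))"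

text \<open>A smooth one-parameter family of curves that for parameter \<open>s = 0\<close> restricts on \<open>{a..b}\<close> to the
  given curve.\<close>

definition smooth_variation ::
  "('g::topological_space, 'v::real_normed_vector, 'z) lie_struct_scheme \<Rightarrow> real \<Rightarrow> real \<Rightarrow>
    (real \<Rightarrow> 'g) \<Rightarrow> (real \<Rightarrow> 'v dual) \<Rightarrow> (real \<Rightarrow> 'v) \<Rightarrow> (real \<Rightarrow> 'v dual) \<Rightarrow>
    (real \<Rightarrow> real \<Rightarrow> 'g) \<Rightarrow> (real \<Rightarrow> real \<Rightarrow> 'v dual) \<Rightarrow> (real \<Rightarrow> real \<Rightarrow> 'v) \<Rightarrow> (real \<Rightarrow> real \<Rightarrow> 'v dual) \<Rightarrow> bool" where
  "smooth_variation G a b g \<mu> \<xi> \<nu> gs \<mu>s \<xi>s \<nu>s \<longleftrightarrow>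
     (\<exists>\<epsilon> T. 0 < \<epsilon> \<and> {a..b} \<subseteq> T \<and> open T \<and>
        smooth_map_on vec_atlas ({-\<epsilon><..<\<epsilon>} \<times> T) (prod_atlas (atlas G) vec_atlas)
          (\<lambda>(s, t). (gs s t, \<mu>s s t, \<xi>s s t, \<nu>s s t))) \<and>
     (\<forall>t\<in>{a..b}. gs 0 t = g t \<and> \<mu>s 0 t = \<mu> t \<and> \<xi>s 0 t = \<xi> t \<and> \<nu>s 0 t = \<nu> t)"

text \<open>The infinitesimal variation of the family is the one generated by the curve \<open>(\<eta>, \<kappa>)\<close> in the
  semidirect product of the Lie algebra and its dual.\<close>

definition generated_by ::
  "('g::topological_space, 'v::real_normed_vector, 'z) lie_struct_scheme \<Rightarrow> real \<Rightarrow> real \<Rightarrow>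
    (real \<Rightarrow> 'g) \<Rightarrow> (real \<Rightarrow> 'v dual) \<Rightarrow> (real \<Rightarrow> 'v) \<Rightarrow> (real \<Rightarrow> 'v dual) \<Rightarrow>
    (real \<Rightarrow> real \<Rightarrow> 'g) \<Rightarrow> (real \<Rightarrow> real \<Rightarrow> 'v dual) \<Rightarrow> (real \<Rightarrow> real \<Rightarrow> 'v) \<Rightarrow> (real \<Rightarrow> real \<Rightarrow> 'v dual) \<Rightarrow>
    (real \<Rightarrow> 'v) \<Rightarrow> (real \<Rightarrow> 'v dual) \<Rightarrow> bool" where
  "generated_by G a b g \<mu> \<xi> \<nu> gs \<mu>s \<xi>s \<nu>s \<eta> \<kappa> \<longleftrightarrow>
     (\<forall>t\<in>{a..b}.
        velocity (atlas G) (\<lambda>s. gs s t) 0 = TR G (g t) (\<eta> t) \<and>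
        vector_derivative (\<lambda>s. \<mu>s s t) (at 0) = \<kappa> t + ad_dual G (\<eta> t) (\<mu> t) \<and>
        vector_derivative (\<lambda>s. \<xi>s s t) (at 0) =
          vector_derivative \<eta> (at t within {a..b}) + ad G (\<xi> t) (\<eta> t) \<and>
        vector_derivative (\<lambda>s. \<nu>s s t) (at 0) =
          vector_derivative \<kappa> (at t within {a..b}) + ad_dual G (\<eta> t) (\<nu> t) - ad_dual G (\<xi> t) (\<kappa> t))"

definition extremal ::
  "('g::topological_space, 'v::real_normed_vector, 'z) lie_struct_scheme \<Rightarrow> ('g, 'v) lagrangian \<Rightarrow>
    real \<Rightarrow> real \<Rightarrow>
    (real \<Rightarrow> 'g) \<Rightarrow> (real \<Rightarrow> 'v dual) \<Rightarrow> (real \<Rightarrow> 'v) \<Rightarrow> (real \<Rightarrow> 'v dual) \<Rightarrow> bool" where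
  "extremal G E a b g \<mu> \<xi> \<nu> \<longleftrightarrow>
     (\<forall>gs \<mu>s \<xi>s \<nu>s \<eta> \<kappa>.
        smooth_variation G a b g \<mu> \<xi> \<nu> gs \<mu>s \<xi>s \<nu>s \<longrightarrow>
        smooth_curve vec_atlas a b \<eta> \<longrightarrow> \<eta> a = 0 \<longrightarrow> \<eta> b = 0 \<longrightarrow>
        smooth_curve vec_atlas a b \<kappa> \<longrightarrow> \<kappa> a = 0 \<longrightarrow> \<kappa> b = 0 \<longrightarrow>
        generated_by G a b g \<mu> \<xi> \<nu> gs \<mu>s \<xi>s \<nu>s \<eta> \<kappa> \<longrightarrow>
        ((\<lambda>s. action E a b (gs s) (\<mu>s s) (\<xi>s s) (\<nu>s s)) has_real_derivative 0) (at 0))"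

end

(*
  Right translating by the curve g turns all partial derivatives of E into those of a single function
  on a vector space, taken at a point over the identity chart. Along a variation generated by
  (eta, kappa) the integrand of the action then has derivative
    <A, eta> + <dE/dxi, eta'> + <kappa, C> + <kappa', dE/dnu>,
  where A and C are the right hand sides of the two equations; this uses only that ad is bilinear and
  antisymmetric. Integration by parts leaves <A - (dE/dxi)', eta> + <kappa, C - (dE/dnu)'>. As the two
  defects are themselves smooth, they may be inserted, multiplied by (t - a)(b - t), for eta and kappa.
  Antisymmetry of ad comes from Ad (exp (t xi)) xi = xi, so it rests on the existence of one-parameter
  subgroups, which are obtained from local solutions of an ordinary differential equation.
*)
theory Submission
  imports Defs
begin

section \<open>Calculus of smooth functions\<close>

text \<open>The tangent space at a group element is read in a chart picked by choice, and the chart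
  at \<open>g t\<close> may jump with t. Smoothness in t of the translated derivative dE/dg
  therefore cannot be seen factor by factor. It comes from E at
  \<open>eparam x \<otimes> g t\<close>, whose group variable x stays in the one chart at the
  identity and in which time is a further variable. The variables of E include functionals, so the
  calculus is developed over spaces with a finite frame, a notion that covers vectors, functionals
  and products of both. \<open>generated_by\<close> prescribes only first-order data at s = 0, so a
  test family may be taken affine in s, with the group part affine in the chart at the identity. A
  group argument takes the place of a uniqueness theorem for differential equations: two curves with
  the same left velocity differ by a constant left factor. This gives both the homomorphism law of
  the local solution and the uniqueness of one-parameter subgroups, without which
  \<open>lie_exp\<close>, a definite description, would have no known value.\<close>

text \<open>Finite-dimensional spaces, which unlike \<open>euclidean_space\<close> include the dual spaces.\<close>

class fin_dim = real_normed_vector +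
  assumes fin_dim_axiom:
    "\<exists>cs :: (('a \<Rightarrow> real) \<times> 'a) list.
       (\<forall>(c, e)\<in>set cs. (\<forall>x y. c (x + y) = c x + c y) \<and> (\<forall>r x. c (r *\<^sub>R x) = r * c x) \<and>
         (\<exists>K. \<forall>x. \<bar>c x\<bar> \<le> norm x * K)) \<and>
       (\<forall>x. x = (\<Sum>(c, e)\<leftarrow>cs. c x *\<^sub>R e))"

text \<open>Folds the conditions spelled out in the class axiom back into
  \<open>bounded_linear\<close>; the instance proofs and the extraction of a frame begin with
  it.\<close>

lemma bounded_linear_real_iff:
  "bounded_linear c \<longleftrightarrow> (\<forall>x y. c (x + y) = c x + c y) \<and> (\<forall>r x. c (r *\<^sub>R x) = r * c x) \<and>
     (\<exists>K::real. \<forall>x. \<bar>c x\<bar> \<le> norm x * K)" for c :: "'a::real_normed_vector \<Rightarrow> real"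
  by (auto simp: bounded_linear_def bounded_linear_axioms_def linear_iff)

text \<open>A frame may be linearly dependent, since only the reconstruction of x is used. It turns
  a derivative in a varying direction into a finite sum of derivatives in fixed directions with
  scalar coefficients, the form that \<open>ck_on\<close> can handle.\<close>

lemma fin_dim_frame:
  obtains cs :: "(('a::fin_dim \<Rightarrow> real) \<times> 'a) list"
  where "\<And>c e. (c, e) \<in> set cs \<Longrightarrow> bounded_linear c" "\<And>x. (\<Sum>(c, e)\<leftarrow>cs. c x *\<^sub>R e) = x"
proof -
  from fin_dim_axiom obtain cs :: "(('a \<Rightarrow> real) \<times> 'a) list"
    where "\<forall>(c, e)\<in>set cs. bounded_linear c" "\<forall>x. x = (\<Sum>(c, e)\<leftarrow>cs. c x *\<^sub>R e)"
    unfolding bounded_linear_real_iff[symmetric] by (elim exE conjE)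
  then show thesis by (intro that[of cs]) (metis case_prodD, metis)
qed

instance euclidean_space \<subseteq> fin_dim
proof (intro_classes, unfold bounded_linear_real_iff[symmetric])
  obtain bs :: "'a list" where bs: "set bs = Basis" "distinct bs"
    using finite_distinct_list[OF finite_Basis] by blast
  let ?cs = "map (\<lambda>b::'a. (\<lambda>x. x \<bullet> b, b)) bs"
  have "(\<Sum>(c, e)\<leftarrow>?cs. c x *\<^sub>R e) = x" for x
    using bs by (simp add: o_def sum_list_distinct_conv_sum_set euclidean_representation)
  moreover have "\<forall>(c, e)\<in>set ?cs. bounded_linear c"
    by (auto intro: bounded_linear_inner_left)
  ultimately show "\<exists>cs :: (('a \<Rightarrow> real) \<times> 'a) list. (\<forall>(c, e)\<in>set cs. bounded_linear c) \<and>
       (\<forall>x. x = (\<Sum>(c, e)\<leftarrow>cs. c x *\<^sub>R e))"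
    by (intro exI[of _ ?cs]) auto
qed

lemma bounded_linear_sum_list:
  assumes "bounded_linear f" shows "f (sum_list xs) = sum_list (map f xs)"
proof -
  interpret bounded_linear f by fact
  show ?thesis by (induction xs) (auto simp: add zero)
qed

instance prod :: (fin_dim, fin_dim) fin_dim
proof (intro_classes, unfold bounded_linear_real_iff[symmetric])
  obtain cs :: "(('a \<Rightarrow> real) \<times> 'a) list" where cs: "\<And>c e. (c, e) \<in> set cs \<Longrightarrow> bounded_linear c"
    "\<And>x. (\<Sum>(c, e)\<leftarrow>cs. c x *\<^sub>R e) = x" by (rule fin_dim_frame) blast
  obtain ds :: "(('b \<Rightarrow> real) \<times> 'b) list" where ds: "\<And>c e. (c, e) \<in> set ds \<Longrightarrow> bounded_linear c"
    "\<And>x. (\<Sum>(c, e)\<leftarrow>ds. c x *\<^sub>R e) = x" by (rule fin_dim_frame) blast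
  \<comment> \<open>The frames of the two factors are concatenated, each extended by zero in the
    other factor.\<close>
  let ?es = "map (\<lambda>(c, e). (\<lambda>x. c (fst x), (e, 0))) cs @ map (\<lambda>(c, e). (\<lambda>x. c (snd x), (0, e))) ds"
  have "(\<Sum>(c, e)\<leftarrow>?es. c x *\<^sub>R e) = x" for x
  proof -
    have 1: "(x, 0::'b) = (\<Sum>(c, e)\<leftarrow>cs. (c x *\<^sub>R e, 0))" for x
      using bounded_linear_sum_list[of "\<lambda>x::'a. (x, 0::'b)" "map (\<lambda>(c, e). c x *\<^sub>R e) cs"] cs(2)[of x]
      by (simp add: o_def split_def bounded_linear_Pair)
    have 2: "(0::'a, y) = (\<Sum>(c, e)\<leftarrow>ds. (0, c y *\<^sub>R e))" for y
      using bounded_linear_sum_list[of "\<lambda>x::'b. (0::'a, x)" "map (\<lambda>(c, e). c y *\<^sub>R e) ds"] ds(2)[of y]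
      by (simp add: o_def split_def bounded_linear_Pair)
    show ?thesis
      using 1[of "fst x", symmetric] 2[of "snd x", symmetric]
      by (simp add: o_def split_def scaleR_prod_def)
  qed
  moreover have "\<forall>(c, e)\<in>set ?es. bounded_linear c"
    using cs(1) ds(1) by (auto intro: bounded_linear_compose[OF _ bounded_linear_fst]
      bounded_linear_compose[OF _ bounded_linear_snd])
  ultimately show "\<exists>cs :: (('a \<times> 'b \<Rightarrow> real) \<times> 'a \<times> 'b) list. (\<forall>(c, e)\<in>set cs. bounded_linear c) \<and>
       (\<forall>x. x = (\<Sum>(c, e)\<leftarrow>cs. c x *\<^sub>R e))"
    by (intro exI[of _ ?es]) auto
qed

instance blinfun :: (euclidean_space, euclidean_space) fin_dim
proof (intro_classes, unfold bounded_linear_real_iff[symmetric])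
  obtain bs :: "('a \<times> 'b) list" where bs: "set bs = Basis \<times> Basis" "distinct bs"
    using finite_distinct_list[of "Basis \<times> Basis"] by auto
  \<comment> \<open>The frame consists of the rank-one maps that send x to (i \<bullet> x) j; the
    coordinates are the matrix entries of f.\<close>
  let ?cs = "map (\<lambda>(i, j). (\<lambda>f::'a \<Rightarrow>\<^sub>L 'b. blinfun_apply f i \<bullet> j,
    blinfun_scaleR_left j o\<^sub>L blinfun_inner_right i)) bs"
  have "(\<Sum>(c, e)\<leftarrow>?cs. c f *\<^sub>R e) = f" for f :: "'a \<Rightarrow>\<^sub>L 'b"
  proof (rule blinfun_eqI)
    fix x
    have "blinfun_apply (\<Sum>(c, e)\<leftarrow>?cs. c f *\<^sub>R e) x =
       (\<Sum>i\<in>Basis. \<Sum>j\<in>Basis. (blinfun_apply f i \<bullet> j) *\<^sub>R (i \<bullet> x) *\<^sub>R j)"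
      using bs by (simp add: o_def split_def sum_list_distinct_conv_sum_set blinfun.sum_left
        blinfun.scaleR_left sum.cartesian_product)
    also have "\<dots> = (\<Sum>i\<in>Basis. (i \<bullet> x) *\<^sub>R (\<Sum>j\<in>Basis. (blinfun_apply f i \<bullet> j) *\<^sub>R j))"
      by (simp add: scaleR_sum_right mult.commute)
    also have "\<dots> = blinfun_apply f (\<Sum>i\<in>Basis. (x \<bullet> i) *\<^sub>R i)"
      unfolding euclidean_representation[of "blinfun_apply f _"]
      by (simp only: blinfun.sum_right blinfun.scaleR_right inner_commute)
    finally show "blinfun_apply (\<Sum>(c, e)\<leftarrow>?cs. c f *\<^sub>R e) x = blinfun_apply f x"
      by (simp only: euclidean_representation)
  qed
  moreover have "\<forall>(c, e)\<in>set ?cs. bounded_linear c"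
    by (auto intro!: bounded_linear_compose[OF bounded_linear_inner_left] blinfun.bounded_linear_left)
  ultimately show "\<exists>cs :: ((('a \<Rightarrow>\<^sub>L 'b) \<Rightarrow> real) \<times> ('a \<Rightarrow>\<^sub>L 'b)) list.
       (\<forall>(c, e)\<in>set cs. bounded_linear c) \<and> (\<forall>x. x = (\<Sum>(c, e)\<leftarrow>cs. c x *\<^sub>R e))"
    by (intro exI[of _ ?cs]) auto
qed

section \<open>Closure properties of functions of class C^k\<close>

lemma ck_on_subset: "ck_on k S f \<Longrightarrow> T \<subseteq> S \<Longrightarrow> ck_on k T f"
  by (induction k arbitrary: f) (auto intro: continuous_on_subset)

lemma frechet_derivative_cong_open:
  assumes "open S" "x \<in> S" "\<And>x. x \<in> S \<Longrightarrow> f x = g x"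
  shows "frechet_derivative f (at x) = frechet_derivative g (at x)"
proof -
  have "(f has_derivative D) (at x) \<longleftrightarrow> (g has_derivative D) (at x)" for D
    using has_derivative_transform_within_open[of _ D x UNIV S] assms by metis
  then show ?thesis by (simp add: frechet_derivative_def)
qed

text \<open>Since \<open>S\<close> is open, agreement on \<open>S\<close> passes to the derivatives,
  which the induction compares next.\<close>

lemma ck_on_cong:
  assumes "open S" "\<And>x. x \<in> S \<Longrightarrow> f x = g x" "ck_on k S f"
  shows "ck_on k S g"
  using assms(2,3)
proof (induction k arbitrary: f g)
  case 0
  then show ?case using continuous_on_cong[of S S f g] by auto
next
  case (Suc k)
  have "g differentiable (at x)" if "x \<in> S" for x
    using has_derivative_transform_within_open[of f _ x UNIV S g] Suc.prems assms(1) that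
    by (auto simp: differentiable_def) metis
  moreover have "ck_on k S (\<lambda>x. frechet_derivative g (at x) v)" for v
    using Suc.IH[of "\<lambda>x. frechet_derivative f (at x) v" "\<lambda>x. frechet_derivative g (at x) v"]
      frechet_derivative_cong_open[of S _ f g] Suc.prems assms(1) by auto
  ultimately show ?case by simp
qed

lemma ck_on_SucD: "ck_on (Suc k) S f \<Longrightarrow> ck_on k S f"
proof (induction k arbitrary: f)
  case 0
  then show ?case
    by (auto intro!: continuous_at_imp_continuous_on differentiable_imp_continuous_within)
next
  case (Suc k)
  then show ?case by (metis ck_on.simps(2))
qed

text \<open>Any explicit formula for the derivative may stand in for
  \<open>frechet_derivative\<close>, with which it agrees on \<open>S\<close>. The closure proofs
  below supply the sum, product and chain rules in this way.\<close>

lemma ck_on_SucI: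
  assumes "open S" "\<And>x. x \<in> S \<Longrightarrow> (f has_derivative D x) (at x)" "\<And>v. ck_on k S (\<lambda>x. D x v)"
  shows "ck_on (Suc k) S f"
proof -
  have "ck_on k S (\<lambda>x. frechet_derivative f (at x) v)" for v
    by (rule ck_on_cong[OF assms(1) _ assms(3)[of v]]) (metis assms(2) frechet_derivative_at)
  then show ?thesis using assms(2) by (auto simp: differentiable_def)
qed

lemma ck_on_SucE:
  assumes "ck_on (Suc k) S f" "x \<in> S"
  shows "(f has_derivative frechet_derivative f (at x)) (at x)"
  using assms by (simp add: frechet_derivative_works)

lemma ck_on_const: "open S \<Longrightarrow> ck_on k S (\<lambda>x. c)"
  by (induction k arbitrary: c) (auto simp del: ck_on.simps(2) intro!: ck_on_SucI[where D="\<lambda>_ _. 0"])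

lemma ck_on_linear:
  assumes "open S" "bounded_linear L" shows "ck_on k S L"
proof (cases k)
  case 0
  then show ?thesis using assms by (simp add: linear_continuous_on)
next
  case (Suc n)
  then show ?thesis
    using assms ck_on_SucI[of S L "\<lambda>_. L" n] ck_on_const bounded_linear_imp_has_derivative by blast
qed

lemma ck_on_bounded_linear:
  assumes "open S" "bounded_linear L" "ck_on k S f" shows "ck_on k S (\<lambda>x. L (f x))"
  using assms(3)
proof (induction k arbitrary: f)
  case 0
  then show ?case using assms by (simp add: bounded_linear.continuous_on)
next
  case (Suc k)
  show ?case
  proof (intro ck_on_SucI assms(1))
    show "((\<lambda>x. L (f x)) has_derivative (\<lambda>v. L (frechet_derivative f (at x) v))) (at x)" if "x \<in> S" for x
      using Suc.prems that by (intro bounded_linear.has_derivative[OF assms(2)] ck_on_SucE)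
  qed (use Suc in simp)
qed

lemma ck_on_add:
  assumes "open S" "ck_on k S f" "ck_on k S g" shows "ck_on k S (\<lambda>x. f x + g x)"
  using assms(2,3)
proof (induction k arbitrary: f g)
  case 0
  then show ?case by (simp add: continuous_on_add)
next
  case (Suc k)
  show ?case
  proof (intro ck_on_SucI assms(1))
    show "((\<lambda>x. f x + g x) has_derivative
        (\<lambda>v. frechet_derivative f (at x) v + frechet_derivative g (at x) v)) (at x)" if "x \<in> S" for x
      using Suc.prems that by (intro has_derivative_add ck_on_SucE)
  qed (use Suc in simp)
qed

text \<open>The product rule gives two terms, each with one factor differentiated. The other factor
  is still of class C^(k+1) and must be lowered by \<open>ck_on_SucD\<close> before the induction
  hypothesis applies.\<close>

lemma ck_on_bounded_bilinear:
  assumes "bounded_bilinear B" "open S" "ck_on k S f" "ck_on k S g"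
  shows "ck_on k S (\<lambda>x. B (f x) (g x))"
  using assms(3,4)
proof (induction k arbitrary: f g)
  case 0
  then show ?case using bounded_bilinear.continuous_on[OF assms(1)] by auto
next
  case (Suc k)
  show ?case
  proof (intro ck_on_SucI assms(2))
    show "((\<lambda>x. B (f x) (g x)) has_derivative
        (\<lambda>v. B (f x) (frechet_derivative g (at x) v) + B (frechet_derivative f (at x) v) (g x))) (at x)"
      if "x \<in> S" for x
      using Suc.prems that by (intro bounded_bilinear.FDERIV[OF assms(1)] ck_on_SucE)
    fix v
    have "ck_on k S (\<lambda>x. B (f x) (frechet_derivative g (at x) v))"
      "ck_on k S (\<lambda>x. B (frechet_derivative f (at x) v) (g x))"
      using Suc.IH Suc.prems ck_on_SucD[OF Suc.prems(1)] ck_on_SucD[OF Suc.prems(2)] by simp_all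
    then show "ck_on k S (\<lambda>x. B (f x) (frechet_derivative g (at x) v) + B (frechet_derivative f (at x) v) (g x))"
      by (intro ck_on_add assms)
  qed
qed

lemma ck_on_sum_list:
  assumes "open S" "\<And>y. y \<in> set ys \<Longrightarrow> ck_on k S (f y)" shows "ck_on k S (\<lambda>x. \<Sum>y\<leftarrow>ys. f y x)"
  using assms(2) by (induction ys) (auto intro!: ck_on_add assms(1) ck_on_const)

lemma linear_frame_expansion:
  fixes L :: "'a::fin_dim \<Rightarrow> 'b::real_normed_vector"
  assumes "\<And>x. (\<Sum>(c, e)\<leftarrow>cs. c x *\<^sub>R e) = x" "bounded_linear L"
  shows "L x = (\<Sum>(c, e)\<leftarrow>cs. c x *\<^sub>R L e)"
proof -
  have "L x = L (\<Sum>(c, e)\<leftarrow>cs. c x *\<^sub>R e)" by (simp only: assms(1))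
  also have "\<dots> = (\<Sum>(c, e)\<leftarrow>cs. c x *\<^sub>R L e)"
    by (subst bounded_linear_sum_list[OF assms(2)])
      (simp add: o_def split_def linear_simps(5)[OF assms(2)])
  finally show ?thesis .
qed

text \<open>By the chain rule the derivative of f is taken at g x in a direction that itself depends
  on x, whereas \<open>ck_on\<close> speaks of fixed directions only. Expanding the direction in a
  frame leaves products of scalar functions with directional derivatives of f composed with g, to
  which the induction hypothesis and the product lemma apply.\<close>

lemma ck_on_compose:
  fixes f :: "'b::fin_dim \<Rightarrow> 'c::real_normed_vector"
  assumes "open S" "open T" "g ` S \<subseteq> T" "ck_on k S g" "ck_on k T f"
  shows "ck_on k S (\<lambda>x. f (g x))"
  using assms(4,5)
proof (induction k arbitrary: f)
  case 0
  then show ?case using continuous_on_compose2[of T f S g] assms(3) by simp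
next
  case (Suc k)
  obtain cs :: "(('b \<Rightarrow> real) \<times> 'b) list" where cs: "\<And>c e. (c, e) \<in> set cs \<Longrightarrow> bounded_linear c"
    "\<And>x. (\<Sum>(c, e)\<leftarrow>cs. c x *\<^sub>R e) = x" by (rule fin_dim_frame) blast
  let ?D = "\<lambda>x v. \<Sum>(c, e)\<leftarrow>cs. c (frechet_derivative g (at x) v) *\<^sub>R frechet_derivative f (at (g x)) e"
  show ?case
  proof (intro ck_on_SucI assms(1))
    fix x assume x: "x \<in> S"
    have f: "(f has_derivative frechet_derivative f (at (g x))) (at (g x))"
      using Suc.prems x assms(3) by (auto intro!: ck_on_SucE[of k T] simp del: ck_on.simps)
    have "?D x = (\<lambda>v. frechet_derivative f (at (g x)) (frechet_derivative g (at x) v))"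
      by (intro ext linear_frame_expansion[OF cs(2) has_derivative_bounded_linear[OF f], symmetric])
    then show "((\<lambda>x. f (g x)) has_derivative ?D x) (at x)"
      using has_derivative_compose[OF ck_on_SucE[OF Suc.prems(1) x] f] by (simp only:)
  next
    fix v
    have "ck_on k S (\<lambda>x. c (frechet_derivative g (at x) v) *\<^sub>R frechet_derivative f (at (g x)) e)"
      if "(c, e) \<in> set cs" for c e
    proof (rule ck_on_bounded_bilinear[OF bounded_bilinear_scaleR assms(1)])
      show "ck_on k S (\<lambda>x. c (frechet_derivative g (at x) v))"
        using Suc.prems(1) by (intro ck_on_bounded_linear[OF assms(1) cs(1)[OF that]]) simp
      show "ck_on k S (\<lambda>x. frechet_derivative f (at (g x)) e)"
        using Suc.prems(2) by (intro Suc.IH ck_on_SucD[OF Suc.prems(1)]) simp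
    qed
    then show "ck_on k S (\<lambda>x. ?D x v)"
      by (intro ck_on_sum_list[OF assms(1)]) (auto simp: split_def)
  qed
qed

text \<open>Continuity and differentiability at a point depend on a neighbourhood only. The lemma
  allows the charts to change from point to point in the proofs about manifolds.\<close>

lemma ck_on_local:
  assumes "\<And>x. x \<in> S \<Longrightarrow> \<exists>N. open N \<and> x \<in> N \<and> ck_on k N f"
  shows "ck_on k S f"
  using assms
proof (induction k arbitrary: f)
  case 0
  have "isCont f x" if "x \<in> S" for x
    using 0[OF that] by (metis ck_on.simps(1) continuous_on_eq_continuous_at)
  then show ?case by (simp add: continuous_at_imp_continuous_on)
next
  case (Suc k)
  have "f differentiable (at x)" if "x \<in> S" for x using Suc.prems[OF that] by auto
  moreover have "ck_on k S (\<lambda>x. frechet_derivative f (at x) v)" for v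
  proof (rule Suc.IH)
    fix x assume "x \<in> S"
    from Suc.prems[OF this] show "\<exists>N. open N \<and> x \<in> N \<and> ck_on k N (\<lambda>x. frechet_derivative f (at x) v)"
      unfolding ck_on.simps by blast
  qed
  ultimately show ?case by simp
qed

section \<open>Infinitely differentiable functions\<close>

lemma smooth_on_subset: "smooth_on S f \<Longrightarrow> T \<subseteq> S \<Longrightarrow> smooth_on T f"
  by (auto simp: smooth_on_def intro: ck_on_subset)

lemma smooth_on_cong: "smooth_on S f \<Longrightarrow> open S \<Longrightarrow> (\<And>x. x \<in> S \<Longrightarrow> f x = g x) \<Longrightarrow> smooth_on S g"
  by (auto simp: smooth_on_def intro: ck_on_cong)

lemma smooth_on_local: "(\<And>x. x \<in> S \<Longrightarrow> \<exists>N. open N \<and> x \<in> N \<and> smooth_on N f) \<Longrightarrow> smooth_on S f"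
  unfolding smooth_on_def using ck_on_local by meson

lemma smooth_on_has_derivative:
  "smooth_on S f \<Longrightarrow> x \<in> S \<Longrightarrow> (f has_derivative frechet_derivative f (at x)) (at x)"
  unfolding smooth_on_def using ck_on_SucE by blast

lemma smooth_on_continuous_on: "smooth_on S f \<Longrightarrow> continuous_on S f"
  unfolding smooth_on_def using ck_on.simps(1) by blast

named_theorems smooth_intros

lemma smooth_on_const [smooth_intros]: "open S \<Longrightarrow> smooth_on S (\<lambda>x. c)"
  by (simp add: smooth_on_def ck_on_const)

lemma smooth_on_linear: "open S \<Longrightarrow> bounded_linear L \<Longrightarrow> smooth_on S L"
  by (simp add: smooth_on_def ck_on_linear)

lemma smooth_on_id [smooth_intros]: "open S \<Longrightarrow> smooth_on S (\<lambda>x. x)"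
  by (simp add: smooth_on_linear bounded_linear_ident)

lemma smooth_on_bounded_linear:
  "bounded_linear L \<Longrightarrow> open S \<Longrightarrow> smooth_on S f \<Longrightarrow> smooth_on S (\<lambda>x. L (f x))"
  by (simp add: smooth_on_def ck_on_bounded_linear)

lemmas smooth_on_fst [smooth_intros] = smooth_on_bounded_linear[OF bounded_linear_fst]
lemmas smooth_on_snd [smooth_intros] = smooth_on_bounded_linear[OF bounded_linear_snd]
lemmas smooth_on_minus [smooth_intros] = smooth_on_bounded_linear[OF bounded_linear_minus[OF bounded_linear_ident]]

lemma smooth_on_add [smooth_intros]:
  "open S \<Longrightarrow> smooth_on S f \<Longrightarrow> smooth_on S g \<Longrightarrow> smooth_on S (\<lambda>x. f x + g x)"
  by (simp add: smooth_on_def ck_on_add)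

lemma smooth_on_diff [smooth_intros]:
  "open S \<Longrightarrow> smooth_on S f \<Longrightarrow> smooth_on S g \<Longrightarrow> smooth_on S (\<lambda>x. f x - g x)"
  using smooth_on_add[of S f "\<lambda>x. - g x"] smooth_on_minus[of S g] by simp

lemma smooth_on_Pair [smooth_intros]:
  assumes "open S" "smooth_on S f" "smooth_on S g" shows "smooth_on S (\<lambda>x. (f x, g x))"
proof -
  have "smooth_on S (\<lambda>x. (f x, 0) + (0, g x))"
    using assms by (intro smooth_on_add
      smooth_on_bounded_linear[OF bounded_linear_Pair[OF bounded_linear_ident bounded_linear_zero]]
      smooth_on_bounded_linear[OF bounded_linear_Pair[OF bounded_linear_zero bounded_linear_ident]])
  then show ?thesis by simp
qed

lemma smooth_on_bounded_bilinear:
  "bounded_bilinear B \<Longrightarrow> open S \<Longrightarrow> smooth_on S f \<Longrightarrow> smooth_on S g \<Longrightarrow> smooth_on S (\<lambda>x. B (f x) (g x))"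
  by (simp add: smooth_on_def ck_on_bounded_bilinear)

lemmas smooth_on_scaleR [smooth_intros] = smooth_on_bounded_bilinear[OF bounded_bilinear_scaleR]
lemmas smooth_on_mult [smooth_intros] = smooth_on_bounded_bilinear[OF bounded_bilinear_mult]

lemma smooth_on_compose:
  fixes f :: "'b::fin_dim \<Rightarrow> 'c::real_normed_vector"
  assumes "smooth_on T f" "open T" "open S" "g ` S \<subseteq> T" "smooth_on S g"
  shows "smooth_on S (\<lambda>x. f (g x))"
  using assms ck_on_compose[of S T g _ f] by (simp add: smooth_on_def)

lemma smooth_on_directional:
  "smooth_on S f \<Longrightarrow> smooth_on S (\<lambda>x. frechet_derivative f (at x) v)"
  unfolding smooth_on_def by (metis ck_on.simps(2))

text \<open>Base point and direction both move, so a frame is used again as for compositions.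
  Applied to a function of several variables it makes a partial derivative smooth in the parameters;
  this is how it serves group multiplication, conjugation and the Lagrangian.\<close>

lemma smooth_on_frechet_derivative:
  fixes f :: "'b::fin_dim \<Rightarrow> 'c::real_normed_vector"
  assumes "smooth_on T f" "open T" "open S" "u ` S \<subseteq> T" "smooth_on S u" "smooth_on S w"
  shows "smooth_on S (\<lambda>x. frechet_derivative f (at (u x)) (w x))"
proof -
  obtain cs :: "(('b \<Rightarrow> real) \<times> 'b) list" where cs: "\<And>c e. (c, e) \<in> set cs \<Longrightarrow> bounded_linear c"
    "\<And>x. (\<Sum>(c, e)\<leftarrow>cs. c x *\<^sub>R e) = x" by (rule fin_dim_frame) blast
  have "smooth_on S (\<lambda>x. c (w x) *\<^sub>R frechet_derivative f (at (u x)) e)" if "(c, e) \<in> set cs" for c e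
    by (rule smooth_on_scaleR[OF assms(3) smooth_on_bounded_linear[OF cs(1)[OF that] assms(3,6)]
      smooth_on_compose[OF smooth_on_directional[OF assms(1)] assms(2-5)]])
  then have "smooth_on S (\<lambda>x. \<Sum>(c, e)\<leftarrow>cs. c (w x) *\<^sub>R frechet_derivative f (at (u x)) e)"
    unfolding smooth_on_def by (auto intro!: ck_on_sum_list[OF assms(3)] simp: split_def)
  then show ?thesis
  proof (rule smooth_on_cong[OF _ assms(3)])
    fix x assume "x \<in> S"
    then have "bounded_linear (frechet_derivative f (at (u x)))"
      using assms(1,4) smooth_on_has_derivative has_derivative_bounded_linear by blast
    from linear_frame_expansion[OF cs(2) this, symmetric]
    show "(\<Sum>(c, e)\<leftarrow>cs. c (w x) *\<^sub>R frechet_derivative f (at (u x)) e) = frechet_derivative f (at (u x)) (w x)" .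
  qed
qed

section \<open>Chain rule at a named point, components, derivatives along an interval\<close>

lemma has_derivative_at_compose:
  assumes "(f has_derivative f') (at x)" "f x = y" "(g has_derivative g') (at y)"
  shows "((\<lambda>x. g (f x)) has_derivative (\<lambda>v. g' (f' v))) (at x)"
  using assms has_derivative_compose by blast

lemma has_derivative_imp_has_vector_derivative:
  assumes "(f has_derivative D) F" shows "(f has_vector_derivative D 1) F"
proof -
  have "D = (\<lambda>r. r *\<^sub>R D 1)"
  proof
    fix r
    show "D r = r *\<^sub>R D 1"
      using linear_scale[OF has_derivative_linear[OF assms], of r 1] by simp
  qed
  then show ?thesis using assms by (simp add: has_vector_derivative_def)
qed

lemma smooth_on_sum:
  assumes "finite I" "open S" "\<And>i. i \<in> I \<Longrightarrow> smooth_on S (f i)"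
  shows "smooth_on S (\<lambda>x. \<Sum>i\<in>I. f i x)"
  using assms(1,3) by (induction I) (auto intro!: smooth_on_add smooth_on_const assms(2))

text \<open>A functional is the sum of its values on basis vectors times the dual basis. The
  derivatives of E become accessible through their pairings only, hence this criterion and its
  counterpart for vectors.\<close>

lemma smooth_on_dual_componentwise:
  fixes f :: "'a::real_normed_vector \<Rightarrow> 'v::euclidean_space dual"
  assumes "open S" "\<And>v. smooth_on S (\<lambda>x. blinfun_apply (f x) v)" shows "smooth_on S f"
proof (rule smooth_on_cong[OF _ assms(1)])
  show "smooth_on S (\<lambda>x. \<Sum>b\<in>Basis. blinfun_apply (f x) b *\<^sub>R blinfun_inner_right b)"
    by (intro smooth_on_sum smooth_on_scaleR smooth_on_const assms) auto
  fix x
  show "(\<Sum>b\<in>Basis. blinfun_apply (f x) b *\<^sub>R blinfun_inner_right b) = f x"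
  proof (rule blinfun_eqI)
    fix v
    have "blinfun_apply (f x) (\<Sum>b\<in>Basis. (v \<bullet> b) *\<^sub>R b) = (\<Sum>b\<in>Basis. (v \<bullet> b) * blinfun_apply (f x) b)"
      by (simp only: blinfun.sum_right blinfun.scaleR_right real_scaleR_def)
    then have "blinfun_apply (f x) v = (\<Sum>b\<in>Basis. (v \<bullet> b) * blinfun_apply (f x) b)"
      by (simp only: euclidean_representation)
    then show "blinfun_apply (\<Sum>b\<in>Basis. blinfun_apply (f x) b *\<^sub>R blinfun_inner_right b) v = blinfun_apply (f x) v"
      by (simp add: blinfun.sum_left blinfun.scaleR_left inner_commute mult.commute)
  qed
qed

lemma smooth_on_vector_componentwise:
  fixes f :: "'a::real_normed_vector \<Rightarrow> 'v::euclidean_space"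
  assumes "open S" "\<And>\<alpha> :: 'v dual. smooth_on S (\<lambda>x. blinfun_apply \<alpha> (f x))" shows "smooth_on S f"
proof (rule smooth_on_cong[OF _ assms(1)])
  show "smooth_on S (\<lambda>x. \<Sum>b\<in>Basis. blinfun_apply (blinfun_inner_right b) (f x) *\<^sub>R b)"
    by (intro smooth_on_sum smooth_on_scaleR smooth_on_const assms) auto
qed (simp add: inner_commute[of _ "f _"] euclidean_representation)

lemma smooth_on_real_has_vector_derivative:
  fixes f :: "real \<Rightarrow> 'b::real_normed_vector"
  assumes "smooth_on S f" "t \<in> S"
  shows "(f has_vector_derivative frechet_derivative f (at t) 1) (at t)"
  by (rule has_derivative_imp_has_vector_derivative[OF smooth_on_has_derivative[OF assms]])

text \<open>\<open>generated_by\<close> and the equations use derivatives within the interval, while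
  the calculus yields two-sided ones. Since a < b, the derivative within the interval is unique even
  at the end points, so the two agree.\<close>

lemma smooth_on_vector_derivative_within:
  fixes f :: "real \<Rightarrow> 'b::real_normed_vector"
  assumes "smooth_on S f" "{a..b} \<subseteq> S" "a < b" "t \<in> {a..b}"
  shows "(f has_vector_derivative vector_derivative f (at t within {a..b})) (at t within {a..b})"
    and "vector_derivative f (at t within {a..b}) = frechet_derivative f (at t) 1"
proof -
  have "(f has_vector_derivative frechet_derivative f (at t) 1) (at t within {a..b})"
    using assms by (intro has_vector_derivative_at_within[OF smooth_on_real_has_vector_derivative[of S]]) auto
  moreover from this show "vector_derivative f (at t within {a..b}) = frechet_derivative f (at t) 1"
    using assms by (intro vector_derivative_within_cbox[unfolded box_real]) auto
  ultimately show "(f has_vector_derivative vector_derivative f (at t within {a..b})) (at t within {a..b})"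
    by simp
qed

section \<open>Smooth maps from open subsets of vector spaces into manifolds\<close>

text \<open>An atlas without the compatibility of its charts. This much passes to
  \<open>vec_atlas\<close> and \<open>prod_atlas\<close> at once and suffices for most facts on
  smooth maps; compatibility enters through the inverse chart maps.\<close>

definition chart_cover :: "('m::topological_space, 'v::real_normed_vector) chart set \<Rightarrow> bool" where
  "chart_cover A \<longleftrightarrow>
     (\<forall>(U, \<phi>)\<in>A. open U \<and> open (\<phi> ` U) \<and> inj_on \<phi> U \<and> continuous_on (\<phi> ` U) (inv_into U \<phi>)) \<and>
     (\<Union>(U, \<phi>)\<in>A. U) = UNIV"

lemma chart_coverD:
  assumes "chart_cover A" "(U, \<phi>) \<in> A"
  shows "open U" "open (\<phi> ` U)" "inj_on \<phi> U" "continuous_on (\<phi> ` U) (inv_into U \<phi>)"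
  using assms by (auto simp: chart_cover_def)

text \<open>The image of N is its preimage under the inverse chart, which is continuous on an open
  set.\<close>

lemma chart_cover_image_open:
  assumes "chart_cover A" "(U, \<phi>) \<in> A" "open N" "N \<subseteq> U" shows "open (\<phi> ` N)"
proof -
  note A = chart_coverD[OF assms(1,2)]
  have "\<phi> ` N = \<phi> ` U \<inter> inv_into U \<phi> -` N"
    using A(3) assms(4) by (auto simp: inv_into_f_f subset_iff)
  then show ?thesis using continuous_open_preimage[OF A(4,2) assms(3)] by simp
qed

lemma chart_coverE:
  assumes "chart_cover A" obtains U \<phi> where "(U, \<phi>) \<in> A" "p \<in> U"
proof -
  have "p \<in> (\<Union>(U, \<phi>)\<in>A. U)" using assms by (simp add: chart_cover_def)
  then show thesis using that by blast
qed

lemma chart_at_mem: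
  assumes "chart_cover A" shows "chart_at A p \<in> A" "p \<in> fst (chart_at A p)"
proof -
  obtain U \<phi> where "(U, \<phi>) \<in> A" "p \<in> U" by (rule chart_coverE[OF assms])
  then have "\<exists>c. c \<in> A \<and> p \<in> fst c" by (intro exI[of _ "(U, \<phi>)"]) simp
  from someI_ex[OF this] show "chart_at A p \<in> A" "p \<in> fst (chart_at A p)"
    by (auto simp: chart_at_def)
qed

lemma smooth_atlas_chart_cover: "smooth_atlas A \<Longrightarrow> chart_cover A"
  unfolding smooth_atlas_def chart_cover_def
  by (auto simp: homeomorphism_def split: prod.splits) (metis inj_on_def)

lemma chart_cover_vec [simp]: "chart_cover vec_atlas"
  by (simp add: chart_cover_def vec_atlas_def inv_id[unfolded id_def] id_def)

lemma chart_at_vec [simp]: "chart_at vec_atlas (p::'a::real_normed_vector) = (UNIV, id)"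
  using chart_at_mem(1)[OF chart_cover_vec, of p] by (simp add: vec_atlas_def)

lemma chart_cover_prod:
  assumes "chart_cover A" "chart_cover B" shows "chart_cover (prod_atlas A B)"
proof -
  have "open (U \<times> V) \<and> open (map_prod \<phi> \<psi> ` (U \<times> V)) \<and> inj_on (map_prod \<phi> \<psi>) (U \<times> V) \<and>
      continuous_on (map_prod \<phi> \<psi> ` (U \<times> V)) (inv_into (U \<times> V) (map_prod \<phi> \<psi>))"
    if "(U, \<phi>) \<in> A" "(V, \<psi>) \<in> B" for U V \<phi> \<psi>
  proof -
    note A = chart_coverD[OF assms(1) that(1)] and B = chart_coverD[OF assms(2) that(2)]
    have inj: "inj_on (map_prod \<phi> \<psi>) (U \<times> V)" using A(3) B(3) by (simp add: map_prod_inj_on)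
    have im: "map_prod \<phi> \<psi> ` (U \<times> V) = \<phi> ` U \<times> \<psi> ` V" by (rule map_prod_surj_on) auto
    have "continuous_on (\<phi> ` U \<times> \<psi> ` V) (\<lambda>z. (inv_into U \<phi> (fst z), inv_into V \<psi> (snd z)))"
      by (intro continuous_on_Pair continuous_on_compose2[OF A(4)] continuous_on_compose2[OF B(4)]
        continuous_on_fst continuous_on_snd continuous_on_id) auto
    moreover have "inv_into (U \<times> V) (map_prod \<phi> \<psi>) z = (inv_into U \<phi> (fst z), inv_into V \<psi> (snd z))"
      if "z \<in> \<phi> ` U \<times> \<psi> ` V" for z
      using that by (intro inv_into_f_eq[OF inj]) (auto simp: inv_into_into f_inv_into_f)
    ultimately have "continuous_on (\<phi> ` U \<times> \<psi> ` V) (inv_into (U \<times> V) (map_prod \<phi> \<psi>))"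
      by (metis (no_types, lifting) continuous_on_cong)
    then show ?thesis using A B inj im by (simp add: open_Times)
  qed
  moreover have "(\<Union>(U, \<phi>)\<in>prod_atlas A B. U) = UNIV"
  proof -
    have "z \<in> (\<Union>(U, \<phi>)\<in>prod_atlas A B. U)" for z
    proof -
      obtain U \<phi> where "(U, \<phi>) \<in> A" "fst z \<in> U" by (rule chart_coverE[OF assms(1)])
      moreover obtain V \<psi> where "(V, \<psi>) \<in> B" "snd z \<in> V" by (rule chart_coverE[OF assms(2)])
      ultimately have "(U \<times> V, map_prod \<phi> \<psi>) \<in> prod_atlas A B" "z \<in> U \<times> V"
        by (auto simp: prod_atlas_def mem_Times_iff)
      then show ?thesis by blast
    qed
    then show ?thesis by blast
  qed
  ultimately show ?thesis unfolding chart_cover_def by (fastforce simp: prod_atlas_def)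
qed

section \<open>Building smooth maps: composition, pairing, restriction, localisation\<close>

lemma smooth_map_on_vec_iff:
  "smooth_map_on vec_atlas W B f \<longleftrightarrow>
     open W \<and> continuous_on W f \<and> (\<forall>(V, \<psi>)\<in>B. smooth_on (W \<inter> f -` V) (\<lambda>x. \<psi> (f x)))"
  by (simp add: smooth_map_on_def vec_atlas_def inv_id comp_def)

lemma smooth_map_on_vec_vec:
  "smooth_map_on vec_atlas W vec_atlas f \<longleftrightarrow> open W \<and> smooth_on W f"
proof -
  have "smooth_map_on vec_atlas W vec_atlas f \<longleftrightarrow> open W \<and> continuous_on W f \<and> smooth_on W f"
    unfolding smooth_map_on_vec_iff by (simp add: vec_atlas_def)
  then show ?thesis using smooth_on_continuous_on by blast
qed

lemma smooth_map_on_vec_open: "smooth_map_on vec_atlas W B f \<Longrightarrow> open W"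
  and smooth_map_on_vec_continuous: "smooth_map_on vec_atlas W B f \<Longrightarrow> continuous_on W f"
  by (auto simp: smooth_map_on_vec_iff)

lemma smooth_map_on_vec_chart:
  "smooth_map_on vec_atlas W B f \<Longrightarrow> (V, \<psi>) \<in> B \<Longrightarrow> smooth_on (W \<inter> f -` V) (\<lambda>x. \<psi> (f x))"
  by (auto simp: smooth_map_on_vec_iff)

lemma smooth_map_on_vec_preimage_open:
  assumes "smooth_map_on vec_atlas W B f" "open V" shows "open (W \<inter> f -` V)"
  using assms continuous_open_preimage by (auto simp: smooth_map_on_vec_iff)

text \<open>Around a point x a chart of the middle manifold at f x is inserted, and the coordinate
  expression becomes a composition of two smooth functions between vector spaces. As that chart
  depends on x, the argument is local.\<close>

lemma smooth_map_on_compose: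
  fixes B :: "('m::topological_space, 'v::fin_dim) chart set"
  assumes f: "smooth_map_on vec_atlas W B f" and h: "smooth_map_on B UNIV C h"
    and B: "chart_cover B" and C: "chart_cover C"
  shows "smooth_map_on vec_atlas W C (\<lambda>x. h (f x))"
  unfolding smooth_map_on_vec_iff
proof (intro conjI ballI)
  show "open W" using f by (simp add: smooth_map_on_vec_iff)
  have hc: "continuous_on UNIV h" using h by (simp add: smooth_map_on_def)
  then show "continuous_on W (\<lambda>x. h (f x))"
    using f by (auto simp: smooth_map_on_vec_iff intro: continuous_on_compose2)
  fix c assume "c \<in> C"
  moreover obtain Z \<theta> where c: "c = (Z, \<theta>)" by (cases c)
  ultimately have Z: "(Z, \<theta>) \<in> C" by simp
  have "smooth_on (W \<inter> (\<lambda>x. h (f x)) -` Z) (\<lambda>x. \<theta> (h (f x)))"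
  proof (rule smooth_on_local)
    fix x assume x: "x \<in> W \<inter> (\<lambda>x. h (f x)) -` Z"
    obtain V \<psi> where V: "(V, \<psi>) \<in> B" "f x \<in> V" by (rule chart_coverE[OF B])
    let ?M = "V \<inter> h -` Z"
    let ?N = "W \<inter> f -` ?M"
    have M: "open ?M"
      by (intro open_Int open_vimage hc chart_coverD(1)[OF C Z] chart_coverD(1)[OF B V(1)])
    have N: "open ?N" by (rule smooth_map_on_vec_preimage_open[OF f M])
    have "smooth_on ?N (\<lambda>x. (\<theta> \<circ> h \<circ> inv_into V \<psi>) (\<psi> (f x)))"
    proof (rule smooth_on_compose[of "\<psi> ` ?M"])
      show "smooth_on (\<psi> ` ?M) (\<theta> \<circ> h \<circ> inv_into V \<psi>)"
        using h V(1) Z by (force simp: smooth_map_on_def)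
      show "open (\<psi> ` ?M)" using chart_cover_image_open[OF B V(1) M] by simp
      show "smooth_on ?N (\<lambda>x. \<psi> (f x))"
        using smooth_map_on_vec_chart[OF f V(1)] by (rule smooth_on_subset) auto
    qed (use N in auto)
    then have "smooth_on ?N (\<lambda>x. \<theta> (h (f x)))"
      by (rule smooth_on_cong[OF _ N]) (auto simp: inv_into_f_f[OF chart_coverD(3)[OF B V(1)]])
    then show "\<exists>N. open N \<and> x \<in> N \<and> smooth_on N (\<lambda>x. \<theta> (h (f x)))"
      using x V N by auto
  qed
  then show "case c of (V, \<psi>) \<Rightarrow> smooth_on (W \<inter> (\<lambda>x. h (f x)) -` V) (\<lambda>x. \<psi> (h (f x)))"
    by (simp add: c)
qed

lemma smooth_map_on_Pair:
  assumes f: "smooth_map_on vec_atlas W B f" and g: "smooth_map_on vec_atlas W C g"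
    and B: "chart_cover B" and C: "chart_cover C"
  shows "smooth_map_on vec_atlas W (prod_atlas B C) (\<lambda>x. (f x, g x))"
  unfolding smooth_map_on_vec_iff
proof (intro conjI ballI)
  show "open W" "continuous_on W (\<lambda>x. (f x, g x))"
    using f g by (auto simp: smooth_map_on_vec_iff intro: continuous_on_Pair)
  fix c assume "c \<in> prod_atlas B C"
  then obtain U \<phi> V \<psi> where c: "c = (U \<times> V, map_prod \<phi> \<psi>)" "(U, \<phi>) \<in> B" "(V, \<psi>) \<in> C"
    by (auto simp: prod_atlas_def)
  have "smooth_on ((W \<inter> f -` U) \<inter> (W \<inter> g -` V)) (\<lambda>x. (\<phi> (f x), \<psi> (g x)))"
    by (intro smooth_on_Pair open_Int smooth_map_on_vec_preimage_open[OF f] smooth_map_on_vec_preimage_open[OF g]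
      chart_coverD(1)[OF B c(2)] chart_coverD(1)[OF C c(3)]
      smooth_on_subset[OF smooth_map_on_vec_chart[OF f c(2)]] smooth_on_subset[OF smooth_map_on_vec_chart[OF g c(3)]]) auto
  moreover have "W \<inter> (\<lambda>x. (f x, g x)) -` (U \<times> V) = (W \<inter> f -` U) \<inter> (W \<inter> g -` V)" by auto
  ultimately show "case c of (V, \<psi>) \<Rightarrow> smooth_on (W \<inter> (\<lambda>x. (f x, g x)) -` V) (\<lambda>x. \<psi> (f x, g x))"
    by (simp add: c(1))
qed

lemma smooth_map_on_precompose:
  fixes f :: "'a::fin_dim \<Rightarrow> 'm::topological_space"
  assumes f: "smooth_map_on vec_atlas W A f" and A: "chart_cover A"
    and S: "open S" and u: "smooth_on S u" "u ` S \<subseteq> W"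
  shows "smooth_map_on vec_atlas S A (\<lambda>x. f (u x))"
  unfolding smooth_map_on_vec_iff
proof (intro conjI ballI S)
  show c: "continuous_on S (\<lambda>x. f (u x))"
    using continuous_on_compose2[OF smooth_map_on_vec_continuous[OF f] smooth_on_continuous_on[OF u(1)] u(2)] .
  fix c assume "c \<in> A"
  moreover obtain V \<psi> where c': "c = (V, \<psi>)" by (cases c)
  ultimately have V: "(V, \<psi>) \<in> A" by simp
  have "smooth_on (S \<inter> (\<lambda>x. f (u x)) -` V) (\<lambda>x. \<psi> (f (u x)))"
    by (rule smooth_on_compose[OF smooth_map_on_vec_chart[OF f V]
          smooth_map_on_vec_preimage_open[OF f chart_coverD(1)[OF A V]]
          continuous_open_preimage[OF c S chart_coverD(1)[OF A V]]])
      (use u in \<open>auto intro: smooth_on_subset\<close>)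
  then show "case c of (V, \<psi>) \<Rightarrow> smooth_on (S \<inter> (\<lambda>x. f (u x)) -` V) (\<lambda>x. \<psi> (f (u x)))"
    by (simp add: c')
qed

text \<open>The coordinate expressions of an inverse chart are the transition maps, so this is the
  compatibility of charts in the language of smooth maps.\<close>

lemma smooth_map_on_chart_inverse:
  assumes A: "smooth_atlas A" and U: "(U, \<phi>) \<in> A"
  shows "smooth_map_on vec_atlas (\<phi> ` U) A (inv_into U \<phi>)"
  unfolding smooth_map_on_vec_iff
proof (intro conjI ballI)
  note C = chart_coverD[OF smooth_atlas_chart_cover[OF A] U]
  show "open (\<phi> ` U)" "continuous_on (\<phi> ` U) (inv_into U \<phi>)" using C by auto
  fix c assume c: "c \<in> A"
  obtain V \<psi> where c': "c = (V, \<psi>)" by (cases c)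
  have "smooth_on (\<phi> ` (U \<inter> V)) (\<psi> \<circ> inv_into U \<phi>)"
    using A U c c' by (fastforce simp: smooth_atlas_def)
  moreover have "\<phi> ` U \<inter> inv_into U \<phi> -` V = \<phi> ` (U \<inter> V)"
    using C(3) by (auto simp: inv_into_f_f)
  ultimately show "case c of (V, \<psi>) \<Rightarrow>
      smooth_on (\<phi> ` U \<inter> inv_into U \<phi> -` V) (\<lambda>x. \<psi> (inv_into U \<phi> x))"
    by (simp add: c' comp_def)
qed

lemma smooth_map_on_const:
  "open W \<Longrightarrow> smooth_map_on vec_atlas W A (\<lambda>x. c)"
  by (auto simp: smooth_map_on_vec_iff smooth_on_const intro!: smooth_on_subset[of W])

lemma smooth_map_on_subset:
  assumes "smooth_map_on vec_atlas W A f" "open S" "S \<subseteq> W" shows "smooth_map_on vec_atlas S A f"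
  using assms unfolding smooth_map_on_vec_iff
  by (fast intro: continuous_on_subset smooth_on_subset)

lemma smooth_map_on_cong:
  assumes f: "smooth_map_on vec_atlas W A f" and A: "chart_cover A" and eq: "\<And>x. x \<in> W \<Longrightarrow> f x = g x"
  shows "smooth_map_on vec_atlas W A g"
  unfolding smooth_map_on_vec_iff
proof (intro conjI ballI)
  show "open W" "continuous_on W g"
    using f eq continuous_on_cong[of W W f g] by (auto simp: smooth_map_on_vec_iff)
  fix c assume "c \<in> A"
  moreover obtain V \<psi> where c': "c = (V, \<psi>)" by (cases c)
  ultimately have V: "(V, \<psi>) \<in> A" by simp
  have "W \<inter> g -` V = W \<inter> f -` V" using eq by auto
  moreover have "smooth_on (W \<inter> f -` V) (\<lambda>x. \<psi> (g x))"
    by (rule smooth_on_cong[OF smooth_map_on_vec_chart[OF f V]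
      smooth_map_on_vec_preimage_open[OF f chart_coverD(1)[OF A V]]]) (use eq in auto)
  ultimately show "case c of (V, \<psi>) \<Rightarrow> smooth_on (W \<inter> g -` V) (\<lambda>x. \<psi> (g x))"
    by (simp add: c')
qed

lemma smooth_map_on_local:
  assumes A: "chart_cover A"
    and loc: "\<And>x. x \<in> W \<Longrightarrow> \<exists>N. x \<in> N \<and> N \<subseteq> W \<and> smooth_map_on vec_atlas N A f"
  shows "smooth_map_on vec_atlas W A f"
  unfolding smooth_map_on_vec_iff
proof (intro conjI ballI)
  show "open W" using loc smooth_map_on_vec_open unfolding open_subopen[of W] by fast
  have "continuous (at x within W) f" if "x \<in> W" for x
  proof -
    obtain N where N: "x \<in> N" "smooth_map_on vec_atlas N A f" using loc[OF \<open>x \<in> W\<close>] by blast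
    have "continuous (at x within N) f"
      using smooth_map_on_vec_continuous[OF N(2)] N(1) by (simp add: continuous_on_eq_continuous_within)
    then have "isCont f x" using at_within_open[OF N(1) smooth_map_on_vec_open[OF N(2)]] by simp
    then show ?thesis by (rule continuous_at_imp_continuous_at_within)
  qed
  then show "continuous_on W f" by (simp add: continuous_on_eq_continuous_within)
  fix c assume "c \<in> A"
  moreover obtain V \<psi> where c': "c = (V, \<psi>)" by (cases c)
  ultimately have V: "(V, \<psi>) \<in> A" by simp
  have "smooth_on (W \<inter> f -` V) (\<lambda>x. \<psi> (f x))"
  proof (rule smooth_on_local)
    fix x assume x: "x \<in> W \<inter> f -` V"
    then obtain N where N: "x \<in> N" "smooth_map_on vec_atlas N A f" using loc by blast
    show "\<exists>N. open N \<and> x \<in> N \<and> smooth_on N (\<lambda>x. \<psi> (f x))"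
      using x N smooth_map_on_vec_chart[OF N(2) V]
        smooth_map_on_vec_preimage_open[OF N(2) chart_coverD(1)[OF A V]] by blast
  qed
  then show "case c of (V, \<psi>) \<Rightarrow> smooth_on (W \<inter> f -` V) (\<lambda>x. \<psi> (f x))"
    by (simp add: c')
qed

text \<open>A chart of one factor becomes a chart of the product only together with a chart of the
  other factor, and the latter covers just part of the domain. Smoothness of each component is
  therefore shown near one point at a time.\<close>

lemma smooth_map_on_fst_snd:
  assumes f: "smooth_map_on vec_atlas W (prod_atlas A B) f" and A: "chart_cover A" and B: "chart_cover B"
  shows "smooth_map_on vec_atlas W A (\<lambda>x. fst (f x))" and "smooth_map_on vec_atlas W B (\<lambda>x. snd (f x))"
proof -
  have W: "open W" and c: "continuous_on W f"
    using f by (auto simp: smooth_map_on_vec_iff)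
  have N: "open (W \<inter> f -` (U \<times> V)) \<and> smooth_on (W \<inter> f -` (U \<times> V)) (\<lambda>x. \<phi> (fst (f x))) \<and>
      smooth_on (W \<inter> f -` (U \<times> V)) (\<lambda>x. \<psi> (snd (f x)))" if "(U, \<phi>) \<in> A" "(V, \<psi>) \<in> B" for U \<phi> V \<psi>
  proof -
    have UV: "(U \<times> V, map_prod \<phi> \<psi>) \<in> prod_atlas A B" using that by (auto simp: prod_atlas_def)
    have o: "open (W \<inter> f -` (U \<times> V))"
      using smooth_map_on_vec_preimage_open[OF f] chart_coverD(1)[OF chart_cover_prod[OF A B] UV] .
    have "smooth_on (W \<inter> f -` (U \<times> V)) (\<lambda>x. fst (map_prod \<phi> \<psi> (f x)))"
      "smooth_on (W \<inter> f -` (U \<times> V)) (\<lambda>x. snd (map_prod \<phi> \<psi> (f x)))"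
      by (intro smooth_on_fst smooth_on_snd o smooth_map_on_vec_chart[OF f UV])+
    with o show ?thesis by simp
  qed
  show "smooth_map_on vec_atlas W A (\<lambda>x. fst (f x))"
    unfolding smooth_map_on_vec_iff
  proof (intro conjI ballI W)
    show "continuous_on W (\<lambda>x. fst (f x))" using c by (rule continuous_on_fst)
    fix u assume "u \<in> A"
    moreover obtain U \<phi> where u: "u = (U, \<phi>)" by (cases u)
    ultimately have U: "(U, \<phi>) \<in> A" by simp
    have "smooth_on (W \<inter> (\<lambda>x. fst (f x)) -` U) (\<lambda>x. \<phi> (fst (f x)))"
    proof (rule smooth_on_local)
      fix x assume x: "x \<in> W \<inter> (\<lambda>x. fst (f x)) -` U"
      obtain V \<psi> where V: "(V, \<psi>) \<in> B" "snd (f x) \<in> V" by (rule chart_coverE[OF B])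
      show "\<exists>N. open N \<and> x \<in> N \<and> smooth_on N (\<lambda>x. \<phi> (fst (f x)))"
        using N[OF U V(1)] x V(2) by (intro exI[of _ "W \<inter> f -` (U \<times> V)"]) (auto simp: mem_Times_iff)
    qed
    then show "case u of (V, \<psi>) \<Rightarrow> smooth_on (W \<inter> (\<lambda>x. fst (f x)) -` V) (\<lambda>x. \<psi> (fst (f x)))"
      by (simp add: u)
  qed
  show "smooth_map_on vec_atlas W B (\<lambda>x. snd (f x))"
    unfolding smooth_map_on_vec_iff
  proof (intro conjI ballI W)
    show "continuous_on W (\<lambda>x. snd (f x))" using c by (rule continuous_on_snd)
    fix v assume "v \<in> B"
    moreover obtain V \<psi> where v: "v = (V, \<psi>)" by (cases v)
    ultimately have V: "(V, \<psi>) \<in> B" by simp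
    have "smooth_on (W \<inter> (\<lambda>x. snd (f x)) -` V) (\<lambda>x. \<psi> (snd (f x)))"
    proof (rule smooth_on_local)
      fix x assume x: "x \<in> W \<inter> (\<lambda>x. snd (f x)) -` V"
      obtain U \<phi> where U: "(U, \<phi>) \<in> A" "fst (f x) \<in> U" by (rule chart_coverE[OF A])
      show "\<exists>N. open N \<and> x \<in> N \<and> smooth_on N (\<lambda>x. \<psi> (snd (f x)))"
        using N[OF U(1) V] x U(2) by (intro exI[of _ "W \<inter> f -` (U \<times> V)"]) (auto simp: mem_Times_iff)
    qed
    then show "case v of (V, \<psi>) \<Rightarrow> smooth_on (W \<inter> (\<lambda>x. snd (f x)) -` V) (\<lambda>x. \<psi> (snd (f x)))"
      by (simp add: v)
  qed
qed

lemma tangent_map_eqI: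
  assumes "chart_at A p = (U, \<phi>)" "chart_at B (f p) = (V, \<psi>)"
    and "((\<lambda>x. \<psi> (f (inv_into U \<phi> x))) has_derivative D) (at (\<phi> p))"
  shows "tangent_map A B f p = D"
  using frechet_derivative_at[OF assms(3)] assms(1,2) by (simp add: tangent_map_def comp_def)

lemma velocity_eqI:
  assumes "chart_at A (c t) = (V, \<psi>)" "((\<lambda>s. \<psi> (c s)) has_vector_derivative w) (at t)"
  shows "velocity A c t = w"
proof -
  have "tangent_map vec_atlas A c t = (\<lambda>r. r *\<^sub>R w)"
    using assms by (intro tangent_map_eqI[of _ _ UNIV id _ _ V \<psi>])
      (simp_all add: inv_id has_vector_derivative_def)
  then show ?thesis by (simp add: velocity_def)
qed

section \<open>Local solutions of ordinary differential equations\<close>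

text \<open>The operator norm of the derivative is at most the sum of the norms of the partial
  derivatives, which is continuous and hence bounded on the compact ball; the mean value inequality
  on the convex ball does the rest.\<close>

lemma smooth_on_lipschitz_cball:
  fixes F :: "'a::euclidean_space \<Rightarrow> 'b::real_normed_vector"
  assumes F: "smooth_on S F" and r: "cball p r \<subseteq> S"
  obtains L where "0 < L" "\<And>x y. x \<in> cball p r \<Longrightarrow> y \<in> cball p r \<Longrightarrow> norm (F x - F y) \<le> L * norm (x - y)"
proof -
  let ?h = "\<lambda>x. \<Sum>b\<in>Basis. norm (frechet_derivative F (at x) b)"
  have "continuous_on (cball p r) ?h"
    by (intro continuous_on_sum continuous_on_norm continuous_on_subset[OF _ r] smooth_on_continuous_on
      smooth_on_directional F)
  then have "bounded (?h ` cball p r)"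
    by (intro compact_imp_bounded compact_continuous_image) auto
  then obtain L where L: "0 < L" "\<And>x. x \<in> cball p r \<Longrightarrow> norm (?h x) \<le> L"
    unfolding bounded_pos by blast
  have "norm (F x - F y) \<le> L * norm (x - y)" if "x \<in> cball p r" "y \<in> cball p r" for x y
  proof (rule differentiable_bound[OF convex_cball[of p r]])
    fix z assume z: "z \<in> cball p r"
    then have D: "(F has_derivative frechet_derivative F (at z)) (at z)"
      using F r by (intro smooth_on_has_derivative) auto
    then show "(F has_derivative frechet_derivative F (at z)) (at z within cball p r)"
      by (rule has_derivative_at_withinI)
    have "onorm (frechet_derivative F (at z)) \<le> ?h z"
      by (rule onorm_componentwise[OF has_derivative_bounded_linear[OF D]])
    also have "\<dots> \<le> L" using L(2)[OF z] by simp
    finally show "onorm (frechet_derivative F (at z)) \<le> L" .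
  qed (use that in auto)
  with L(1) show thesis by (rule that)
qed

text \<open>Picard's integral operator is a contraction on the bounded continuous functions on the
  whole real line. Working there, and not on an interval, gives a complete metric space that is
  available as a type.\<close>

lemma lipschitz_ode_solution:
  fixes G :: "'a::euclidean_space \<Rightarrow> 'a"
  assumes L: "0 < L" "\<And>x y. norm (G x - G y) \<le> L * norm (x - y)" and d: "0 < d" "4 * d * L < 1"
  obtains u where "u 0 = p" "continuous_on UNIV u"
    "\<And>t. t \<in> {-d<..<d} \<Longrightarrow> (u has_vector_derivative G (u t)) (at t)"
proof -
  have contG: "continuous_on UNIV G"
  proof -
    have "L-lipschitz_on UNIV G" using L by (auto simp: lipschitz_on_def dist_norm)
    then show ?thesis by (rule lipschitz_on_continuous_on)
  qed
  \<comment> \<open>Clamping time to [-d, d] makes every image under the operator constant outside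
    this interval, hence bounded.\<close>
  define c where "c t = max (-d) (min d t)" for t :: real
  have c: "c t \<in> {-d..d}" for t using d by (auto simp: c_def)
  \<comment> \<open>The oriented integral from 0 to t is written as a difference of two integrals
    from -d, because \<open>integral\<close> over an interval with reversed end points is
    zero.\<close>
  define T where "T u t = p + integral {-d..c t} (\<lambda>s. G (u s)) - integral {-d..0} (\<lambda>s. G (u s))"
    for u :: "real \<Rightarrow> 'a" and t
  have contGu: "continuous_on A (\<lambda>s. G (apply_bcontfun u s))" for u A
    by (rule continuous_on_compose2[OF contG]) auto
  have T_cont: "continuous_on UNIV (T (apply_bcontfun u))" for u
  proof -
    have "continuous_on {-d..d} (\<lambda>t. integral {-d..t} (\<lambda>s. G (apply_bcontfun u s)))"
      by (intro indefinite_integral_continuous_1 integrable_continuous_real contGu)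
    moreover have "continuous_on UNIV c" unfolding c_def by (intro continuous_intros)
    ultimately have "continuous_on UNIV (\<lambda>t. integral {-d..c t} (\<lambda>s. G (apply_bcontfun u s)))"
      using c by (auto intro: continuous_on_compose2)
    then show ?thesis unfolding T_def by (intro continuous_intros)
  qed
  have T_bcont: "T (apply_bcontfun u) \<in> bcontfun" for u
  proof -
    have "bounded (T (apply_bcontfun u) ` {-d..d})"
      by (intro compact_imp_bounded compact_continuous_image continuous_on_subset[OF T_cont]) auto
    moreover have "T (apply_bcontfun u) t = T (apply_bcontfun u) (c t)" for t
      using d by (simp add: T_def c_def)
    then have "range (T (apply_bcontfun u)) \<subseteq> T (apply_bcontfun u) ` {-d..d}"
      using c by (metis image_eqI image_subsetI)
    ultimately show ?thesis using T_cont bounded_subset by (auto simp: bcontfun_def)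
  qed
  have T_apply: "apply_bcontfun (Bcontfun (T (apply_bcontfun u))) = T (apply_bcontfun u)" for u
    by (rule Bcontfun_inverse[OF T_bcont])
  have contraction: "dist (Bcontfun (T (apply_bcontfun u))) (Bcontfun (T (apply_bcontfun v))) \<le> (4 * d * L) * dist u v"
    for u v :: "real \<Rightarrow>\<^sub>C 'a"
  proof (rule dist_bound)
    fix t
    have bound: "norm (integral {-d..\<tau>} (\<lambda>s. G (apply_bcontfun u s)) - integral {-d..\<tau>} (\<lambda>s. G (apply_bcontfun v s)))
        \<le> 2 * d * (L * dist u v)" if "\<tau> \<in> {-d..d}" for \<tau>
    proof -
      have "integral {-d..\<tau>} (\<lambda>s. G (apply_bcontfun u s)) - integral {-d..\<tau>} (\<lambda>s. G (apply_bcontfun v s)) =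
          integral {-d..\<tau>} (\<lambda>s. G (apply_bcontfun u s) - G (apply_bcontfun v s))"
        by (intro integral_diff[symmetric] integrable_continuous_real contGu)
      also have "norm \<dots> \<le> (L * dist u v) * (\<tau> - - d)"
      proof (rule integral_bound)
        fix s
        have "norm (G (apply_bcontfun u s) - G (apply_bcontfun v s)) \<le> L * dist (apply_bcontfun u s) (apply_bcontfun v s)"
          using L(2) by (simp add: dist_norm)
        also have "\<dots> \<le> L * dist u v" using L(1) dist_bounded[of u s v] by simp
        finally show "norm (G (apply_bcontfun u s) - G (apply_bcontfun v s)) \<le> L * dist u v" .
      qed (use that in \<open>auto intro!: continuous_on_diff contGu\<close>)
      also have "\<dots> \<le> (L * dist u v) * (2 * d)"
        using that L(1) by (intro mult_left_mono) auto
      finally show ?thesis by (simp add: mult.commute)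
    qed
    have "dist (T (apply_bcontfun u) t) (T (apply_bcontfun v) t) =
        norm ((integral {-d..c t} (\<lambda>s. G (apply_bcontfun u s)) - integral {-d..c t} (\<lambda>s. G (apply_bcontfun v s))) -
          (integral {-d..0} (\<lambda>s. G (apply_bcontfun u s)) - integral {-d..0} (\<lambda>s. G (apply_bcontfun v s))))"
      by (simp add: T_def dist_norm algebra_simps)
    \<comment> \<open>Each of the two integrals runs over a length of at most 2d; together they
      produce the contraction constant 4dL.\<close>
    also have "\<dots> \<le> 2 * d * (L * dist u v) + 2 * d * (L * dist u v)"
      using d by (intro norm_triangle_le_diff add_mono bound c) auto
    finally show "dist (apply_bcontfun (Bcontfun (T (apply_bcontfun u))) t)
        (apply_bcontfun (Bcontfun (T (apply_bcontfun v))) t) \<le> (4 * d * L) * dist u v"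
      by (simp add: T_apply algebra_simps)
  qed
  have "\<exists>!u::real \<Rightarrow>\<^sub>C 'a. Bcontfun (T (apply_bcontfun u)) = u"
    using d L(1) contraction by (intro banach_fix_type[of "4 * d * L"]) auto
  then obtain u where "Bcontfun (T (apply_bcontfun u)) = u" by blast
  then have u: "apply_bcontfun u = T (apply_bcontfun u)" using T_apply[of u] by simp
  show thesis
  proof (rule that[of "apply_bcontfun u"])
    show "apply_bcontfun u 0 = p" using d by (subst u) (simp add: T_def c_def)
    show "continuous_on UNIV (apply_bcontfun u)" by simp
    fix t assume t: "t \<in> {-d<..<d}"
    have "((\<lambda>t. integral {-d..t} (\<lambda>s. G (apply_bcontfun u s))) has_vector_derivative G (apply_bcontfun u t))
        (at t within {-d..d})"
      using t by (intro integral_has_vector_derivative contGu) auto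
    then have "((\<lambda>t. integral {-d..t} (\<lambda>s. G (apply_bcontfun u s))) has_vector_derivative G (apply_bcontfun u t)) (at t)"
      using t at_within_interior[of t "{-d..d}"] by simp
    then have "((\<lambda>t. p + integral {-d..t} (\<lambda>s. G (apply_bcontfun u s)) - integral {-d..0} (\<lambda>s. G (apply_bcontfun u s)))
        has_vector_derivative G (apply_bcontfun u t)) (at t)"
      by (auto intro!: derivative_eq_intros)
    then show "(apply_bcontfun u has_vector_derivative G (apply_bcontfun u t)) (at t)"
    proof (rule has_vector_derivative_transform_within_open[of _ _ _ "{-d<..<d}"])
      fix s assume "s \<in> {-d<..<d}"
      then have "c s = s" by (auto simp: c_def)
      then show "p + integral {-d..s} (\<lambda>s. G (apply_bcontfun u s)) - integral {-d..0} (\<lambda>s. G (apply_bcontfun u s)) =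
          apply_bcontfun u s"
        by (subst (3) u) (simp add: T_def)
    qed (use t in auto)
  qed
qed

text \<open>F is replaced by a globally Lipschitz field that agrees with it on a ball around p. By
  continuity the solution stays in the ball for a short time, and there it solves the original
  equation.\<close>

lemma smooth_ode_solution:
  fixes F :: "'a::euclidean_space \<Rightarrow> 'a"
  assumes F: "smooth_on S F" and S: "open S" "p \<in> S"
  obtains x d where "0 < d" "x 0 = p" "x ` {-d<..<d} \<subseteq> S" "smooth_on {-d<..<d} x"
    "\<And>t. t \<in> {-d<..<d} \<Longrightarrow> (x has_vector_derivative F (x t)) (at t)"
proof -
  obtain r where r: "0 < r" "cball p r \<subseteq> S" using S open_contains_cball by blast
  obtain L where L: "0 < L" "\<And>x y. x \<in> cball p r \<Longrightarrow> y \<in> cball p r \<Longrightarrow> norm (F x - F y) \<le> L * norm (x - y)"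
    using smooth_on_lipschitz_cball[OF F r(2)] by blast
  \<comment> \<open>The projection to the closed ball does not increase distances, so G inherits the
    Lipschitz constant of F on the ball.\<close>
  define G where "G x = F (closest_point (cball p r) x)" for x
  have G: "norm (G x - G y) \<le> L * norm (x - y)" for x y
  proof -
    have "cball p r \<noteq> {}" using r by auto
    note cp = closest_point_in_set[OF closed_cball this]
    have "norm (G x - G y) \<le> L * norm (closest_point (cball p r) x - closest_point (cball p r) y)"
      unfolding G_def by (intro L(2) cp)
    also have "\<dots> \<le> L * norm (x - y)"
      using closest_point_lipschitz[OF convex_cball closed_cball \<open>cball p r \<noteq> {}\<close>, of x y] L(1)
      by (simp add: dist_norm)
    finally show ?thesis .
  qed
  \<comment> \<open>This choice makes the contraction constant 4dL equal to 1/2.\<close>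
  define d where "d = 1 / (8 * L)"
  have d: "0 < d" "4 * d * L < 1" using L(1) by (auto simp: d_def)
  obtain u where u: "u 0 = p" "continuous_on UNIV u"
    "\<And>t. t \<in> {-d<..<d} \<Longrightarrow> (u has_vector_derivative G (u t)) (at t)"
    using lipschitz_ode_solution[OF L(1) G d] by blast
  have "open (u -` ball p r)" by (rule open_vimage[OF open_ball u(2)])
  moreover have "0 \<in> u -` ball p r" using u(1) r(1) by simp
  ultimately obtain e where e: "0 < e" "ball 0 e \<subseteq> u -` ball p r" using openE by blast
  define k where "k = min d e"
  have k: "0 < k" using d e by (simp add: k_def)
  have ball: "u t \<in> ball p r" if "t \<in> {-k<..<k}" for t
  proof -
    have "t \<in> ball 0 e" using that by (auto simp: k_def)
    then show ?thesis using e(2) by blast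
  qed
  have deriv: "(u has_vector_derivative F (u t)) (at t)" if "t \<in> {-k<..<k}" for t
  proof -
    have "u t \<in> cball p r" using ball[OF that] by simp
    then have "closest_point (cball p r) (u t) = u t" by (rule closest_point_self)
    then have "G (u t) = F (u t)" by (simp add: G_def)
    moreover have "t \<in> {-d<..<d}" using that by (auto simp: k_def)
    ultimately show ?thesis using u(3)[of t] by simp
  qed
  have im: "u ` {-k<..<k} \<subseteq> S" using ball r(2) ball_subset_cball by blast
  \<comment> \<open>Bootstrapping: if u is of class C^n, then so is F composed with u, which is the
    derivative of u, and hence u is of class C^(n+1).\<close>
  have "ck_on n {-k<..<k} u" for n
  proof (induction n)
    case 0
    then show ?case using u(2) continuous_on_subset by auto
  next
    case (Suc n)
    have "ck_on n S F" using F by (simp add: smooth_on_def)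
    then have "ck_on n {-k<..<k} (\<lambda>t. F (u t))" by (rule ck_on_compose[OF open_greaterThanLessThan S(1) im Suc])
    then have "ck_on n {-k<..<k} (\<lambda>t. v *\<^sub>R F (u t))" for v
      by (rule ck_on_bounded_linear[OF open_greaterThanLessThan bounded_linear_scaleR_right])
    moreover have "(u has_derivative (\<lambda>v. v *\<^sub>R F (u t))) (at t)" if "t \<in> {-k<..<k}" for t
      using deriv[OF that] by (simp only: has_vector_derivative_def)
    ultimately show ?case
      by (intro ck_on_SucI[OF open_greaterThanLessThan])
  qed
  then have "smooth_on {-k<..<k} u" by (simp add: smooth_on_def)
  with k u(1) im deriv show thesis by (intro that)
qed

section \<open>The chart at the identity\<close>

context lie_group
begin

text \<open>The chart must be the one chosen by \<open>chart_at\<close>: \<open>TR\<close>,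
  \<open>Ad\<close> and \<open>velocity\<close> are defined through that choice, so that their
  values at the identity are derivatives in exactly these coordinates.\<close>

definition edom :: "'g set" where "edom = fst (chart_at (atlas G) \<one>)"
definition echart :: "'g \<Rightarrow> 'v" where "echart = snd (chart_at (atlas G) \<one>)"
definition eimg :: "'v set" where "eimg = echart ` edom"
definition eparam :: "'v \<Rightarrow> 'g" where "eparam = inv_into edom echart"
definition epoint :: 'v where "epoint = echart \<one>"

lemma carrier_mem [simp]: "x \<in> carrier G" by (simp add: carrier_UNIV)

lemma chart_cover_G: "chart_cover (atlas G)"
  by (rule smooth_atlas_chart_cover[OF atlas])

lemma chart_at_one: "chart_at (atlas G) \<one> = (edom, echart)"
  by (simp add: edom_def echart_def)

lemma echart_mem: "(edom, echart) \<in> atlas G" and one_in_edom [simp]: "\<one> \<in> edom"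
  using chart_at_mem[OF chart_cover_G, of \<one>] by (simp_all add: chart_at_one)

lemma open_edom [simp]: "open edom" and open_eimg [simp]: "open eimg"
  using chart_coverD[OF chart_cover_G echart_mem] by (auto simp: eimg_def)

lemma eparam_echart [simp]: "x \<in> edom \<Longrightarrow> eparam (echart x) = x"
  using chart_coverD(3)[OF chart_cover_G echart_mem] by (simp add: eparam_def)

lemma echart_eparam [simp]: "y \<in> eimg \<Longrightarrow> echart (eparam y) = y"
  by (simp add: eparam_def eimg_def f_inv_into_f)

lemma eparam_in_edom [simp]: "y \<in> eimg \<Longrightarrow> eparam y \<in> edom"
  by (simp add: eparam_def eimg_def inv_into_into)

lemma echart_in_eimg [simp]: "x \<in> edom \<Longrightarrow> echart x \<in> eimg"
  by (simp add: eimg_def)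

lemma epoint_in_eimg [simp]: "epoint \<in> eimg" and eparam_epoint [simp]: "eparam epoint = \<one>"
  and echart_one [simp]: "echart \<one> = epoint"
  by (simp_all add: epoint_def)

lemma smooth_mult_on:
  assumes "smooth_map_on vec_atlas W (atlas G) f" "smooth_map_on vec_atlas W (atlas G) h"
  shows "smooth_map_on vec_atlas W (atlas G) (\<lambda>x. f x \<otimes> h x)"
  using smooth_map_on_compose[OF smooth_map_on_Pair[OF assms chart_cover_G chart_cover_G] smooth_mult
    chart_cover_prod[OF chart_cover_G chart_cover_G] chart_cover_G] by simp

lemma smooth_inv_on:
  assumes "smooth_map_on vec_atlas W (atlas G) f"
  shows "smooth_map_on vec_atlas W (atlas G) (\<lambda>x. inv (f x))"
  by (rule smooth_map_on_compose[OF assms smooth_inv chart_cover_G chart_cover_G])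

lemma smooth_eparam: "smooth_map_on vec_atlas eimg (atlas G) eparam"
  unfolding eimg_def eparam_def by (rule smooth_map_on_chart_inverse[OF atlas echart_mem])

lemma smooth_eparam_on:
  assumes "open S" "smooth_on S u" "u ` S \<subseteq> eimg"
  shows "smooth_map_on vec_atlas S (atlas G) (\<lambda>x. eparam (u x))"
  by (rule smooth_map_on_precompose[OF smooth_eparam chart_cover_G assms])

lemma open_chart_preimage:
  assumes "smooth_map_on vec_atlas W (atlas G) f" "(V, \<psi>) \<in> atlas G" shows "open (W \<inter> f -` V)"
  by (rule smooth_map_on_vec_preimage_open[OF assms(1) chart_coverD(1)[OF chart_cover_G assms(2)]])

lemma m_inv_cancel [simp]: "inv x \<otimes> (x \<otimes> y) = y" "x \<otimes> (inv x \<otimes> y) = y"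
  by (simp_all add: m_assoc[symmetric])

section \<open>One-parameter subgroups\<close>

text \<open>The hypotheses say that f and h have the same left velocity \<xi> t, the derivative of
  f(t)^(-1) f(s) at s = t. Then f h^(-1) has derivative zero in every chart, so it is locally
  constant, and constant on the connected set I.\<close>

lemma equal_unit_velocities:
  assumes I: "open I" "convex I"
    and f: "smooth_map_on vec_atlas I (atlas G) f" and h: "smooth_map_on vec_atlas I (atlas G) h"
    and vf: "\<And>t. t \<in> I \<Longrightarrow> ((\<lambda>s. echart (inv f t \<otimes> f s)) has_vector_derivative \<xi> t) (at t)"
    and vh: "\<And>t. t \<in> I \<Longrightarrow> ((\<lambda>s. echart (inv h t \<otimes> h s)) has_vector_derivative \<xi> t) (at t)"
    and t: "t \<in> I" "t' \<in> I"
  shows "f t \<otimes> inv h t = f t' \<otimes> inv h t'"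
proof -
  define c where "c s = f s \<otimes> inv h s" for s
  have c: "smooth_map_on vec_atlas I (atlas G) c"
    unfolding c_def by (intro smooth_mult_on smooth_inv_on f h)
  have zero: "((\<lambda>s. \<psi> (c s)) has_derivative (\<lambda>_. 0)) (at t)"
    if t: "t \<in> I" and V: "(V, \<psi>) \<in> atlas G" "c t \<in> V" for t V \<psi>
  proof -
    \<comment> \<open>With x and y the coordinates of f(t)^(-1) f(s) and h(t)^(-1) h(s), the value
      of q at (x, y) is f(s) h(s)^(-1). On the diagonal q is constant, so its derivative kills every
      pair (v, v), in particular the common velocity.\<close>
    define q where "q z = f t \<otimes> (eparam (fst z) \<otimes> inv (eparam (snd z))) \<otimes> inv h t" for z
    have E: "open (eimg \<times> eimg)" by (simp add: open_Times)
    have q: "smooth_map_on vec_atlas (eimg \<times> eimg) (atlas G) q"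
      unfolding q_def
      by (intro smooth_mult_on smooth_inv_on smooth_map_on_const smooth_eparam_on E smooth_intros) auto
    have q0: "(epoint, epoint) \<in> (eimg \<times> eimg) \<inter> q -` V"
      using V(2) by (simp add: q_def c_def)
    have D: "((\<lambda>z. \<psi> (q z)) has_derivative frechet_derivative (\<lambda>z. \<psi> (q z)) (at (epoint, epoint))) (at (epoint, epoint))"
      (is "(_ has_derivative ?D) _")
      by (rule smooth_on_has_derivative[OF smooth_map_on_vec_chart[OF q V(1)] q0])
    have "((\<lambda>x. \<psi> (q (x, x))) has_derivative (\<lambda>v. ?D (v, v))) (at epoint)"
      by (rule has_derivative_at_compose[of "\<lambda>x. (x, x)" "\<lambda>v. (v, v)", OF _ refl D])
        (auto intro!: derivative_eq_intros)
    moreover have "((\<lambda>x. \<psi> (q (x, x))) has_derivative (\<lambda>v. 0)) (at epoint)"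
      by (rule has_derivative_transform_within_open[of "\<lambda>x. \<psi> (c t)" _ _ _ eimg]) (auto simp: q_def c_def)
    ultimately have "(\<lambda>v. ?D (v, v)) = (\<lambda>v. 0)" by (rule has_derivative_unique)
    then have D0: "?D (v, v) = 0" for v by (rule fun_cong)
    define w where "w s = (echart (inv f t \<otimes> f s), echart (inv h t \<otimes> h s))" for s
    have "w t = (epoint, epoint)" by (simp add: w_def)
    moreover have "(w has_derivative (\<lambda>r. (r *\<^sub>R \<xi> t, r *\<^sub>R \<xi> t))) (at t)"
      unfolding w_def using vf[OF t] vh[OF t]
      by (intro has_derivative_Pair) (simp_all add: has_vector_derivative_def)
    ultimately have "((\<lambda>s. \<psi> (q (w s))) has_derivative (\<lambda>r. ?D (r *\<^sub>R \<xi> t, r *\<^sub>R \<xi> t))) (at t)"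
      by (intro has_derivative_at_compose[of w _ t, OF _ _ D])
    then have "((\<lambda>s. \<psi> (q (w s))) has_derivative (\<lambda>r. 0)) (at t)" by (simp only: D0)
    then show ?thesis
    proof (rule has_derivative_transform_within_open)
      have "smooth_map_on vec_atlas I (atlas G) (\<lambda>s. inv f t \<otimes> f s)"
        "smooth_map_on vec_atlas I (atlas G) (\<lambda>s. inv h t \<otimes> h s)"
        by (intro smooth_mult_on smooth_map_on_const f h I)+
      from this[THEN open_chart_preimage, OF echart_mem]
      show "open ((I \<inter> (\<lambda>s. inv f t \<otimes> f s) -` edom) \<inter> (I \<inter> (\<lambda>s. inv h t \<otimes> h s) -` edom))"
        by (rule open_Int)
    qed (use t in \<open>auto simp: q_def w_def c_def m_assoc inv_mult_group\<close>)
  qed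
  have "eventually (\<lambda>s. c t = c s) (at t within I)" if t: "t \<in> I" for t
  proof -
    obtain V \<psi> where V: "(V, \<psi>) \<in> atlas G" "c t \<in> V" by (rule chart_coverE[OF chart_cover_G])
    obtain e where e: "0 < e" "ball t e \<subseteq> I \<inter> c -` V"
      using open_chart_preimage[OF c V(1)] t V(2) openE[of "I \<inter> c -` V" t] by blast
    \<comment> \<open>The coordinate expression has zero derivative on a ball and is constant there;
      injectivity of the chart carries this back to the group.\<close>
    have "\<psi> (c s) = \<psi> (c t)" if "s \<in> ball t e" for s
    proof (rule has_derivative_zero_unique[of "ball t e"])
      show "((\<lambda>s. \<psi> (c s)) has_derivative (\<lambda>h. 0)) (at x within ball t e)" if "x \<in> ball t e" for x
        using that e(2) V(1) by (intro has_derivative_at_withinI[OF zero]) auto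
    qed (use that e(1) in auto)
    then have "c t = c s" if "s \<in> ball t e" for s
      using that e chart_coverD(3)[OF chart_cover_G V(1)] V(2) by (metis IntD2 inj_onD subsetD vimageE)
    then show ?thesis unfolding eventually_at using e(1) by (auto simp: dist_commute)
  qed
  then have "c t = c t'"
    by (intro connected_local_const[OF convex_connected[OF I(2)] t]) auto
  then show ?thesis by (simp add: c_def)
qed

text \<open>The curve is an integral curve of the left invariant vector field with value \<xi> at
  the identity. For fixed s the curves \<gamma>(s + t) and \<gamma>(t) have the same left velocity
  in t, so their quotient is constant, and its value at t = 0 is \<gamma>(s).\<close>

lemma local_one_param_subgroup:
  obtains \<gamma> d where "0 < d" "smooth_map_on vec_atlas {-d<..<d} (atlas G) \<gamma>" "\<gamma> 0 = \<one>"
    "\<And>s t. s \<in> {-d<..<d} \<Longrightarrow> t \<in> {-d<..<d} \<Longrightarrow> s + t \<in> {-d<..<d} \<Longrightarrow> \<gamma> (s + t) = \<gamma> s \<otimes> \<gamma> t"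
    "((\<lambda>t. echart (\<gamma> t)) has_vector_derivative \<xi>) (at 0)"
proof -
  have E: "open (eimg \<times> eimg)" by (simp add: open_Times)
  define m where "m z = eparam (fst z) \<otimes> eparam (snd z)" for z
  have m: "smooth_map_on vec_atlas (eimg \<times> eimg) (atlas G) m"
    unfolding m_def by (intro smooth_mult_on smooth_eparam_on E smooth_intros) auto
  let ?N = "(eimg \<times> eimg) \<inter> m -` edom"
  have N: "open ?N" by (rule open_chart_preimage[OF m echart_mem])
  have mN: "smooth_on ?N (\<lambda>z. echart (m z))" by (rule smooth_map_on_vec_chart[OF m echart_mem])
  have unit: "(x, epoint) \<in> ?N" if "x \<in> eimg" for x using that by (simp add: m_def)
  \<comment> \<open>The left invariant vector field in coordinates: the derivative at the identity
    of left translation by \<open>eparam x\<close>, applied to \<xi>.\<close>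
  define F where "F x = frechet_derivative (\<lambda>z. echart (m z)) (at (x, epoint)) (0, \<xi>)" for x
  have F: "smooth_on eimg F"
    unfolding F_def
    by (rule smooth_on_frechet_derivative[OF mN N]) (auto intro!: smooth_intros simp: m_def)
  obtain x d where x: "0 < d" "x 0 = epoint" "x ` {-d<..<d} \<subseteq> eimg" "smooth_on {-d<..<d} x"
    "\<And>t. t \<in> {-d<..<d} \<Longrightarrow> (x has_vector_derivative F (x t)) (at t)"
    by (rule smooth_ode_solution[OF F open_eimg epoint_in_eimg]) (rule that)
  define \<gamma> where "\<gamma> t = eparam (x t)" for t
  have \<gamma>: "smooth_map_on vec_atlas {-d<..<d} (atlas G) \<gamma>"
    unfolding \<gamma>_def by (intro smooth_eparam_on x) auto
  have vel: "((\<lambda>s. echart (inv \<gamma> t \<otimes> \<gamma> s)) has_vector_derivative \<xi>) (at t)" if t: "t \<in> {-d<..<d}" for t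
  proof -
    have xt: "x t \<in> eimg" using x(3) t by auto
    define K where "K z = inv \<gamma> t \<otimes> eparam z" for z
    have K: "smooth_map_on vec_atlas eimg (atlas G) K"
      unfolding K_def by (intro smooth_mult_on smooth_map_on_const smooth_eparam) auto
    have DK: "((\<lambda>z. echart (K z)) has_derivative frechet_derivative (\<lambda>z. echart (K z)) (at (x t))) (at (x t))"
      (is "(_ has_derivative ?DK) _")
      using xt by (intro smooth_on_has_derivative[OF smooth_map_on_vec_chart[OF K echart_mem]])
        (simp add: K_def \<gamma>_def)
    have Dm: "((\<lambda>z. echart (m z)) has_derivative frechet_derivative (\<lambda>z. echart (m z)) (at (x t, epoint))) (at (x t, epoint))"
      (is "(_ has_derivative ?Dm) _")
      by (rule smooth_on_has_derivative[OF mN unit[OF xt]])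
    have "((\<lambda>y. echart (m (x t, y))) has_derivative (\<lambda>v. ?Dm (0, v))) (at epoint)"
      by (rule has_derivative_at_compose[of "\<lambda>y. (x t, y)" "\<lambda>v. (0, v)", OF _ refl Dm])
        (auto intro!: derivative_eq_intros)
    moreover have "echart (m (x t, epoint)) = x t" using xt by (simp add: m_def)
    ultimately have "((\<lambda>y. echart (K (echart (m (x t, y))))) has_derivative (\<lambda>v. ?DK (?Dm (0, v)))) (at epoint)"
      by (rule has_derivative_at_compose[of "\<lambda>y. echart (m (x t, y))", OF _ _ DK])
    \<comment> \<open>K is left translation by the inverse of \<gamma>(t) and undoes the translation
      hidden in F, so the derivative of K sends F (x t) back to \<xi>.\<close>
    moreover have "((\<lambda>y. echart (K (echart (m (x t, y))))) has_derivative (\<lambda>v. v)) (at epoint)"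
    proof (rule has_derivative_transform_within_open[OF has_derivative_ident])
      show "open ((\<lambda>y. (x t, y)) -` ?N)" by (intro open_vimage[OF N] continuous_intros)
    qed (use unit[OF xt] in \<open>auto simp: K_def m_def \<gamma>_def\<close>)
    ultimately have "(\<lambda>v. ?DK (?Dm (0, v))) = (\<lambda>v. v)" by (rule has_derivative_unique)
    then have "?DK (F (x t)) = \<xi>" unfolding F_def by (rule fun_cong)
    moreover have "((\<lambda>s. echart (K (x s))) has_derivative (\<lambda>r. ?DK (r *\<^sub>R F (x t)))) (at t)"
      using x(5)[OF t] unfolding has_vector_derivative_def
      by (rule has_derivative_at_compose[of x, OF _ refl DK])
    ultimately show ?thesis
      using linear_scale[OF has_derivative_linear[OF DK]]
      by (simp add: has_vector_derivative_def K_def \<gamma>_def)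
  qed
  have \<gamma>0: "\<gamma> 0 = \<one>" by (simp add: \<gamma>_def x(2))
  have "\<gamma> (s + t) = \<gamma> s \<otimes> \<gamma> t" if s: "s \<in> {-d<..<d}" and t: "t \<in> {-d<..<d}" "s + t \<in> {-d<..<d}" for s t
  proof -
    \<comment> \<open>The times t at which \<gamma>(t) and \<gamma>(s + t) both lie in the local
      domain: an open interval that contains 0.\<close>
    let ?I = "{-d<..<d} \<inter> {-d-s<..<d-s}"
    have "\<gamma> (s + t) \<otimes> inv \<gamma> t = \<gamma> (s + 0) \<otimes> inv \<gamma> 0"
    proof (rule equal_unit_velocities[of ?I "\<lambda>t. \<gamma> (s + t)" \<gamma>])
      show "open ?I" "convex ?I" by (auto intro: open_Int convex_Int)
      show "smooth_map_on vec_atlas ?I (atlas G) \<gamma>" by (rule smooth_map_on_subset[OF \<gamma>]) auto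
      show "smooth_map_on vec_atlas ?I (atlas G) (\<lambda>t. \<gamma> (s + t))"
        by (rule smooth_map_on_precompose[OF \<gamma> chart_cover_G]) (auto intro!: smooth_intros open_Int)
      fix r assume r: "r \<in> ?I"
      then show "((\<lambda>s. echart (inv \<gamma> r \<otimes> \<gamma> s)) has_vector_derivative \<xi>) (at r)" using vel[of r] by auto
      have D: "((\<lambda>u. echart (inv \<gamma> (s + r) \<otimes> \<gamma> u)) has_derivative (\<lambda>u. u *\<^sub>R \<xi>)) (at (s + r))"
        using vel[of "s + r"] r by (auto simp: has_vector_derivative_def)
      have "((\<lambda>u. echart (inv \<gamma> (s + r) \<otimes> \<gamma> (s + u))) has_derivative (\<lambda>u. u *\<^sub>R \<xi>)) (at r)"
        by (rule has_derivative_at_compose[of "\<lambda>u. s + u" "\<lambda>u. u", OF _ refl D]) (auto intro!: derivative_eq_intros)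
      then show "((\<lambda>u. echart (inv \<gamma> (s + r) \<otimes> \<gamma> (s + u))) has_vector_derivative \<xi>) (at r)"
        by (simp add: has_vector_derivative_def)
    qed (use s t x(1) in auto)
    then have "\<gamma> (s + t) \<otimes> inv \<gamma> t \<otimes> \<gamma> t = \<gamma> s \<otimes> \<gamma> t" by (simp add: \<gamma>0)
    then show ?thesis by (simp add: m_assoc)
  qed
  moreover have "((\<lambda>t. echart (\<gamma> t)) has_vector_derivative \<xi>) (at 0)"
    using vel[of 0] x(1) by (simp add: \<gamma>0)
  ultimately show thesis by (rule that[OF x(1) \<gamma> \<gamma>0])
qed

lemma open_preimage_edom:
  "smooth_map_on vec_atlas W (atlas G) f \<Longrightarrow> open (W \<inter> f -` edom)"
  by (rule open_chart_preimage[OF _ echart_mem])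

lemma smooth_on_echart:
  "smooth_map_on vec_atlas W (atlas G) f \<Longrightarrow> smooth_on (W \<inter> f -` edom) (\<lambda>x. echart (f x))"
  by (rule smooth_map_on_vec_chart[OF _ echart_mem])

lemma smooth_pow_on:
  "smooth_map_on vec_atlas W (atlas G) f \<Longrightarrow> smooth_map_on vec_atlas W (atlas G) (\<lambda>x. f x [^] (n::nat))"
  by (induction n) (auto intro: smooth_mult_on smooth_map_on_const smooth_map_on_vec_open)

text \<open>A local solution is extended by \<Gamma>(t) = \<gamma>(t/n)^n with n so large that t/n
  lies in the local domain. Two admissible n and k give the same value, as both powers equal
  \<gamma>(t/(nk))^(nk). A fixed n serves a whole interval, which gives smoothness.\<close>

lemma one_param_subgroup_exists:
  obtains \<gamma> where "one_param_subgroup G \<gamma>" "((\<lambda>t. echart (\<gamma> t)) has_vector_derivative \<xi>) (at 0)"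
proof -
  obtain \<gamma> d where d: "0 < d" and \<gamma>: "smooth_map_on vec_atlas {-d<..<d} (atlas G) \<gamma>" "\<gamma> 0 = \<one>"
    "\<And>s t. s \<in> {-d<..<d} \<Longrightarrow> t \<in> {-d<..<d} \<Longrightarrow> s + t \<in> {-d<..<d} \<Longrightarrow> \<gamma> (s + t) = \<gamma> s \<otimes> \<gamma> t"
    "((\<lambda>t. echart (\<gamma> t)) has_vector_derivative \<xi>) (at 0)"
    by (rule local_one_param_subgroup[of \<xi>]) (rule that)
  have pow: "\<gamma> (real j * u) = \<gamma> u [^] j" if "\<bar>u\<bar> * real j < d" for j u
    using that
  proof (induction j)
    case (Suc j)
    have j: "\<bar>u\<bar> * real j < d" using Suc.prems by (simp add: algebra_simps)
    have ju: "\<bar>real j * u\<bar> < d" using j by (simp add: abs_mult mult.commute)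
    have Sju: "\<bar>real j * u + u\<bar> < d"
    proof -
      have "real j * u + u = real (Suc j) * u" by (simp add: algebra_simps)
      then show ?thesis using Suc.prems by (simp only: abs_mult) (simp add: mult.commute)
    qed
    have "\<bar>u\<bar> * 1 \<le> \<bar>u\<bar> * real (Suc j)" by (rule mult_left_mono) auto
    then have u: "\<bar>u\<bar> < d" using Suc.prems by simp
    have "\<gamma> (real j * u + u) = \<gamma> (real j * u) \<otimes> \<gamma> u"
      using ju Sju u by (intro \<gamma>(3)) auto
    then show ?case using Suc.IH[OF j] by (simp add: algebra_simps)
  qed (simp add: \<gamma>(2))
  \<comment> \<open>The successor makes n positive and the inequality |t| < n d strict, also when
    |t|/d is an integer.\<close>
  define \<Gamma> where "\<Gamma> t = (let n = Suc (nat \<lceil>\<bar>t\<bar> / d\<rceil>) in \<gamma> (t / real n) [^] n)" for t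
  have refine: "\<gamma> (t / real n) [^] n = \<gamma> (t / (real n * real k)) [^] (n * k)"
    if "0 < n" "0 < k" "\<bar>t\<bar> < real n * d" for t n k
  proof -
    have "\<gamma> (real k * (t / (real n * real k))) = \<gamma> (t / (real n * real k)) [^] k"
      using that by (intro pow) (simp add: field_simps abs_mult)
    moreover have "real k * (t / (real n * real k)) = t / real n" using that by simp
    ultimately show ?thesis by (simp add: nat_pow_pow mult.commute)
  qed
  have \<Gamma>: "\<Gamma> t = \<gamma> (t / real n) [^] n" if n: "0 < n" "\<bar>t\<bar> < real n * d" for t n
  proof -
    define k where "k = Suc (nat \<lceil>\<bar>t\<bar> / d\<rceil>)"
    have "\<bar>t\<bar> / d \<le> real (nat \<lceil>\<bar>t\<bar> / d\<rceil>)" by (rule real_nat_ceiling_ge)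
    then have "\<bar>t\<bar> / d < real k" by (simp add: k_def)
    then have k: "\<bar>t\<bar> < real k * d" "0 < k" using d by (simp_all add: field_simps k_def)
    have "\<Gamma> t = \<gamma> (t / real k) [^] k" by (simp add: \<Gamma>_def k_def Let_def)
    also have "\<dots> = \<gamma> (t / real n) [^] n"
      using refine[of n k t] refine[of k n t] n k by (simp add: mult.commute)
    finally show ?thesis .
  qed
  have large: "\<exists>n>0. r < real n * d" for r
  proof -
    obtain n where n: "r < real n * d" using reals_Archimedean3[OF d] by blast
    also have "\<dots> \<le> real (Suc n) * d" using d by (intro mult_right_mono) auto
    finally show ?thesis by blast
  qed
  have "\<Gamma> (s + t) = \<Gamma> s \<otimes> \<Gamma> t" for s t
  proof -
    obtain n where n: "0 < n" "\<bar>s\<bar> + \<bar>t\<bar> < real n * d" using large by blast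
    have b: "\<bar>s\<bar> < real n * d" "\<bar>t\<bar> < real n * d" "\<bar>s + t\<bar> < real n * d" using n by linarith+
    have I: "r / real n \<in> {-d<..<d}" if "\<bar>r\<bar> < real n * d" for r
      using that n(1) by (auto simp: field_simps abs_less_iff)
    have st: "\<gamma> (s / real n + t / real n) = \<gamma> (s / real n) \<otimes> \<gamma> (t / real n)"
      using I[OF b(1)] I[OF b(2)] I[OF b(3)] by (intro \<gamma>(3)) (simp_all add: add_divide_distrib)
    have ts: "\<gamma> (t / real n + s / real n) = \<gamma> (t / real n) \<otimes> \<gamma> (s / real n)"
      using I[OF b(1)] I[OF b(2)] I[OF b(3)] by (intro \<gamma>(3)) (simp_all add: add_divide_distrib add.commute)
    \<comment> \<open>Both orders represent \<gamma> at the sum of the arguments. Commutation is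
      what lets the n-th power be distributed over the product.\<close>
    have "\<gamma> (s / real n) \<otimes> \<gamma> (t / real n) = \<gamma> (t / real n) \<otimes> \<gamma> (s / real n)"
      using st ts by (simp add: add.commute)
    then have "(\<gamma> (s / real n) \<otimes> \<gamma> (t / real n)) [^] n = \<gamma> (s / real n) [^] n \<otimes> \<gamma> (t / real n) [^] n"
      by (intro pow_mult_distrib) auto
    then show ?thesis
      using \<Gamma>[OF n(1) b(1)] \<Gamma>[OF n(1) b(2)] \<Gamma>[OF n(1) b(3)] st by (simp add: add_divide_distrib)
  qed
  moreover have "smooth_map_on vec_atlas UNIV (atlas G) \<Gamma>"
  proof (rule smooth_map_on_local[OF chart_cover_G])
    fix t :: real
    obtain n where n: "0 < n" "\<bar>t\<bar> < real n * d" using large by blast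
    let ?N = "{-(real n * d)<..<real n * d}"
    have "smooth_on ?N (\<lambda>r. (1 / real n) * r)"
      by (intro smooth_intros) auto
    then have "smooth_map_on vec_atlas ?N (atlas G) (\<lambda>r. \<gamma> ((1 / real n) * r))"
      using n(1) by (intro smooth_map_on_precompose[OF \<gamma>(1) chart_cover_G]) (auto simp: field_simps)
    then have "smooth_map_on vec_atlas ?N (atlas G) (\<lambda>r. \<gamma> (r / real n))" by simp
    from smooth_map_on_cong[OF smooth_pow_on[OF this, of n] chart_cover_G, of \<Gamma>]
    have "smooth_map_on vec_atlas ?N (atlas G) \<Gamma>"
      using \<Gamma>[OF n(1)] by (simp add: abs_less_iff)
    then show "\<exists>N. t \<in> N \<and> N \<subseteq> UNIV \<and> smooth_map_on vec_atlas N (atlas G) \<Gamma>"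
      using n(2) by (intro exI[of _ ?N]) auto
  qed
  ultimately have "one_param_subgroup G \<Gamma>" by (simp add: one_param_subgroup_def)
  moreover have "((\<lambda>t. echart (\<Gamma> t)) has_vector_derivative \<xi>) (at 0)"
    by (rule has_vector_derivative_transform_within_open[OF \<gamma>(4), of "{-d<..<d}"])
      (use d \<Gamma>[of 1] in \<open>auto simp: abs_less_iff\<close>)
  ultimately show thesis by (rule that)
qed

section \<open>Uniqueness of one-parameter subgroups and the exponential map\<close>

lemma one_param_subgroup_zero:
  assumes "one_param_subgroup G \<gamma>" shows "\<gamma> 0 = \<one>"
proof -
  have "\<gamma> (0 + 0) = \<gamma> 0 \<otimes> \<gamma> 0" using assms unfolding one_param_subgroup_def by blast
  then show ?thesis by simp
qed

lemma one_param_subgroup_diff: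
  assumes "one_param_subgroup G \<gamma>" shows "inv \<gamma> t \<otimes> \<gamma> s = \<gamma> (s - t)"
proof -
  have "\<gamma> (t + (s - t)) = \<gamma> t \<otimes> \<gamma> (s - t)" using assms unfolding one_param_subgroup_def by blast
  then show ?thesis by simp
qed

lemma one_param_subgroup_velocity:
  assumes "one_param_subgroup G \<gamma>" shows "((\<lambda>t. echart (\<gamma> t)) has_vector_derivative velocity (atlas G) \<gamma> 0) (at 0)"
proof -
  have \<gamma>: "smooth_map_on vec_atlas UNIV (atlas G) \<gamma>" using assms by (simp add: one_param_subgroup_def)
  let ?D = "frechet_derivative (\<lambda>t. echart (\<gamma> t)) (at 0)"
  have D: "((\<lambda>t. echart (\<gamma> t)) has_derivative ?D) (at 0)"
    using one_param_subgroup_zero[OF assms]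
    by (intro smooth_on_has_derivative[OF smooth_on_echart[OF \<gamma>]]) simp
  have "((\<lambda>t. echart (\<gamma> t)) has_vector_derivative ?D 1) (at 0)"
    by (rule has_derivative_imp_has_vector_derivative[OF D])
  moreover from this have "velocity (atlas G) \<gamma> 0 = ?D 1"
    by (intro velocity_eqI[of _ _ _ edom echart]) (simp_all add: one_param_subgroup_zero[OF assms] chart_at_one)
  ultimately show ?thesis by simp
qed

text \<open>Since \<gamma>(t)^(-1) \<gamma>(s) = \<gamma>(s - t), the left velocity at every time is
  the velocity at 0. Two such curves with equal initial velocity have a constant quotient, which is
  the identity at time 0.\<close>

lemma one_param_subgroup_unique:
  assumes "one_param_subgroup G \<gamma>" "one_param_subgroup G \<delta>"
    and "((\<lambda>t. echart (\<gamma> t)) has_vector_derivative \<xi>) (at 0)" "((\<lambda>t. echart (\<delta> t)) has_vector_derivative \<xi>) (at 0)"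
  shows "\<gamma> = \<delta>"
proof
  have vel: "((\<lambda>s. echart (inv \<gamma> t \<otimes> \<gamma> s)) has_vector_derivative \<xi>) (at t)"
    if \<gamma>: "one_param_subgroup G \<gamma>" "((\<lambda>t. echart (\<gamma> t)) has_vector_derivative \<xi>) (at 0)" for \<gamma> t
  proof -
    have D: "((\<lambda>s. echart (\<gamma> s)) has_derivative (\<lambda>r. r *\<^sub>R \<xi>)) (at 0)"
      using \<gamma>(2) by (simp only: has_vector_derivative_def)
    have "((\<lambda>s. echart (\<gamma> (s - t))) has_derivative (\<lambda>r. r *\<^sub>R \<xi>)) (at t)"
      by (rule has_derivative_at_compose[of "\<lambda>s. s - t" "\<lambda>r. r", OF _ _ D]) (auto intro!: derivative_eq_intros)
    then show ?thesis by (simp add: has_vector_derivative_def one_param_subgroup_diff[OF \<gamma>(1)])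
  qed
  fix t
  have "\<gamma> t \<otimes> inv \<delta> t = \<gamma> 0 \<otimes> inv \<delta> 0"
    using assms by (intro equal_unit_velocities[of UNIV \<gamma> \<delta> "\<lambda>_. \<xi>"] vel) (auto simp: one_param_subgroup_def)
  then have "\<gamma> t \<otimes> inv \<delta> t \<otimes> \<delta> t = \<delta> t"
    using one_param_subgroup_zero[OF assms(1)] one_param_subgroup_zero[OF assms(2)] by simp
  then show "\<gamma> t = \<delta> t" by (simp add: m_assoc)
qed

lemma lie_exp_eq:
  assumes "one_param_subgroup G \<gamma>" "((\<lambda>t. echart (\<gamma> t)) has_vector_derivative \<xi>) (at 0)"
  shows "lie_exp G \<xi> = \<gamma> 1"
proof -
  have "(THE \<gamma>. one_param_subgroup G \<gamma> \<and> velocity (atlas G) \<gamma> 0 = \<xi>) = \<gamma>"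
  proof (rule the_equality)
    show "one_param_subgroup G \<gamma> \<and> velocity (atlas G) \<gamma> 0 = \<xi>"
      using assms(1) vector_derivative_unique_at[OF one_param_subgroup_velocity[OF assms(1)] assms(2)] by simp
    show "\<delta> = \<gamma>" if "one_param_subgroup G \<delta> \<and> velocity (atlas G) \<delta> 0 = \<xi>" for \<delta>
      using that one_param_subgroup_velocity[of \<delta>] assms by (intro one_param_subgroup_unique) auto
  qed
  then show ?thesis by (simp add: lie_exp_def)
qed

text \<open>The one-parameter subgroup for t \<xi> is that for \<xi> run at speed t; its value at
  time 1 is \<gamma>(t).\<close>

lemma lie_exp_curve:
  obtains \<gamma> where "one_param_subgroup G \<gamma>" "((\<lambda>t. echart (\<gamma> t)) has_vector_derivative \<xi>) (at 0)"
    "\<And>t. lie_exp G (t *\<^sub>R \<xi>) = \<gamma> t"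
proof -
  obtain \<gamma> where \<gamma>: "one_param_subgroup G \<gamma>" "((\<lambda>t. echart (\<gamma> t)) has_vector_derivative \<xi>) (at 0)"
    by (rule one_param_subgroup_exists)
  have "lie_exp G (t *\<^sub>R \<xi>) = \<gamma> (t * 1)" for t
  proof (rule lie_exp_eq[of "\<lambda>s. \<gamma> (t * s)"])
    have "smooth_map_on vec_atlas UNIV (atlas G) \<gamma>" using \<gamma>(1) by (simp add: one_param_subgroup_def)
    then have "smooth_map_on vec_atlas UNIV (atlas G) (\<lambda>s. \<gamma> (t * s))"
      by (rule smooth_map_on_precompose[OF _ chart_cover_G]) (auto intro!: smooth_intros)
    then show "one_param_subgroup G (\<lambda>s. \<gamma> (t * s))"
      using \<gamma>(1) by (simp add: one_param_subgroup_def distrib_left)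
    have D: "((\<lambda>s. echart (\<gamma> s)) has_derivative (\<lambda>r. r *\<^sub>R \<xi>)) (at 0)"
      using \<gamma>(2) by (simp only: has_vector_derivative_def)
    have "((\<lambda>s. echart (\<gamma> (t * s))) has_derivative (\<lambda>r. (t * r) *\<^sub>R \<xi>)) (at 0)"
      by (rule has_derivative_at_compose[of "\<lambda>s. t * s" "\<lambda>r. t * r", OF _ _ D]) (auto intro!: derivative_eq_intros)
    then show "((\<lambda>s. echart (\<gamma> (t * s))) has_vector_derivative t *\<^sub>R \<xi>) (at 0)"
      by (simp add: has_vector_derivative_def mult.commute)
  qed
  with \<gamma> show thesis by (intro that[of \<gamma>]) simp_all
qed

section \<open>The adjoint representation\<close>

text \<open>Conjugation fixes the identity, so both charts in the definition of \<open>Ad\<close>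
  are the chart at the identity.\<close>

lemma Ad_has_derivative:
  "((\<lambda>x. echart (inv k \<otimes> eparam x \<otimes> k)) has_derivative Ad G k) (at epoint)"
proof -
  have K: "smooth_map_on vec_atlas eimg (atlas G) (\<lambda>x. inv k \<otimes> eparam x \<otimes> k)"
    by (intro smooth_mult_on smooth_map_on_const smooth_eparam open_eimg)
  have D: "((\<lambda>x. echart (inv k \<otimes> eparam x \<otimes> k)) has_derivative
      frechet_derivative (\<lambda>x. echart (inv k \<otimes> eparam x \<otimes> k)) (at epoint)) (at epoint)"
    by (rule smooth_on_has_derivative[OF smooth_on_echart[OF K]]) simp
  then have "Ad G k = frechet_derivative (\<lambda>x. echart (inv k \<otimes> eparam x \<otimes> k)) (at epoint)"
    unfolding Ad_def
    by (intro tangent_map_eqI[of _ _ edom echart _ _ edom echart]) (simp_all add: chart_at_one eparam_def)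
  then show ?thesis using D by simp
qed

lemma linear_Ad: "linear (Ad G k)"
  by (rule has_derivative_linear[OF Ad_has_derivative])

text \<open>This is the partial derivative, at the identity and in the second variable, of
  conjugation as a smooth function of both the conjugating and the conjugated element.\<close>

lemma smooth_on_Ad: "smooth_on eimg (\<lambda>y. Ad G (eparam y) \<eta>)"
proof -
  have E: "open (eimg \<times> eimg)" by (simp add: open_Times)
  define m where "m z = inv (eparam (fst z)) \<otimes> eparam (snd z) \<otimes> eparam (fst z)" for z
  have m: "smooth_map_on vec_atlas (eimg \<times> eimg) (atlas G) m"
    unfolding m_def by (intro smooth_mult_on smooth_inv_on smooth_eparam_on E smooth_intros) auto
  let ?N = "(eimg \<times> eimg) \<inter> m -` edom"
  have N: "open ?N" by (rule open_preimage_edom[OF m])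
  have mN: "smooth_on ?N (\<lambda>z. echart (m z))" by (rule smooth_on_echart[OF m])
  have unit: "(y, epoint) \<in> ?N" if "y \<in> eimg" for y using that by (simp add: m_def)
  have "smooth_on eimg (\<lambda>y. frechet_derivative (\<lambda>z. echart (m z)) (at (y, epoint)) (0, \<eta>))"
    by (rule smooth_on_frechet_derivative[OF mN N]) (auto intro!: smooth_intros simp: m_def)
  then show ?thesis
  proof (rule smooth_on_cong[OF _ open_eimg])
    fix y assume y: "y \<in> eimg"
    let ?D = "frechet_derivative (\<lambda>z. echart (m z)) (at (y, epoint))"
    have D: "((\<lambda>z. echart (m z)) has_derivative ?D) (at (y, epoint))"
      by (rule smooth_on_has_derivative[OF mN unit[OF y]])
    have "((\<lambda>x. echart (m (y, x))) has_derivative (\<lambda>v. ?D (0, v))) (at epoint)"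
      by (rule has_derivative_at_compose[of "\<lambda>x. (y, x)" "\<lambda>v. (0, v)", OF _ refl D])
        (auto intro!: derivative_eq_intros)
    then have "(\<lambda>v. ?D (0, v)) = Ad G (eparam y)"
      by (rule has_derivative_unique) (simp add: m_def Ad_has_derivative)
    then show "?D (0, \<eta>) = Ad G (eparam y) \<eta>" by (rule fun_cong)
  qed
qed

text \<open>\<open>ad\<close> differentiates along the curve exp(t \<xi>), whose velocity at 0 in
  the chart is \<xi>. The chain rule identifies it with the derivative of one fixed map, from which
  linearity in \<xi> can be read off.\<close>

lemma Ad_chart_has_derivative:
  "((\<lambda>y. Ad G (eparam y) \<eta>) has_derivative (\<lambda>\<xi>. ad G \<xi> \<eta>)) (at epoint)"
proof -
  let ?D = "frechet_derivative (\<lambda>y. Ad G (eparam y) \<eta>) (at epoint)"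
  have D: "((\<lambda>y. Ad G (eparam y) \<eta>) has_derivative ?D) (at epoint)"
    by (rule smooth_on_has_derivative[OF smooth_on_Ad epoint_in_eimg])
  have "ad G \<xi> \<eta> = ?D \<xi>" for \<xi>
  proof -
    obtain \<gamma> where \<gamma>: "one_param_subgroup G \<gamma>" "((\<lambda>t. echart (\<gamma> t)) has_vector_derivative \<xi>) (at 0)"
      "\<And>t. lie_exp G (t *\<^sub>R \<xi>) = \<gamma> t" by (rule lie_exp_curve) (rule that)
    have s: "smooth_map_on vec_atlas UNIV (atlas G) \<gamma>" using \<gamma>(1) by (simp add: one_param_subgroup_def)
    have 0: "\<gamma> 0 = \<one>" by (rule one_param_subgroup_zero[OF \<gamma>(1)])
    have "((\<lambda>t. Ad G (eparam (echart (\<gamma> t))) \<eta>) has_derivative (\<lambda>r. ?D (r *\<^sub>R \<xi>))) (at 0)"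
      using \<gamma>(2) 0
      by (intro has_derivative_at_compose[of "\<lambda>t. echart (\<gamma> t)", OF _ _ D]) (simp_all add: has_vector_derivative_def)
    then have "((\<lambda>t. Ad G (eparam (echart (\<gamma> t))) \<eta>) has_vector_derivative ?D \<xi>) (at 0)"
      using linear_scale[OF has_derivative_linear[OF D]] by (simp add: has_vector_derivative_def)
    then have "((\<lambda>t. Ad G (\<gamma> t) \<eta>) has_vector_derivative ?D \<xi>) (at 0)"
      by (rule has_vector_derivative_transform_within_open[OF _ open_preimage_edom[OF s]]) (auto simp: 0)
    then show ?thesis unfolding ad_def \<gamma>(3) by (rule vector_derivative_at)
  qed
  with D show ?thesis by simp
qed

text \<open>In the first argument \<open>ad\<close> is a derivative, hence linear. In the second,
  linearity of \<open>Ad\<close> is inherited through uniqueness of derivatives. Boundedness is a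
  matter of finite dimension.\<close>

lemma bounded_bilinear_ad: "bounded_bilinear (ad G)"
proof -
  have "linear (\<lambda>\<xi>. ad G \<xi> \<eta>)" for \<eta> by (rule has_derivative_linear[OF Ad_chart_has_derivative])
  moreover have "linear (ad G \<xi>)" for \<xi>
  proof (rule linearI)
    fix \<eta> \<eta>' r
    have "((\<lambda>y. Ad G (eparam y) (\<eta> + \<eta>')) has_derivative (\<lambda>\<xi>. ad G \<xi> \<eta> + ad G \<xi> \<eta>')) (at epoint)"
      by (simp add: linear_add[OF linear_Ad] has_derivative_add[OF Ad_chart_has_derivative Ad_chart_has_derivative])
    from has_derivative_unique[OF Ad_chart_has_derivative this]
    show "ad G \<xi> (\<eta> + \<eta>') = ad G \<xi> \<eta> + ad G \<xi> \<eta>'" by (rule fun_cong)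
    have "((\<lambda>y. Ad G (eparam y) (r *\<^sub>R \<eta>)) has_derivative (\<lambda>\<xi>. r *\<^sub>R ad G \<xi> \<eta>)) (at epoint)"
      by (simp add: linear_scale[OF linear_Ad] has_derivative_scaleR_right[OF Ad_chart_has_derivative])
    from has_derivative_unique[OF Ad_chart_has_derivative this]
    show "ad G \<xi> (r *\<^sub>R \<eta>) = r *\<^sub>R ad G \<xi> \<eta>" by (rule fun_cong)
  qed
  ultimately show ?thesis
    unfolding bilinear_conv_bounded_bilinear[symmetric] bilinear_def by blast
qed

text \<open>Elements of a one-parameter subgroup commute, so conjugation by \<gamma>(t) fixes every
  \<gamma>(r). Differentiating in r at 0 shows that \<open>Ad G (\<gamma> t)\<close> fixes \<xi>,
  and a constant curve has derivative zero.\<close>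

lemma ad_self: "ad G \<xi> \<xi> = 0"
proof -
  obtain \<gamma> where \<gamma>: "one_param_subgroup G \<gamma>" "((\<lambda>t. echart (\<gamma> t)) has_vector_derivative \<xi>) (at 0)"
    "\<And>t. lie_exp G (t *\<^sub>R \<xi>) = \<gamma> t" by (rule lie_exp_curve) (rule that)
  have s: "smooth_map_on vec_atlas UNIV (atlas G) \<gamma>" using \<gamma>(1) by (simp add: one_param_subgroup_def)
  have 0: "\<gamma> 0 = \<one>" by (rule one_param_subgroup_zero[OF \<gamma>(1)])
  have "Ad G (\<gamma> t) \<xi> = \<xi>" for t
  proof -
    have "((\<lambda>s. echart (inv \<gamma> t \<otimes> eparam (echart (\<gamma> s)) \<otimes> \<gamma> t)) has_derivative (\<lambda>r. Ad G (\<gamma> t) (r *\<^sub>R \<xi>))) (at 0)"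
      using \<gamma>(2) 0 by (intro has_derivative_at_compose[of "\<lambda>t. echart (\<gamma> t)", OF _ _ Ad_has_derivative])
        (simp_all add: has_vector_derivative_def)
    moreover have "((\<lambda>s. echart (inv \<gamma> t \<otimes> eparam (echart (\<gamma> s)) \<otimes> \<gamma> t)) has_derivative (\<lambda>r. r *\<^sub>R \<xi>)) (at 0)"
    proof (rule has_derivative_transform_within_open[OF _ open_preimage_edom[OF s]])
      show "((\<lambda>t. echart (\<gamma> t)) has_derivative (\<lambda>r. r *\<^sub>R \<xi>)) (at 0)"
        using \<gamma>(2) by (simp only: has_vector_derivative_def)
      fix r
      have "\<gamma> (r + t) = \<gamma> r \<otimes> \<gamma> t" "\<gamma> (t + r) = \<gamma> t \<otimes> \<gamma> r"
        using \<gamma>(1) unfolding one_param_subgroup_def by blast+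
      then have "\<gamma> r \<otimes> \<gamma> t = \<gamma> t \<otimes> \<gamma> r" by (simp add: add.commute)
      then have "inv \<gamma> t \<otimes> \<gamma> r \<otimes> \<gamma> t = \<gamma> r" by (simp add: m_assoc)
      then show "r \<in> UNIV \<inter> \<gamma> -` edom \<Longrightarrow>
          echart (\<gamma> r) = echart (inv \<gamma> t \<otimes> eparam (echart (\<gamma> r)) \<otimes> \<gamma> t)" by simp
    qed (simp add: 0)
    ultimately have "(\<lambda>r. Ad G (\<gamma> t) (r *\<^sub>R \<xi>)) = (\<lambda>r. r *\<^sub>R \<xi>)" by (rule has_derivative_unique)
    from fun_cong[OF this, of 1] show ?thesis by simp
  qed
  then show ?thesis by (simp add: ad_def \<gamma>(3))
qed

text \<open>Polarisation of \<open>ad_self\<close> at \<xi> + \<eta>.\<close>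

lemma ad_antisym: "ad G \<xi> \<eta> = - ad G \<eta> \<xi>"
proof -
  interpret bounded_bilinear "ad G" by (rule bounded_bilinear_ad)
  have "ad G (\<xi> + \<eta>) (\<xi> + \<eta>) = ad G \<xi> \<xi> + ad G \<eta> \<xi> + (ad G \<xi> \<eta> + ad G \<eta> \<eta>)"
    by (simp only: add_left add_right)
  then have "0 = 0 + ad G \<eta> \<xi> + (ad G \<xi> \<eta> + 0)" by (simp only: ad_self)
  then have "ad G \<xi> \<eta> + ad G \<eta> \<xi> = 0" by (simp add: add.commute)
  then show ?thesis by (simp add: eq_neg_iff_add_eq_0)
qed

section \<open>The coadjoint action\<close>

lemma ad_dual_apply: "blinfun_apply (ad_dual G \<xi> \<mu>) \<eta> = blinfun_apply \<mu> (ad G \<xi> \<eta>)"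
  unfolding ad_dual_def
  by (subst bounded_linear_Blinfun_apply)
    (auto intro!: bounded_linear_compose[OF blinfun.bounded_linear_right]
      bounded_bilinear.bounded_linear_right[OF bounded_bilinear_ad])

lemma bounded_bilinear_ad_dual: "bounded_bilinear (ad_dual G)"
proof -
  interpret ad: bounded_bilinear "ad G" by (rule bounded_bilinear_ad)
  obtain K where K: "0 < K" "\<And>\<xi> \<eta>. norm (ad G \<xi> \<eta>) \<le> norm \<xi> * norm \<eta> * K" using ad.pos_bounded by blast
  show ?thesis
  proof
    show "\<exists>K. \<forall>\<xi> \<mu>. norm (ad_dual G \<xi> \<mu>) \<le> norm \<xi> * norm \<mu> * K"
    proof (intro exI allI norm_blinfun_bound)
      fix \<xi> \<mu> \<eta>
      have "norm (blinfun_apply (ad_dual G \<xi> \<mu>) \<eta>) \<le> norm \<mu> * norm (ad G \<xi> \<eta>)"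
        by (simp only: ad_dual_apply norm_blinfun)
      also have "\<dots> \<le> norm \<mu> * (norm \<xi> * norm \<eta> * K)" by (intro mult_left_mono K) auto
      finally show "norm (blinfun_apply (ad_dual G \<xi> \<mu>) \<eta>) \<le> norm \<xi> * norm \<mu> * K * norm \<eta>"
        by (simp add: algebra_simps)
    qed (use K in auto)
  qed (auto intro!: blinfun_eqI simp: ad_dual_apply ad.add_left ad.scaleR_left blinfun.add_left
      blinfun.add_right blinfun.scaleR_left blinfun.scaleR_right)
qed

lemmas smooth_on_ad = smooth_on_bounded_bilinear[OF bounded_bilinear_ad]
lemmas smooth_on_ad_dual = smooth_on_bounded_bilinear[OF bounded_bilinear_ad_dual]

section \<open>Right translations\<close>

lemma TR_has_derivative:
  assumes V: "chart_at (atlas G) g = (V, \<psi>)"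
  shows "((\<lambda>x. \<psi> (eparam x \<otimes> g)) has_derivative TR G g) (at epoint)"
proof -
  have VA: "(V, \<psi>) \<in> atlas G" "g \<in> V" using chart_at_mem[OF chart_cover_G, of g] V by auto
  have K: "smooth_map_on vec_atlas eimg (atlas G) (\<lambda>x. eparam x \<otimes> g)"
    by (intro smooth_mult_on smooth_map_on_const smooth_eparam open_eimg)
  have D: "((\<lambda>x. \<psi> (eparam x \<otimes> g)) has_derivative
      frechet_derivative (\<lambda>x. \<psi> (eparam x \<otimes> g)) (at epoint)) (at epoint)"
    by (rule smooth_on_has_derivative[OF smooth_map_on_vec_chart[OF K VA(1)]]) (simp add: VA)
  then have "TR G g = frechet_derivative (\<lambda>x. \<psi> (eparam x \<otimes> g)) (at epoint)"
    unfolding TR_def using V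
    by (intro tangent_map_eqI[of _ _ edom echart _ _ V \<psi>]) (simp_all add: chart_at_one eparam_def)
  then show ?thesis using D by simp
qed

lemma bounded_linear_TR: "bounded_linear (TR G g)"
  using TR_has_derivative[of g] by (cases "chart_at (atlas G) g") (auto intro: has_derivative_bounded_linear)

text \<open>Right translation by the inverse of g supplies a left inverse for the tangent map.
  Injectivity will recover \<eta> from the prescribed velocity of a variation.\<close>

lemma inj_TR: "inj (TR G g)"
proof -
  obtain V \<psi> where V: "chart_at (atlas G) g = (V, \<psi>)" by (cases "chart_at (atlas G) g")
  then have VA: "(V, \<psi>) \<in> atlas G" "g \<in> V" using chart_at_mem[OF chart_cover_G, of g] by auto
  note C = chart_coverD[OF chart_cover_G VA(1)]
  have K: "smooth_map_on vec_atlas (\<psi> ` V) (atlas G) (\<lambda>y. inv_into V \<psi> y \<otimes> inv g)"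
    by (intro smooth_mult_on smooth_map_on_const smooth_map_on_chart_inverse[OF atlas VA(1)] C)
  have g: "inv_into V \<psi> (\<psi> g) = g" by (rule inv_into_f_f[OF C(3) VA(2)])
  have D: "((\<lambda>y. echart (inv_into V \<psi> y \<otimes> inv g)) has_derivative
      frechet_derivative (\<lambda>y. echart (inv_into V \<psi> y \<otimes> inv g)) (at (\<psi> g))) (at (\<psi> g))"
    (is "(_ has_derivative ?D) _")
    by (rule smooth_on_has_derivative[OF smooth_on_echart[OF K]]) (simp add: VA g)
  have "((\<lambda>x. echart (inv_into V \<psi> (\<psi> (eparam x \<otimes> g)) \<otimes> inv g)) has_derivative (\<lambda>v. ?D (TR G g v))) (at epoint)"
    by (rule has_derivative_at_compose[OF TR_has_derivative[OF V] _ D]) simp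
  moreover have "((\<lambda>x. echart (inv_into V \<psi> (\<psi> (eparam x \<otimes> g)) \<otimes> inv g)) has_derivative (\<lambda>v. v)) (at epoint)"
  proof (rule has_derivative_transform_within_open[OF has_derivative_ident])
    have "smooth_map_on vec_atlas eimg (atlas G) (\<lambda>x. eparam x \<otimes> g)"
      by (intro smooth_mult_on smooth_map_on_const smooth_eparam open_eimg)
    then show "open (eimg \<inter> (\<lambda>x. eparam x \<otimes> g) -` V)" by (rule open_chart_preimage[OF _ VA(1)])
  qed (auto simp: VA inv_into_f_f[OF C(3)] m_assoc)
  ultimately have "(\<lambda>v. ?D (TR G g v)) = (\<lambda>v. v)" by (rule has_derivative_unique)
  then show ?thesis by (metis injI)
qed

text \<open>The curve is right translation by c(t) applied to c(s) c(t)^(-1), which passes through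
  the identity at s = t; the chain rule then produces \<open>TR\<close>.\<close>

lemma velocity_right_translation:
  assumes c: "smooth_map_on vec_atlas W (atlas G) c" "t \<in> W"
    and x: "((\<lambda>s. echart (c s \<otimes> inv c t)) has_vector_derivative w) (at t)"
  shows "velocity (atlas G) c t = TR G (c t) w"
proof -
  obtain V \<psi> where V: "chart_at (atlas G) (c t) = (V, \<psi>)" by (cases "chart_at (atlas G) (c t)")
  let ?k = "\<lambda>s. c s \<otimes> inv c t"
  have k: "smooth_map_on vec_atlas W (atlas G) ?k"
    by (intro smooth_mult_on smooth_map_on_const c(1) smooth_map_on_vec_open[OF c(1)])
  have "((\<lambda>s. \<psi> (eparam (echart (?k s)) \<otimes> c t)) has_derivative (\<lambda>r. TR G (c t) (r *\<^sub>R w))) (at t)"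
    using x by (intro has_derivative_at_compose[of "\<lambda>s. echart (?k s)", OF _ _ TR_has_derivative[OF V]])
      (simp_all add: has_vector_derivative_def)
  then have "((\<lambda>s. \<psi> (c s)) has_derivative (\<lambda>r. TR G (c t) (r *\<^sub>R w))) (at t)"
    by (rule has_derivative_transform_within_open[OF _ open_preimage_edom[OF k]]) (use c(2) in \<open>auto simp: m_assoc\<close>)
  then have "((\<lambda>s. \<psi> (c s)) has_vector_derivative TR G (c t) w) (at t)"
    by (simp add: has_vector_derivative_def linear_simps(5)[OF bounded_linear_TR])
  then show ?thesis by (rule velocity_eqI[of _ c t, OF V])
qed

text \<open>Smoothness provides some derivative w of the translated curve. Its image under
  \<open>TR\<close> is the velocity, so w is \<eta> by injectivity.\<close>

lemma right_translated_derivative: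
  assumes c: "smooth_map_on vec_atlas W (atlas G) c" "t \<in> W"
    and v: "velocity (atlas G) c t = TR G (c t) \<eta>"
  shows "((\<lambda>s. echart (c s \<otimes> inv c t)) has_vector_derivative \<eta>) (at t)"
proof -
  have k: "smooth_map_on vec_atlas W (atlas G) (\<lambda>s. c s \<otimes> inv c t)"
    by (intro smooth_mult_on smooth_map_on_const c(1) smooth_map_on_vec_open[OF c(1)])
  from smooth_on_has_derivative[OF smooth_on_echart[OF k], of t] c(2)
  obtain w where w: "((\<lambda>s. echart (c s \<otimes> inv c t)) has_vector_derivative w) (at t)"
    using has_derivative_imp_has_vector_derivative by auto
  then have "TR G (c t) w = TR G (c t) \<eta>" using velocity_right_translation[OF c w] v by simp
  then have "w = \<eta>" using inj_TR by (simp add: inj_eq)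
  then show ?thesis using w by simp
qed

lemma TR_dual_apply: "blinfun_apply (TR_dual G g \<alpha>) \<eta> = blinfun_apply \<alpha> (TR G g \<eta>)"
  unfolding TR_dual_def
  by (subst bounded_linear_Blinfun_apply)
    (auto intro!: bounded_linear_compose[OF blinfun.bounded_linear_right] bounded_linear_TR)

lemma smooth_lagrangian_compose:
  assumes "smooth_lagrangian G E" "smooth_map_on vec_atlas W (atlas G) c"
    and "smooth_on W m" "smooth_on W x" "smooth_on W n"
  shows "smooth_on W (\<lambda>w. E (c w) (m w) (x w) (n w))"
proof -
  have W: "open W" by (rule smooth_map_on_vec_open[OF assms(2)])
  have "smooth_map_on vec_atlas W vec_atlas (\<lambda>w. (m w, x w, n w))"
    using W assms by (simp add: smooth_map_on_vec_vec smooth_on_Pair)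
  from smooth_map_on_Pair[OF assms(2) this chart_cover_G chart_cover_vec]
  have "smooth_map_on vec_atlas W vec_atlas (\<lambda>w. (\<lambda>(g, \<mu>, \<xi>, \<nu>). E g \<mu> \<xi> \<nu>) (c w, m w, x w, n w))"
    by (rule smooth_map_on_compose[OF _ assms(1)[unfolded smooth_lagrangian_def]
      chart_cover_prod[OF chart_cover_G chart_cover_vec] chart_cover_vec])
  then show ?thesis by (simp add: smooth_map_on_vec_vec)
qed

end

section \<open>The first variation of the action\<close>

text \<open>In finite dimension the bidual is the space itself: the representing vector has as
  coordinates the values of F on the dual basis. Testing with inner products shows that it is
  unique, so the definite description is meaningful.\<close>

lemma of_bidual_eq:
  fixes F :: "'v::euclidean_space dual \<Rightarrow> real"
  assumes "linear F" shows "blinfun_apply \<alpha> (of_bidual F) = F \<alpha>"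
proof -
  have "\<exists>!x. \<forall>\<alpha>. F \<alpha> = blinfun_apply \<alpha> x"
  proof (rule ex1I)
    let ?x = "\<Sum>b\<in>Basis. F (blinfun_inner_right b) *\<^sub>R b"
    show "\<forall>\<alpha>. F \<alpha> = blinfun_apply \<alpha> ?x"
    proof
      fix \<alpha> :: "'v dual"
      have "\<alpha> = (\<Sum>b\<in>Basis. blinfun_apply \<alpha> b *\<^sub>R blinfun_inner_right b)"
      proof (rule blinfun_eqI)
        fix x
        have "blinfun_apply \<alpha> (\<Sum>b\<in>Basis. (x \<bullet> b) *\<^sub>R b) = (\<Sum>b\<in>Basis. (x \<bullet> b) * blinfun_apply \<alpha> b)"
          by (simp only: blinfun.sum_right blinfun.scaleR_right real_scaleR_def)
        then have "blinfun_apply \<alpha> x = (\<Sum>b\<in>Basis. (x \<bullet> b) * blinfun_apply \<alpha> b)"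
          by (simp only: euclidean_representation)
        then show "blinfun_apply \<alpha> x = blinfun_apply (\<Sum>b\<in>Basis. blinfun_apply \<alpha> b *\<^sub>R blinfun_inner_right b) x"
          by (simp add: blinfun.sum_left blinfun.scaleR_left inner_commute mult.commute)
      qed
      then have "F \<alpha> = F (\<Sum>b\<in>Basis. blinfun_apply \<alpha> b *\<^sub>R blinfun_inner_right b)" by simp
      also have "\<dots> = blinfun_apply \<alpha> ?x"
        by (simp add: linear_sum[OF assms] linear_scale[OF assms] blinfun.sum_right blinfun.scaleR_right mult.commute)
      finally show "F \<alpha> = blinfun_apply \<alpha> ?x" .
    qed
    fix y assume y: "\<forall>\<alpha>. F \<alpha> = blinfun_apply \<alpha> y"
    have "y \<bullet> b = ?x \<bullet> b" if "b \<in> Basis" for b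
    proof -
      have "F (blinfun_inner_right b) = b \<bullet> y" using y by simp
      then show ?thesis using that by (simp add: inner_commute[of y])
    qed
    then show "y = ?x" by (rule euclidean_eqI)
  qed
  then have "\<forall>\<alpha>. F \<alpha> = blinfun_apply \<alpha> (of_bidual F)"
    unfolding of_bidual_def by (rule theI')
  then show ?thesis by simp
qed

text \<open>T is a common neighbourhood of the interval on which all four curves are smooth;
  derivatives along them are thus two-sided also at a and b.\<close>

locale lagrangian_curve = lie_group G
  for G :: "('g::{t2_space, second_countable_topology}, 'v::euclidean_space, 'z) lie_struct_scheme" (structure) +
  fixes E :: "('g, 'v) lagrangian" and a b :: real and T :: "real set"
    and g :: "real \<Rightarrow> 'g" and \<mu> :: "real \<Rightarrow> 'v dual" and \<xi> :: "real \<Rightarrow> 'v" and \<nu> :: "real \<Rightarrow> 'v dual"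
  assumes E: "smooth_lagrangian G E" and ab: "a < b" and T: "{a..b} \<subseteq> T"
    and g: "smooth_map_on vec_atlas T (atlas G) g"
    and smooth_\<mu>: "smooth_on T \<mu>" and smooth_\<xi>: "smooth_on T \<xi>" and smooth_\<nu>: "smooth_on T \<nu>"
begin

lemma open_T [simp]: "open T" by (rule smooth_map_on_vec_open[OF g])

text \<open>Right translating by the curve moves all the derivatives of the Lagrangian along it to the
  chart at the identity.\<close>

definition Ef :: "'v \<times> 'v dual \<times> 'v \<times> 'v dual \<times> real \<Rightarrow> real" where
  "Ef = (\<lambda>(x, m, y, n, t). E (eparam x \<otimes> g t) m y n)"

definition dE :: "real \<Rightarrow> 'v \<times> 'v dual \<times> 'v \<times> 'v dual \<times> real \<Rightarrow> real" where
  "dE t = frechet_derivative Ef (at (epoint, \<mu> t, \<xi> t, \<nu> t, t))"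

lemma open_Ef_dom: "open (eimg \<times> UNIV \<times> UNIV \<times> UNIV \<times> T)"
  by (simp add: open_Times)

lemma smooth_on_Ef: "smooth_on (eimg \<times> UNIV \<times> UNIV \<times> UNIV \<times> T) Ef"
proof -
  have "smooth_map_on vec_atlas (eimg \<times> (UNIV :: 'v dual set) \<times> (UNIV :: 'v set) \<times> (UNIV :: 'v dual set) \<times> T) (atlas G)
      (\<lambda>z. eparam (fst z) \<otimes> g (snd (snd (snd (snd z)))))"
    by (intro smooth_mult_on smooth_eparam_on smooth_map_on_precompose[OF g chart_cover_G] open_Ef_dom smooth_intros)
      auto
  then show ?thesis
    unfolding Ef_def split_def
    by (intro smooth_lagrangian_compose[OF E] smooth_intros open_Ef_dom)
qed

lemma dE_has_derivative: "t \<in> T \<Longrightarrow> (Ef has_derivative dE t) (at (epoint, \<mu> t, \<xi> t, \<nu> t, t))"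
  unfolding dE_def by (rule smooth_on_has_derivative[OF smooth_on_Ef]) simp

text \<open>As t is one of the variables of \<open>Ef\<close>, this is the derivative of a single
  smooth function at a smoothly moving point, in a fixed direction.\<close>

lemma smooth_on_dE: "smooth_on T (\<lambda>t. dE t v)"
  unfolding dE_def
  by (rule smooth_on_frechet_derivative[OF smooth_on_Ef open_Ef_dom])
    (auto intro!: smooth_intros smooth_\<mu> smooth_\<xi> smooth_\<nu>)

lemma linear_dE: "t \<in> T \<Longrightarrow> linear (dE t)"
  by (rule has_derivative_linear[OF dE_has_derivative])

lemma dE_split:
  assumes "t \<in> T"
  shows "dE t (x, m, y, n, 0) = dE t (x, 0, 0, 0, 0) + dE t (0, m, 0, 0, 0) + dE t (0, 0, y, 0, 0) + dE t (0, 0, 0, n, 0)"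
  by (simp add: linear_add[OF linear_dE[OF assms], symmetric])

abbreviation "Dg t \<equiv> TR_dual G (g t) (d_g G E (g t) (\<mu> t) (\<xi> t) (\<nu> t))"
abbreviation "D\<mu> t \<equiv> d_mu E (g t) (\<mu> t) (\<xi> t) (\<nu> t)"
abbreviation "D\<xi> t \<equiv> d_xi E (g t) (\<mu> t) (\<xi> t) (\<nu> t)"
abbreviation "D\<nu> t \<equiv> d_nu E (g t) (\<mu> t) (\<xi> t) (\<nu> t)"

section \<open>The partial derivatives of E as components of \<open>dE\<close>\<close>

lemma D\<xi>_apply:
  assumes "t \<in> T" shows "blinfun_apply (D\<xi> t) v = dE t (0, 0, v, 0, 0)"
proof -
  have "((\<lambda>y. Ef (epoint, \<mu> t, y, \<nu> t, t)) has_derivative (\<lambda>v. dE t (0, 0, v, 0, 0))) (at (\<xi> t))"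
    by (rule has_derivative_at_compose[of "\<lambda>y. (epoint, \<mu> t, y, \<nu> t, t)" "\<lambda>v. (0, 0, v, 0, 0)",
          OF _ refl dE_has_derivative[OF assms]]) (auto intro!: derivative_eq_intros simp: zero_prod_def)
  then have D: "((\<lambda>y. E (g t) (\<mu> t) y (\<nu> t)) has_derivative (\<lambda>v. dE t (0, 0, v, 0, 0))) (at (\<xi> t))"
    by (simp add: Ef_def)
  show ?thesis
    unfolding d_xi_def frechet_derivative_at[OF D, symmetric]
    using has_derivative_bounded_linear[OF D] by (simp add: bounded_linear_Blinfun_apply)
qed

lemma D\<mu>_apply:
  assumes "t \<in> T" shows "blinfun_apply \<alpha> (D\<mu> t) = dE t (0, \<alpha>, 0, 0, 0)"
proof -
  have "((\<lambda>y. Ef (epoint, y, \<xi> t, \<nu> t, t)) has_derivative (\<lambda>v. dE t (0, v, 0, 0, 0))) (at (\<mu> t))"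
    by (rule has_derivative_at_compose[of "\<lambda>y. (epoint, y, \<xi> t, \<nu> t, t)" "\<lambda>v. (0, v, 0, 0, 0)",
          OF _ refl dE_has_derivative[OF assms]]) (auto intro!: derivative_eq_intros simp: zero_prod_def)
  then have D: "((\<lambda>y. E (g t) y (\<xi> t) (\<nu> t)) has_derivative (\<lambda>v. dE t (0, v, 0, 0, 0))) (at (\<mu> t))"
    by (simp add: Ef_def)
  show ?thesis
    unfolding d_mu_def frechet_derivative_at[OF D, symmetric]
    by (rule of_bidual_eq[OF has_derivative_linear[OF D]])
qed

lemma D\<nu>_apply:
  assumes "t \<in> T" shows "blinfun_apply \<alpha> (D\<nu> t) = dE t (0, 0, 0, \<alpha>, 0)"
proof -
  have "((\<lambda>y. Ef (epoint, \<mu> t, \<xi> t, y, t)) has_derivative (\<lambda>v. dE t (0, 0, 0, v, 0))) (at (\<nu> t))"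
    by (rule has_derivative_at_compose[of "\<lambda>y. (epoint, \<mu> t, \<xi> t, y, t)" "\<lambda>v. (0, 0, 0, v, 0)",
          OF _ refl dE_has_derivative[OF assms]]) (auto intro!: derivative_eq_intros simp: zero_prod_def)
  then have D: "((\<lambda>y. E (g t) (\<mu> t) (\<xi> t) y) has_derivative (\<lambda>v. dE t (0, 0, 0, v, 0))) (at (\<nu> t))"
    by (simp add: Ef_def)
  show ?thesis
    unfolding d_nu_def frechet_derivative_at[OF D, symmetric]
    by (rule of_bidual_eq[OF has_derivative_linear[OF D]])
qed

text \<open>E at \<open>eparam x \<otimes> g t\<close>, with the other variables frozen, is
  differentiated at the identity in two ways: through the chart at \<open>g t\<close>, which gives
  dE/dg after \<open>TR\<close>, and through \<open>Ef\<close>, which gives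
  \<open>dE\<close>.\<close>

lemma Dg_apply:
  assumes t: "t \<in> T" shows "blinfun_apply (Dg t) v = dE t (v, 0, 0, 0, 0)"
proof -
  let ?E = "\<lambda>h. E h (\<mu> t) (\<xi> t) (\<nu> t)"
  obtain V \<psi> where V: "chart_at (atlas G) (g t) = (V, \<psi>)" by (cases "chart_at (atlas G) (g t)")
  then have VA: "(V, \<psi>) \<in> atlas G" "g t \<in> V" using chart_at_mem[OF chart_cover_G, of "g t"] by auto
  note C = chart_coverD[OF chart_cover_G VA(1)]
  have inv: "inv_into V \<psi> (\<psi> h) = h" if "h \<in> V" for h by (rule inv_into_f_f[OF C(3) that])
  have "smooth_on (\<psi> ` V) (\<lambda>y. ?E (inv_into V \<psi> y))"
    by (intro smooth_lagrangian_compose[OF E] smooth_map_on_chart_inverse[OF atlas VA(1)] smooth_on_const C)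
  then have D: "((\<lambda>y. ?E (inv_into V \<psi> y)) has_derivative
      frechet_derivative (\<lambda>y. ?E (inv_into V \<psi> y)) (at (\<psi> (g t)))) (at (\<psi> (g t)))"
    (is "(_ has_derivative ?D) _")
    by (rule smooth_on_has_derivative) (use VA(2) in auto)
  have "tangent_map (atlas G) vec_atlas ?E (g t) = ?D"
    using V D by (intro tangent_map_eqI[of _ _ V \<psi> _ _ UNIV id]) auto
  then have dg: "d_g G E (g t) (\<mu> t) (\<xi> t) (\<nu> t) = Blinfun ?D" by (simp add: d_g_def)
  have "((\<lambda>x. ?E (inv_into V \<psi> (\<psi> (eparam x \<otimes> g t)))) has_derivative (\<lambda>v. ?D (TR G (g t) v))) (at epoint)"
    by (rule has_derivative_at_compose[OF TR_has_derivative[OF V] _ D]) simp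
  moreover have "((\<lambda>x. ?E (inv_into V \<psi> (\<psi> (eparam x \<otimes> g t)))) has_derivative (\<lambda>v. dE t (v, 0, 0, 0, 0))) (at epoint)"
  proof (rule has_derivative_transform_within_open)
    show "((\<lambda>x. Ef (x, \<mu> t, \<xi> t, \<nu> t, t)) has_derivative (\<lambda>v. dE t (v, 0, 0, 0, 0))) (at epoint)"
      by (rule has_derivative_at_compose[of "\<lambda>y. (y, \<mu> t, \<xi> t, \<nu> t, t)" "\<lambda>v. (v, 0, 0, 0, 0)",
          OF _ refl dE_has_derivative[OF t]]) (auto intro!: derivative_eq_intros simp: zero_prod_def)
    have "smooth_map_on vec_atlas eimg (atlas G) (\<lambda>x. eparam x \<otimes> g t)"
      by (intro smooth_mult_on smooth_map_on_const smooth_eparam open_eimg)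
    then show "open (eimg \<inter> (\<lambda>x. eparam x \<otimes> g t) -` V)" by (rule open_chart_preimage[OF _ VA(1)])
  qed (auto simp: VA inv Ef_def)
  ultimately have "(\<lambda>v. ?D (TR G (g t) v)) = (\<lambda>v. dE t (v, 0, 0, 0, 0))" by (rule has_derivative_unique)
  then show ?thesis
    using has_derivative_bounded_linear[OF D]
    by (simp add: TR_dual_apply dg bounded_linear_Blinfun_apply fun_eq_iff)
qed

lemma smooth_on_partials:
  shows "smooth_on T Dg" "smooth_on T D\<mu>" "smooth_on T D\<xi>" "smooth_on T D\<nu>"
proof -
  have c: "smooth_on T (\<lambda>t. F t)" if "\<And>t. t \<in> T \<Longrightarrow> F t = dE t v" for F v
    by (rule smooth_on_cong[OF smooth_on_dE[of v] open_T]) (simp add: that)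
  show "smooth_on T Dg" by (rule smooth_on_dual_componentwise[OF open_T], rule c[OF Dg_apply])
  show "smooth_on T D\<xi>" by (rule smooth_on_dual_componentwise[OF open_T], rule c[OF D\<xi>_apply])
  show "smooth_on T D\<mu>" by (rule smooth_on_vector_componentwise[OF open_T], rule c[OF D\<mu>_apply])
  show "smooth_on T D\<nu>" by (rule smooth_on_vector_componentwise[OF open_T], rule c[OF D\<nu>_apply])
qed

definition rhs\<xi> :: "real \<Rightarrow> 'v dual" where
  "rhs\<xi> t = Dg t - ad_dual G (D\<mu> t) (\<mu> t) + ad_dual G (\<xi> t) (D\<xi> t) - ad_dual G (D\<nu> t) (\<nu> t)"

definition rhs\<nu> :: "real \<Rightarrow> 'v" where
  "rhs\<nu> t = D\<mu> t - ad G (\<xi> t) (D\<nu> t)"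

text \<open>The two-sided derivative makes the defect smooth on all of T; on the interval it agrees
  with the derivative within the interval.\<close>

definition defect\<xi> :: "real \<Rightarrow> 'v dual" where
  "defect\<xi> t = rhs\<xi> t - frechet_derivative D\<xi> (at t) 1"

definition defect\<nu> :: "real \<Rightarrow> 'v" where
  "defect\<nu> t = rhs\<nu> t - frechet_derivative D\<nu> (at t) 1"

lemma smooth_on_defects: "smooth_on T defect\<xi>" "smooth_on T defect\<nu>"
  unfolding defect\<xi>_def defect\<nu>_def rhs\<xi>_def rhs\<nu>_def
  by (intro smooth_intros smooth_on_directional smooth_on_ad smooth_on_ad_dual smooth_on_partials
    smooth_\<mu> smooth_\<xi> smooth_\<nu> open_T)+

text \<open>Each term is paired so that \<eta> or \<kappa> stands alone. The pairings of dE/d\<mu>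
  and dE/d\<nu> with \<open>ad_dual G \<eta> (\<mu> t)\<close> and
  \<open>ad_dual G \<eta> (\<nu> t)\<close> have \<eta> in the first slot of the bracket. Moving it
  to the second costs a sign by antisymmetry, whence the two negative coadjoint terms; the terms
  with \<xi> need no exchange.\<close>

lemma dE_variation:
  assumes t: "t \<in> T"
  shows "dE t (\<eta>, \<kappa> + ad_dual G \<eta> (\<mu> t), \<eta>' + ad G (\<xi> t) \<eta>, \<kappa>' + ad_dual G \<eta> (\<nu> t) - ad_dual G (\<xi> t) \<kappa>, 0) =
    blinfun_apply (rhs\<xi> t) \<eta> + blinfun_apply (D\<xi> t) \<eta>' + blinfun_apply \<kappa> (rhs\<nu> t) + blinfun_apply \<kappa>' (D\<nu> t)"
  by (subst dE_split[OF t], unfold Dg_apply[OF t, symmetric] D\<mu>_apply[OF t, symmetric]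
    D\<xi>_apply[OF t, symmetric] D\<nu>_apply[OF t, symmetric] rhs\<xi>_def rhs\<nu>_def)
    (simp add: blinfun.add_left blinfun.diff_left blinfun.add_right blinfun.diff_right ad_dual_apply
    ad_antisym[of \<eta>] blinfun.minus_right)

text \<open>Near s = 0 the integrand is \<open>Ef\<close> along the curve w, whose group coordinate
  is that of c(s) g(t)^(-1). By the velocity condition this coordinate has derivative
  \<eta>.\<close>

lemma variation_has_derivative:
  assumes c: "smooth_map_on vec_atlas W (atlas G) c" and W: "0 \<in> W"
    and m: "smooth_on W m" and x: "smooth_on W x" and n: "smooth_on W n"
    and t: "t \<in> T" and init: "c 0 = g t" "m 0 = \<mu> t" "x 0 = \<xi> t" "n 0 = \<nu> t"
    and vel: "velocity (atlas G) c 0 = TR G (g t) \<eta>" "vector_derivative m (at 0) = m'"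
      "vector_derivative x (at 0) = x'" "vector_derivative n (at 0) = n'"
  shows "((\<lambda>s. E (c s) (m s) (x s) (n s)) has_vector_derivative dE t (\<eta>, m', x', n', 0)) (at 0)"
proof -
  have vd: "(f has_derivative (\<lambda>r. r *\<^sub>R f')) (at 0)"
    if "smooth_on W f" "vector_derivative f (at 0) = f'" for f :: "real \<Rightarrow> 'x::real_normed_vector" and f'
    using smooth_on_real_has_vector_derivative[OF that(1) W] that(2)
    by (metis has_vector_derivative_def vector_derivative_at)
  have k: "smooth_map_on vec_atlas W (atlas G) (\<lambda>s. c s \<otimes> inv g t)"
    by (intro smooth_mult_on smooth_map_on_const c smooth_map_on_vec_open[OF c])
  define w where "w s = (echart (c s \<otimes> inv g t), m s, x s, n s, t)" for s
  have e: "((\<lambda>s. echart (c s \<otimes> inv g t)) has_derivative (\<lambda>r. r *\<^sub>R \<eta>)) (at 0)"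
    using right_translated_derivative[OF c W, of \<eta>] init vel by (simp add: has_vector_derivative_def)
  have "(w has_derivative (\<lambda>r. (r *\<^sub>R \<eta>, r *\<^sub>R m', r *\<^sub>R x', r *\<^sub>R n', 0))) (at 0)"
    unfolding w_def
    by (intro has_derivative_Pair e vd[OF m vel(2)] vd[OF x vel(3)] vd[OF n vel(4)] has_derivative_const)
  moreover have "w 0 = (epoint, \<mu> t, \<xi> t, \<nu> t, t)" by (simp add: w_def init)
  ultimately have "((\<lambda>s. Ef (w s)) has_derivative (\<lambda>r. dE t (r *\<^sub>R \<eta>, r *\<^sub>R m', r *\<^sub>R x', r *\<^sub>R n', 0))) (at 0)"
    by (rule has_derivative_at_compose[OF _ _ dE_has_derivative[OF t]])
  then have "((\<lambda>s. E (c s) (m s) (x s) (n s)) has_derivative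
      (\<lambda>r. dE t (r *\<^sub>R \<eta>, r *\<^sub>R m', r *\<^sub>R x', r *\<^sub>R n', 0))) (at 0)"
    by (rule has_derivative_transform_within_open[OF _ open_preimage_edom[OF k]])
      (auto simp: W init w_def Ef_def m_assoc)
  from has_derivative_imp_has_vector_derivative[OF this] show ?thesis by simp
qed

text \<open>Integration by parts: the difference of the two integrands is the derivative of the
  boundary function \<open>?P\<close>, and this vanishes at a and b with \<eta> and
  \<kappa>.\<close>

lemma boundary_terms_vanish:
  assumes \<eta>: "smooth_on S \<eta>" "{a..b} \<subseteq> S" "\<eta> a = 0" "\<eta> b = 0"
    and \<kappa>: "smooth_on S \<kappa>" "\<kappa> a = 0" "\<kappa> b = 0"
  shows "integral {a..b} (\<lambda>t. blinfun_apply (rhs\<xi> t) (\<eta> t)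
      + blinfun_apply (D\<xi> t) (vector_derivative \<eta> (at t within {a..b}))
      + blinfun_apply (\<kappa> t) (rhs\<nu> t)
      + blinfun_apply (vector_derivative \<kappa> (at t within {a..b})) (D\<nu> t)) =
    integral {a..b} (\<lambda>t. blinfun_apply (defect\<xi> t) (\<eta> t) + blinfun_apply (\<kappa> t) (defect\<nu> t))"
    (is "integral _ ?V = integral _ ?R")
proof -
  let ?P = "\<lambda>t. blinfun_apply (D\<xi> t) (\<eta> t) + blinfun_apply (\<kappa> t) (D\<nu> t)"
  have "(?P has_vector_derivative ?V t - ?R t) (at t within {a..b})" if t: "t \<in> {a..b}" for t
  proof -
    note D = smooth_on_vector_derivative_within[OF _ _ ab t]
    have "(?P has_vector_derivative
        (blinfun_apply (D\<xi> t) (vector_derivative \<eta> (at t within {a..b}))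
          + blinfun_apply (vector_derivative D\<xi> (at t within {a..b})) (\<eta> t))
        + (blinfun_apply (\<kappa> t) (vector_derivative D\<nu> (at t within {a..b}))
          + blinfun_apply (vector_derivative \<kappa> (at t within {a..b})) (D\<nu> t))) (at t within {a..b})"
      by (intro has_vector_derivative_add
        bounded_bilinear.has_vector_derivative[OF bounded_bilinear_blinfun_apply]
        D(1)[OF \<eta>(1,2)] D(1)[OF \<kappa>(1) \<eta>(2)] D(1)[OF smooth_on_partials(3) T] D(1)[OF smooth_on_partials(4) T])
    then show ?thesis
      unfolding D(2)[OF smooth_on_partials(3) T] D(2)[OF smooth_on_partials(4) T]
      by (simp add: defect\<xi>_def defect\<nu>_def blinfun.diff_left blinfun.diff_right algebra_simps)
  qed
  then have "((\<lambda>t. ?V t - ?R t) has_integral ?P b - ?P a) {a..b}"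
    using ab by (intro fundamental_theorem_of_calculus) auto
  then have V: "((\<lambda>t. ?V t - ?R t) has_integral 0) {a..b}" using \<eta> \<kappa> by simp
  have "continuous_on {a..b} ?R"
    using T by (intro continuous_on_add bounded_bilinear.continuous_on[OF bounded_bilinear_blinfun_apply]
      continuous_on_subset[OF smooth_on_continuous_on[OF smooth_on_defects(1)]]
      continuous_on_subset[OF smooth_on_continuous_on[OF smooth_on_defects(2)]]
      continuous_on_subset[OF smooth_on_continuous_on[OF \<eta>(1)] \<eta>(2)]
      continuous_on_subset[OF smooth_on_continuous_on[OF \<kappa>(1)] \<eta>(2)])
  then have R: "(?R has_integral integral {a..b} ?R) {a..b}"
    by (intro integrable_integral integrable_continuous_real)
  \<comment> \<open>Integrability of \<open>?V\<close> is obtained along with its value, by adding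
    the continuous function \<open>?R\<close> to a function with integral zero.\<close>
  have "(?V has_integral 0 + integral {a..b} ?R) {a..b}"
    using has_integral_add[OF V R] by simp
  then show ?thesis by (simp add: integral_unique)
qed

lemma action_variation:
  assumes var: "smooth_variation G a b g \<mu> \<xi> \<nu> gs \<mu>s \<xi>s \<nu>s"
    and gen: "generated_by G a b g \<mu> \<xi> \<nu> gs \<mu>s \<xi>s \<nu>s \<eta> \<kappa>"
    and \<eta>: "smooth_curve vec_atlas a b \<eta>" "\<eta> a = 0" "\<eta> b = 0"
    and \<kappa>: "smooth_curve vec_atlas a b \<kappa>" "\<kappa> a = 0" "\<kappa> b = 0"
  shows "((\<lambda>s. action E a b (gs s) (\<mu>s s) (\<xi>s s) (\<nu>s s)) has_real_derivative
    integral {a..b} (\<lambda>t. blinfun_apply (defect\<xi> t) (\<eta> t) + blinfun_apply (\<kappa> t) (defect\<nu> t))) (at 0)"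
proof -
  obtain \<epsilon> S where \<epsilon>: "0 < \<epsilon>" and S: "{a..b} \<subseteq> S" "open S" and
    f: "smooth_map_on vec_atlas ({-\<epsilon><..<\<epsilon>} \<times> S) (prod_atlas (atlas G) vec_atlas)
          (\<lambda>(s, t). (gs s t, \<mu>s s t, \<xi>s s t, \<nu>s s t))"
    and init: "\<And>t. t \<in> {a..b} \<Longrightarrow> gs 0 t = g t \<and> \<mu>s 0 t = \<mu> t \<and> \<xi>s 0 t = \<xi> t \<and> \<nu>s 0 t = \<nu> t"
    using var unfolding smooth_variation_def by blast
  let ?I = "{-\<epsilon><..<\<epsilon>}"
  let ?W = "?I \<times> S"
  have W: "open ?W" using S(2) by (simp add: open_Times)
  have gs: "smooth_map_on vec_atlas ?W (atlas G) (\<lambda>z. gs (fst z) (snd z))"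
    using smooth_map_on_fst_snd(1)[OF f chart_cover_G chart_cover_vec] by (simp add: split_def)
  have rest: "smooth_on ?W (\<lambda>z. (\<mu>s (fst z) (snd z), \<xi>s (fst z) (snd z), \<nu>s (fst z) (snd z)))"
    using smooth_map_on_fst_snd(2)[OF f chart_cover_G chart_cover_vec]
    by (simp add: split_def smooth_map_on_vec_vec)
  have \<mu>s: "smooth_on ?W (\<lambda>z. \<mu>s (fst z) (snd z))" and \<xi>s: "smooth_on ?W (\<lambda>z. \<xi>s (fst z) (snd z))"
    and \<nu>s: "smooth_on ?W (\<lambda>z. \<nu>s (fst z) (snd z))"
    using smooth_on_fst[OF W rest] smooth_on_fst[OF W smooth_on_snd[OF W rest]]
      smooth_on_snd[OF W smooth_on_snd[OF W rest]] by simp_all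
  define e where "e z = E (gs (fst z) (snd z)) (\<mu>s (fst z) (snd z)) (\<xi>s (fst z) (snd z)) (\<nu>s (fst z) (snd z))" for z
  have e: "smooth_on ?W e"
    unfolding e_def by (rule smooth_lagrangian_compose[OF E gs \<mu>s \<xi>s \<nu>s])
  define e' where "e' s t = frechet_derivative e (at (s, t)) (1, 0)" for s t
  have e': "((\<lambda>s. e (s, t)) has_vector_derivative e' s t) (at s)" if "s \<in> ?I" "t \<in> S" for s t
  proof -
    have D: "(e has_derivative frechet_derivative e (at (s, t))) (at (s, t))"
      using that by (intro smooth_on_has_derivative[OF e]) auto
    have "((\<lambda>s. e (s, t)) has_derivative (\<lambda>r. frechet_derivative e (at (s, t)) (r, 0))) (at s)"
      by (rule has_derivative_at_compose[of "\<lambda>s. (s, t)" "\<lambda>r. (r, 0)", OF _ refl D])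
        (auto intro!: derivative_eq_intros)
    from has_derivative_imp_has_vector_derivative[OF this] show ?thesis by (simp add: e'_def)
  qed
  \<comment> \<open>Differentiation under the integral sign; joint smoothness of the family in (s,
    t) supplies the continuity of the integrand's s-derivative.\<close>
  have "((\<lambda>s. integral (cbox a b) (\<lambda>t. e (s, t))) has_vector_derivative integral (cbox a b) (e' 0)) (at 0 within ?I)"
  proof (rule leibniz_rule_vector_derivative)
    show "((\<lambda>s. e (s, t)) has_vector_derivative e' s t) (at s within ?I)" if "s \<in> ?I" "t \<in> cbox a b" for s t
      using that S(1) by (intro has_vector_derivative_at_within[OF e']) auto
    show "(\<lambda>t. e (s, t)) integrable_on cbox a b" if "s \<in> ?I" for s
    proof -
      have "continuous_on {a..b} (\<lambda>t. e (s, t))"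
        using that S(1)
        by (intro continuous_on_compose2[OF smooth_on_continuous_on[OF e]] continuous_intros) auto
      then show ?thesis by (simp add: integrable_continuous_real)
    qed
    have "continuous_on ?W (\<lambda>z. frechet_derivative e (at z) (1, 0))"
      by (intro smooth_on_continuous_on smooth_on_directional e)
    then have "continuous_on (?I \<times> cbox a b) (\<lambda>z. frechet_derivative e (at z) (1, 0))"
      by (rule continuous_on_subset) (use S(1) in auto)
    then show "continuous_on (?I \<times> cbox a b) (\<lambda>(s, t). e' s t)" by (simp add: e'_def split_def)
  qed (use \<epsilon> in auto)
  then have D: "((\<lambda>s. action E a b (gs s) (\<mu>s s) (\<xi>s s) (\<nu>s s)) has_real_derivative integral {a..b} (e' 0)) (at 0)"
    using \<epsilon> at_within_open[of 0 ?I]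
    by (simp add: action_def e_def has_real_derivative_iff_has_vector_derivative)
  have "e' 0 t = blinfun_apply (rhs\<xi> t) (\<eta> t) + blinfun_apply (D\<xi> t) (vector_derivative \<eta> (at t within {a..b}))
      + blinfun_apply (\<kappa> t) (rhs\<nu> t) + blinfun_apply (vector_derivative \<kappa> (at t within {a..b})) (D\<nu> t)"
    if t: "t \<in> {a..b}" for t
  proof -
    have tT: "t \<in> T" "t \<in> S" using t T S by auto
    have line: "smooth_on ?I (\<lambda>s. (s, t))" "(\<lambda>s. (s, t)) ` ?I \<subseteq> ?W"
      using tT by (auto intro!: smooth_intros)
    have sl: "smooth_on ?I (\<lambda>s. h (fst (s, t)) (snd (s, t)))"
      if "smooth_on ?W (\<lambda>z. h (fst z) (snd z))" for h :: "real \<Rightarrow> real \<Rightarrow> 'x::real_normed_vector"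
      by (rule smooth_on_compose[OF that W _ line(2,1)]) simp
    have "smooth_map_on vec_atlas ?I (atlas G) (\<lambda>s. gs (fst (s, t)) (snd (s, t)))"
      by (rule smooth_map_on_precompose[OF gs chart_cover_G _ line]) simp
    then have "((\<lambda>s. E (gs s t) (\<mu>s s t) (\<xi>s s t) (\<nu>s s t)) has_vector_derivative
      dE t (\<eta> t, \<kappa> t + ad_dual G (\<eta> t) (\<mu> t),
        vector_derivative \<eta> (at t within {a..b}) + ad G (\<xi> t) (\<eta> t),
        vector_derivative \<kappa> (at t within {a..b}) + ad_dual G (\<eta> t) (\<nu> t) - ad_dual G (\<xi> t) (\<kappa> t), 0)) (at 0)"
      using \<epsilon> init[OF t] sl[OF \<mu>s] sl[OF \<xi>s] sl[OF \<nu>s] gen[unfolded generated_by_def, rule_format, OF t]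
      by (intro variation_has_derivative[of ?I] tT) simp_all
    moreover have "((\<lambda>s. E (gs s t) (\<mu>s s t) (\<xi>s s t) (\<nu>s s t)) has_vector_derivative e' 0 t) (at 0)"
      using e'[of 0 t] \<epsilon> tT by (simp add: e_def)
    ultimately show ?thesis
      unfolding dE_variation[OF tT(1)] by (rule vector_derivative_unique_at[rotated])
  qed
  then have "integral {a..b} (e' 0) = integral {a..b} (\<lambda>t. blinfun_apply (rhs\<xi> t) (\<eta> t)
      + blinfun_apply (D\<xi> t) (vector_derivative \<eta> (at t within {a..b}))
      + blinfun_apply (\<kappa> t) (rhs\<nu> t)
      + blinfun_apply (vector_derivative \<kappa> (at t within {a..b})) (D\<nu> t))"
    by (rule integral_cong)
  also obtain A B where A: "{a..b} \<subseteq> A" "smooth_on A \<eta>" "{a..b} \<subseteq> B" "smooth_on B \<kappa>"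
    using \<eta>(1) \<kappa>(1) unfolding smooth_curve_def smooth_map_on_vec_vec by blast
  then have "integral {a..b} (\<lambda>t. blinfun_apply (rhs\<xi> t) (\<eta> t)
      + blinfun_apply (D\<xi> t) (vector_derivative \<eta> (at t within {a..b}))
      + blinfun_apply (\<kappa> t) (rhs\<nu> t)
      + blinfun_apply (vector_derivative \<kappa> (at t within {a..b})) (D\<nu> t)) =
      integral {a..b} (\<lambda>t. blinfun_apply (defect\<xi> t) (\<eta> t) + blinfun_apply (\<kappa> t) (defect\<nu> t))"
    using \<eta> \<kappa> by (intro boundary_terms_vanish[of "A \<inter> B"]) (auto intro: smooth_on_subset)
  finally show ?thesis using D by simp
qed

text \<open>The vector variables move along straight lines with the prescribed slope. The group
  variable is \<open>g t\<close> multiplied from the left by a straight line through the identity in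
  its chart, so its right translated velocity is \<eta>.\<close>

lemma variation_exists:
  assumes \<eta>: "smooth_on T \<eta>" and \<kappa>: "smooth_on T \<kappa>"
  obtains gs \<mu>s \<xi>s \<nu>s where "smooth_variation G a b g \<mu> \<xi> \<nu> gs \<mu>s \<xi>s \<nu>s"
    "generated_by G a b g \<mu> \<xi> \<nu> gs \<mu>s \<xi>s \<nu>s \<eta> \<kappa>"
proof -
  obtain r where r: "0 < r" "ball epoint r \<subseteq> eimg" using openE[OF open_eimg epoint_in_eimg] by blast
  have "bounded (\<eta> ` {a..b})"
    by (intro compact_imp_bounded compact_continuous_image continuous_on_subset[OF smooth_on_continuous_on[OF \<eta>] T]) auto
  then obtain M where M: "0 < M" "\<And>t. t \<in> {a..b} \<Longrightarrow> norm (\<eta> t) < M"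
    unfolding bounded_pos_less by auto
  \<comment> \<open>The bound M holds on the compact interval; restricting T to the open set where
    it still holds makes one parameter range serve all times.\<close>
  define S where "S = T \<inter> (\<lambda>t. norm (\<eta> t)) -` {..<M}"
  have S: "open S" unfolding S_def
    by (intro continuous_open_preimage continuous_on_norm smooth_on_continuous_on \<eta> open_T open_lessThan)
  have abS: "{a..b} \<subseteq> S" using T M(2) by (auto simp: S_def)
  have ST: "S \<subseteq> T" by (auto simp: S_def)
  \<comment> \<open>For |s| < r/M the displacement s \<eta>(t) is shorter than r and stays inside
    the chart image.\<close>
  define \<epsilon> where "\<epsilon> = r / M"
  have \<epsilon>: "0 < \<epsilon>" using r M by (simp add: \<epsilon>_def)
  have small: "epoint + s *\<^sub>R \<eta> t \<in> eimg" if "s \<in> {-\<epsilon><..<\<epsilon>}" "t \<in> S" for s t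
  proof -
    have "norm (s *\<^sub>R \<eta> t) \<le> \<bar>s\<bar> * M" using that(2) by (auto simp: S_def intro: mult_left_mono)
    also have "\<dots> < \<epsilon> * M" using that(1) M by (intro mult_strict_right_mono) auto
    also have "\<dots> = r" using M by (simp add: \<epsilon>_def)
    finally show ?thesis using r(2) by (auto simp: dist_norm)
  qed
  let ?d\<eta> = "\<lambda>t. frechet_derivative \<eta> (at t) 1" and ?d\<kappa> = "\<lambda>t. frechet_derivative \<kappa> (at t) 1"
  define gs where "gs s t = eparam (epoint + s *\<^sub>R \<eta> t) \<otimes> g t" for s t
  define \<mu>s where "\<mu>s s t = \<mu> t + s *\<^sub>R (\<kappa> t + ad_dual G (\<eta> t) (\<mu> t))" for s t
  define \<xi>s where "\<xi>s s t = \<xi> t + s *\<^sub>R (?d\<eta> t + ad G (\<xi> t) (\<eta> t))" for s t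
  define \<nu>s where "\<nu>s s t = \<nu> t + s *\<^sub>R (?d\<kappa> t + ad_dual G (\<eta> t) (\<nu> t) - ad_dual G (\<xi> t) (\<kappa> t))" for s t
  let ?I = "{-\<epsilon><..<\<epsilon>}"
  let ?W = "?I \<times> S"
  have W: "open ?W" using S by (simp add: open_Times)
  have sm: "smooth_on ?W (\<lambda>z. f (snd z))" if "smooth_on T f" for f :: "real \<Rightarrow> 'x::real_normed_vector"
    by (rule smooth_on_compose[OF that open_T W]) (use ST W in \<open>auto intro!: smooth_intros\<close>)
  have gs: "smooth_map_on vec_atlas ?W (atlas G) (\<lambda>z. gs (fst z) (snd z))"
    unfolding gs_def
  proof (intro smooth_mult_on smooth_eparam_on W)
    show "smooth_on ?W (\<lambda>z. epoint + fst z *\<^sub>R \<eta> (snd z))"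
      by (intro smooth_intros sm \<eta> W)
    show "(\<lambda>z. epoint + fst z *\<^sub>R \<eta> (snd z)) ` ?W \<subseteq> eimg" using small by auto
    show "smooth_map_on vec_atlas ?W (atlas G) (\<lambda>z. g (snd z))"
      by (rule smooth_map_on_precompose[OF g chart_cover_G W]) (use ST W in \<open>auto intro!: smooth_intros\<close>)
  qed
  have "smooth_map_on vec_atlas ?W vec_atlas (\<lambda>z. (\<mu>s (fst z) (snd z), \<xi>s (fst z) (snd z), \<nu>s (fst z) (snd z)))"
    unfolding smooth_map_on_vec_vec \<mu>s_def \<xi>s_def \<nu>s_def
    by (intro conjI smooth_intros smooth_on_ad smooth_on_ad_dual sm smooth_on_directional \<eta> \<kappa> smooth_\<mu> smooth_\<xi> smooth_\<nu> W)
  from smooth_map_on_Pair[OF gs this chart_cover_G chart_cover_vec]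
  have "smooth_map_on vec_atlas ?W (prod_atlas (atlas G) vec_atlas) (\<lambda>(s, t). (gs s t, \<mu>s s t, \<xi>s s t, \<nu>s s t))"
    by (simp add: split_def)
  then have var: "smooth_variation G a b g \<mu> \<xi> \<nu> gs \<mu>s \<xi>s \<nu>s"
    unfolding smooth_variation_def using \<epsilon> S abS
    by (intro conjI exI[of _ \<epsilon>] exI[of _ S]) (auto simp: gs_def \<mu>s_def \<xi>s_def \<nu>s_def)
  have vd: "vector_derivative (\<lambda>s. u + s *\<^sub>R v) (at 0) = v" for u v :: "'x::real_normed_vector"
    by (rule vector_derivative_at) (auto intro!: derivative_eq_intros)
  have "generated_by G a b g \<mu> \<xi> \<nu> gs \<mu>s \<xi>s \<nu>s \<eta> \<kappa>"
    unfolding generated_by_def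
  proof (intro ballI conjI)
    fix t assume t: "t \<in> {a..b}"
    then have tS: "t \<in> S" "t \<in> T" using abS T by auto
    note D = smooth_on_vector_derivative_within(2)[OF _ T ab t]
    show "vector_derivative (\<lambda>s. \<mu>s s t) (at 0) = \<kappa> t + ad_dual G (\<eta> t) (\<mu> t)"
      "vector_derivative (\<lambda>s. \<xi>s s t) (at 0) = vector_derivative \<eta> (at t within {a..b}) + ad G (\<xi> t) (\<eta> t)"
      "vector_derivative (\<lambda>s. \<nu>s s t) (at 0) =
        vector_derivative \<kappa> (at t within {a..b}) + ad_dual G (\<eta> t) (\<nu> t) - ad_dual G (\<xi> t) (\<kappa> t)"
      unfolding \<mu>s_def \<xi>s_def \<nu>s_def vd D[OF \<eta>] D[OF \<kappa>] by (rule refl)+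
    have "smooth_map_on vec_atlas ?I (atlas G) (\<lambda>s. gs (fst (s, t)) (snd (s, t)))"
      by (rule smooth_map_on_precompose[OF gs chart_cover_G]) (use tS in \<open>auto intro!: smooth_intros\<close>)
    then have c: "smooth_map_on vec_atlas ?I (atlas G) (\<lambda>s. gs s t)" by simp
    have gs0: "gs 0 t = g t" by (simp add: gs_def)
    have "((\<lambda>s. epoint + s *\<^sub>R \<eta> t) has_vector_derivative \<eta> t) (at 0)"
      by (auto intro!: derivative_eq_intros)
    then have "((\<lambda>s. echart (gs s t \<otimes> inv gs 0 t)) has_vector_derivative \<eta> t) (at 0)"
      by (rule has_vector_derivative_transform_within_open[of _ _ _ ?I])
        (use \<epsilon> small[OF _ tS(1)] in \<open>auto simp: gs_def m_assoc\<close>)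
    from velocity_right_translation[OF c _ this]
    show "velocity (atlas G) (\<lambda>s. gs s t) 0 = TR G (g t) (\<eta> t)" using \<epsilon> gs0 by simp
  qed
  with var show thesis by (rule that)
qed

lemma extremal_iff_defects:
  "extremal G E a b g \<mu> \<xi> \<nu> \<longleftrightarrow> (\<forall>t\<in>{a..b}. defect\<xi> t = 0 \<and> defect\<nu> t = 0)"
proof
  assume "\<forall>t\<in>{a..b}. defect\<xi> t = 0 \<and> defect\<nu> t = 0"
  then have zero: "integral {a..b} (\<lambda>t. blinfun_apply (defect\<xi> t) (\<eta> t) + blinfun_apply (\<kappa> t) (defect\<nu> t)) = 0"
    for \<eta> \<kappa>
    by (intro integral_unique has_integral_is_0) auto
  show "extremal G E a b g \<mu> \<xi> \<nu>"
    unfolding extremal_def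
  proof (intro allI impI)
    fix gs \<mu>s \<xi>s \<nu>s \<eta> \<kappa>
    assume "smooth_variation G a b g \<mu> \<xi> \<nu> gs \<mu>s \<xi>s \<nu>s" "smooth_curve vec_atlas a b \<eta>" "\<eta> a = 0" "\<eta> b = 0"
      "smooth_curve vec_atlas a b \<kappa>" "\<kappa> a = 0" "\<kappa> b = 0" "generated_by G a b g \<mu> \<xi> \<nu> gs \<mu>s \<xi>s \<nu>s \<eta> \<kappa>"
    then show "((\<lambda>s. action E a b (gs s) (\<mu>s s) (\<xi>s s) (\<nu>s s)) has_real_derivative 0) (at 0)"
      using action_variation[of gs \<mu>s \<xi>s \<nu>s \<eta> \<kappa>] unfolding zero by blast
  qed
next
  assume ext: "extremal G E a b g \<mu> \<xi> \<nu>"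
  \<comment> \<open>A sum of squares that vanishes only where both defects do.\<close>
  define sq where "sq t = (\<Sum>i\<in>Basis. (blinfun_apply (defect\<xi> t) i)\<^sup>2) + defect\<nu> t \<bullet> defect\<nu> t" for t
  define w where "w t = (t - a) * (b - t)" for t
  \<comment> \<open>The defects change places: the Euclidean inner product turns the functional
    \<open>defect\<xi>\<close> into a vector for \<eta> and the vector \<open>defect\<nu>\<close>
    into a functional for \<kappa>. Both pairings then become squares.\<close>
  define \<eta> where "\<eta> t = w t *\<^sub>R (\<Sum>i\<in>Basis. blinfun_apply (defect\<xi> t) i *\<^sub>R i)" for t
  define \<kappa> where "\<kappa> t = w t *\<^sub>R blinfun_inner_right (defect\<nu> t)" for t
  have w: "smooth_on T w" unfolding w_def by (intro smooth_intros open_T)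
  have \<eta>: "smooth_on T \<eta>" unfolding \<eta>_def
    by (intro smooth_on_scaleR smooth_on_sum smooth_on_const w open_T
      smooth_on_bounded_linear[OF blinfun.bounded_linear_left] smooth_on_defects) simp
  have \<kappa>: "smooth_on T \<kappa>" unfolding \<kappa>_def
    by (intro smooth_on_scaleR w open_T smooth_on_bounded_linear[OF bounded_linear_blinfun_inner_right] smooth_on_defects)
  have curves: "smooth_curve vec_atlas a b \<eta>" "smooth_curve vec_atlas a b \<kappa>"
    using \<eta> \<kappa> T by (auto simp: smooth_curve_def smooth_map_on_vec_vec intro!: exI[of _ T])
  have ends: "\<eta> a = 0" "\<eta> b = 0" "\<kappa> a = 0" "\<kappa> b = 0" by (simp_all add: \<eta>_def \<kappa>_def w_def)
  obtain gs \<mu>s \<xi>s \<nu>s where v: "smooth_variation G a b g \<mu> \<xi> \<nu> gs \<mu>s \<xi>s \<nu>s"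
    "generated_by G a b g \<mu> \<xi> \<nu> gs \<mu>s \<xi>s \<nu>s \<eta> \<kappa>"
    by (rule variation_exists[OF \<eta> \<kappa>])
  have "((\<lambda>s. action E a b (gs s) (\<mu>s s) (\<xi>s s) (\<nu>s s)) has_real_derivative 0) (at 0)"
    using ext v curves ends unfolding extremal_def by blast
  from DERIV_unique[OF action_variation[OF v curves(1) ends(1,2) curves(2) ends(3,4)] this]
  have int: "integral {a..b} (\<lambda>t. blinfun_apply (defect\<xi> t) (\<eta> t) + blinfun_apply (\<kappa> t) (defect\<nu> t)) = 0" .
  have wsq: "blinfun_apply (defect\<xi> t) (\<eta> t) + blinfun_apply (\<kappa> t) (defect\<nu> t) = w t * sq t" for t
    by (simp add: \<eta>_def \<kappa>_def sq_def blinfun.scaleR_left blinfun.scaleR_right blinfun.sum_right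
      power2_eq_square distrib_left)
  have cont: "continuous_on {a..b} defect\<xi>" "continuous_on {a..b} defect\<nu>"
    using continuous_on_subset[OF smooth_on_continuous_on[OF smooth_on_defects(1)] T]
      continuous_on_subset[OF smooth_on_continuous_on[OF smooth_on_defects(2)] T] .
  have "continuous_on {a..b} (\<lambda>t. w t * sq t)"
    unfolding sq_def w_def by (intro continuous_intros cont)
  moreover have "0 \<le> w t * sq t" if "t \<in> {a..b}" for t
    using that by (auto simp: w_def sq_def intro!: mult_nonneg_nonneg add_nonneg_nonneg sum_nonneg)
  moreover have "integral {a..b} (\<lambda>t. w t * sq t) = 0" using int by (simp add: wsq)
  ultimately have zero: "w t * sq t = 0" if "t \<in> {a..b}" for t
    using integral_eq_0_iff[of a b "\<lambda>t. w t * sq t"] ab that by auto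
  have inner0: "defect\<xi> t = 0 \<and> defect\<nu> t = 0" if "t \<in> {a<..<b}" for t
  proof -
    have "sq t = 0" using zero[of t] that by (auto simp: w_def)
    moreover have "0 \<le> (\<Sum>i\<in>Basis. (blinfun_apply (defect\<xi> t) i)\<^sup>2)" "0 \<le> defect\<nu> t \<bullet> defect\<nu> t"
      by (auto intro: sum_nonneg)
    ultimately have "(\<Sum>i\<in>Basis. (blinfun_apply (defect\<xi> t) i)\<^sup>2) = 0" "defect\<nu> t \<bullet> defect\<nu> t = 0"
      unfolding sq_def by linarith+
    then have "\<forall>i\<in>Basis. blinfun_apply (defect\<xi> t) i = 0" "defect\<nu> t = 0"
      by (simp_all add: sum_nonneg_eq_0_iff)
    then show ?thesis by (auto intro: blinfun_euclidean_eqI)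
  qed
  \<comment> \<open>At a and b the weight w vanishes and gives no information; there the defects
    vanish by continuity.\<close>
  have cl: "closure {a<..<b} = {a..b}" using ab by simp
  show "\<forall>t\<in>{a..b}. defect\<xi> t = 0 \<and> defect\<nu> t = 0"
  proof (intro ballI conjI)
    fix t assume t: "t \<in> {a..b}"
    show "defect\<xi> t = 0"
      by (rule continuous_constant_on_closure[of "{a<..<b}" defect\<xi>]) (use cl cont t inner0 in auto)
    show "defect\<nu> t = 0"
      by (rule continuous_constant_on_closure[of "{a<..<b}" defect\<nu>]) (use cl cont t inner0 in auto)
  qed
qed

text \<open>Derivatives within a nondegenerate interval are unique, so having the right hand side as
  derivative means that it equals the existing one.\<close>

lemma defect_zero_iff:
  assumes t: "t \<in> {a..b}"
  shows "(D\<xi> has_vector_derivative rhs\<xi> t) (at t within {a..b}) \<longleftrightarrow> defect\<xi> t = 0"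
    and "(D\<nu> has_vector_derivative rhs\<nu> t) (at t within {a..b}) \<longleftrightarrow> defect\<nu> t = 0"
proof -
  have "(f has_vector_derivative v) (at t within {a..b}) \<longleftrightarrow> v - frechet_derivative f (at t) 1 = 0"
    if "smooth_on T f" for f :: "real \<Rightarrow> 'x::real_normed_vector" and v
  proof
    assume "(f has_vector_derivative v) (at t within {a..b})"
    from vector_derivative_within_cbox[unfolded box_real, OF ab t this] show "v - frechet_derivative f (at t) 1 = 0"
      using smooth_on_vector_derivative_within(2)[OF that T ab t] by simp
  next
    assume "v - frechet_derivative f (at t) 1 = 0"
    then show "(f has_vector_derivative v) (at t within {a..b})"
      using smooth_on_vector_derivative_within[OF that T ab t] by simp
  qed
  from this[OF smooth_on_partials(3)] this[OF smooth_on_partials(4)]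
  show "(D\<xi> has_vector_derivative rhs\<xi> t) (at t within {a..b}) \<longleftrightarrow> defect\<xi> t = 0"
    "(D\<nu> has_vector_derivative rhs\<nu> t) (at t within {a..b}) \<longleftrightarrow> defect\<nu> t = 0"
    by (simp_all add: defect\<xi>_def defect\<nu>_def)
qed

lemma extremal_iff:
  "extremal G E a b g \<mu> \<xi> \<nu> \<longleftrightarrow>
    (\<forall>t\<in>{a..b}. (D\<xi> has_vector_derivative rhs\<xi> t) (at t within {a..b}) \<and>
      (D\<nu> has_vector_derivative rhs\<nu> t) (at t within {a..b}))"
  using extremal_iff_defects defect_zero_iff by simp

end

theorem mainTheorem19:
  fixes G :: "('g::{t2_space, second_countable_topology}, 'v::euclidean_space, 'z) lie_struct_scheme"
    and E :: "('g, 'v) lagrangian"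
    and a b :: real
    and g :: "real \<Rightarrow> 'g" and \<mu> :: "real \<Rightarrow> 'v dual" and \<xi> :: "real \<Rightarrow> 'v" and \<nu> :: "real \<Rightarrow> 'v dual"
  assumes "lie_group G"
    and "smooth_lagrangian G E"
    and "a < b"
    and "smooth_curve (atlas G) a b g"
    and "smooth_curve vec_atlas a b \<mu>"
    and "smooth_curve vec_atlas a b \<xi>"
    and "smooth_curve vec_atlas a b \<nu>"
  shows "extremal G E a b g \<mu> \<xi> \<nu> \<longleftrightarrow>
    (\<forall>t\<in>{a..b}.
       ((\<lambda>t. d_xi E (g t) (\<mu> t) (\<xi> t) (\<nu> t)) has_vector_derivative
          TR_dual G (g t) (d_g G E (g t) (\<mu> t) (\<xi> t) (\<nu> t))
          - ad_dual G (d_mu E (g t) (\<mu> t) (\<xi> t) (\<nu> t)) (\<mu> t)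
          + ad_dual G (\<xi> t) (d_xi E (g t) (\<mu> t) (\<xi> t) (\<nu> t))
          - ad_dual G (d_nu E (g t) (\<mu> t) (\<xi> t) (\<nu> t)) (\<nu> t)) (at t within {a..b}) \<and>
       ((\<lambda>t. d_nu E (g t) (\<mu> t) (\<xi> t) (\<nu> t)) has_vector_derivative
          d_mu E (g t) (\<mu> t) (\<xi> t) (\<nu> t)
          - ad G (\<xi> t) (d_nu E (g t) (\<mu> t) (\<xi> t) (\<nu> t))) (at t within {a..b}))"
proof -
  interpret lie_group G by fact
  obtain A B C D where T: "{a..b} \<subseteq> A" "smooth_map_on vec_atlas A (atlas G) g"
    "{a..b} \<subseteq> B" "smooth_map_on vec_atlas B vec_atlas \<mu>" "{a..b} \<subseteq> C" "smooth_map_on vec_atlas C vec_atlas \<xi>"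
    "{a..b} \<subseteq> D" "smooth_map_on vec_atlas D vec_atlas \<nu>"
    using assms(4-7) unfolding smooth_curve_def by blast
  then have o: "open A" "open B" "open C" "open D" by (auto dest: smooth_map_on_vec_open)
  \<comment> \<open>Each curve is smooth on a neighbourhood of its own; the locale takes their
    intersection for T.\<close>
  interpret lagrangian_curve G E a b "A \<inter> B \<inter> C \<inter> D" g \<mu> \<xi> \<nu>
    using assms(2,3) T o
    by unfold_locales (auto simp: smooth_map_on_vec_vec intro: smooth_on_subset smooth_map_on_subset[of A])
  show ?thesis using extremal_iff unfolding rhs\<xi>_def rhs\<nu>_def .
qed

end
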